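(* Let $n$ be a positive integer and let $F_n$ denote the free group of rank $n$. Then the space $\mathrm{CO}(F_n)$ of left-invariant circular orders on $F_n$ has an isolated point (i.e. $F_n$ admits an isolated circular order) if and only if $n$ is even.
   Context: A left-invariant circular order on a group $G$ is a function $c:G\times G\times G\to\{0,1,-1\}$ such that: (1) $c(\gamma g_0,\gamma g_1,\gamma g_2)=c(g_0,g_1,g_2)$ for all $\gamma,g_0,g_1,g_2\in G$; (2) $c(g_1,g_2,g_3)-c(g_0,g_2,g_3)+c(g_0,g_1,g_3)-c(g_0,g_1,g_2)=0$ for all $g_0,g_1,g_2,g_3\in G$; (3) $c(g_0,g_1,g_2)=0$ if and only if $g_i=g_j$ for some $i\neq j$. The space $\mathrm{CO}(G)$ is the set of all left-invariant circular orders on $G$, with the subspace topology from $\{0,1,-1\}^{G\times G\times G}$ with the product topology (each factor discrete). An isolated circular order is an isolated point of $\mathrm{CO}(G)$. *)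

theory Defs
  imports "HOL-Analysis.Function_Topology" "HOL-Algebra.Group"
begin

section \<open>Free groups as groups of reduced words\<close>

text \<open>
  The letter \<open>(s, False)\<close> is the generator \<open>s\<close>, and \<open>(s, True)\<close> is its formal inverse.
  HOL-Algebra has only free \<^emph>\<open>abelian\<close> groups. For reduced \<open>w\<close>, \<open>push x w\<close> is the reduced form of
  \<open>x # w\<close>, so \<open>foldr push u v\<close> is the reduced form of \<open>u @ v\<close>.
\<close>

type_synonym 'a letter = "'a \<times> bool"

definition flip :: "'a letter \<Rightarrow> 'a letter"
  where "flip x = (fst x, \<not> snd x)"

definition reduced :: "'a letter list \<Rightarrow> bool"
  where "reduced w \<longleftrightarrow> successively (\<lambda>x y. y \<noteq> flip x) w"

fun push :: "'a letter \<Rightarrow> 'a letter list \<Rightarrow> 'a letter list" where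
  "push x [] = [x]"
| "push x (y # w) = (if y = flip x then w else x # y # w)"

definition free_group :: "'a set \<Rightarrow> 'a letter list monoid"
  where "free_group S =
    \<lparr>carrier = {w. reduced w \<and> set w \<subseteq> S \<times> UNIV},
     mult = (\<lambda>u v. foldr push u v),
     one = []\<rparr>"

lemma flip_flip [simp]: "flip (flip x) = x"
  by (simp add: flip_def)

lemma fst_flip [simp]: "fst (flip x) = fst x"
  by (simp add: flip_def)

lemma flip_neq [simp]: "flip x \<noteq> x" "x \<noteq> flip x"
  by (cases x; simp add: flip_def)+

lemma reduced_Nil [simp]: "reduced []"
  by (simp add: reduced_def)

lemma reduced_Cons: "reduced (x # w) \<longleftrightarrow> reduced w \<and> (w \<noteq> [] \<longrightarrow> hd w \<noteq> flip x)"
  by (cases w) (auto simp: reduced_def)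

lemma reduced_push: "reduced w \<Longrightarrow> reduced (push x w)"
  by (cases w) (auto simp: reduced_Cons)

lemma push_reduced: "reduced (x # w) \<Longrightarrow> push x w = x # w"
  by (cases w) (auto simp: reduced_Cons)

lemma push_flip_push: "reduced w \<Longrightarrow> push (flip x) (push x w) = w"
  by (cases w) (auto simp: push_reduced)

lemma push_push_flip: "reduced w \<Longrightarrow> push x (push (flip x) w) = w"
  using push_flip_push[of w "flip x"] by simp

lemma reduced_foldr_push: "reduced v \<Longrightarrow> reduced (foldr push u v)"
  by (induction u) (auto intro: reduced_push)

lemma set_push: "set (push x w) \<subseteq> insert x (set w)"
  by (cases w) auto

lemma set_foldr_push: "set (foldr push u v) \<subseteq> set u \<union> set v"
proof (induction u)
  case (Cons x u)
  then show ?case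
    using set_push[of x "foldr push u v"] by auto
qed simp

lemma foldr_push_push:
  assumes "reduced w"
  shows "foldr push (push x v) w = push x (foldr push v w)"
proof (cases v)
  case (Cons y v')
  then show ?thesis
    using push_push_flip[OF reduced_foldr_push[OF assms]] by auto
qed simp

lemma foldr_push_assoc:
  "reduced w \<Longrightarrow> foldr push (foldr push u v) w = foldr push u (foldr push v w)"
  by (induction u) (auto simp: foldr_push_push)

lemma foldr_push_Nil: "reduced u \<Longrightarrow> foldr push u [] = u"
  by (induction u) (auto simp: reduced_Cons push_reduced)

lemma foldr_push_rev: "foldr push (rev (map flip u)) u = []"
  by (induction u) auto

lemma reduced_rev_flip: "reduced u \<Longrightarrow> reduced (rev (map flip u))"
  unfolding reduced_def successively_rev successively_map
  by (erule successively_mono) (metis flip_flip)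

lemma group_free_group: "group (free_group S)"
proof (rule groupI)
  fix x assume x: "x \<in> carrier (free_group S)"
  have "rev (map flip x) \<in> carrier (free_group S)"
    using x reduced_rev_flip[of x] by (fastforce simp: free_group_def flip_def)
  moreover have "rev (map flip x) \<otimes>\<^bsub>free_group S\<^esub> x = \<one>\<^bsub>free_group S\<^esub>"
    by (simp add: free_group_def foldr_push_rev)
  ultimately show "\<exists>y\<in>carrier (free_group S). y \<otimes>\<^bsub>free_group S\<^esub> x = \<one>\<^bsub>free_group S\<^esub>"
    by blast
next
  fix x y assume "x \<in> carrier (free_group S)" "y \<in> carrier (free_group S)"
  then show "x \<otimes>\<^bsub>free_group S\<^esub> y \<in> carrier (free_group S)"
    using set_foldr_push[of x y] by (fastforce simp: free_group_def reduced_foldr_push)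
qed (auto simp: free_group_def foldr_push_assoc)

lemma free_group_universal:
  assumes "group H" and f: "f \<in> S \<rightarrow> carrier H"
  shows "\<exists>h \<in> hom (free_group S) H. (\<forall>s\<in>S. h [(s, False)] = f s) \<and>
    (\<forall>h' \<in> hom (free_group S) H. (\<forall>s\<in>S. h' [(s, False)] = f s) \<longrightarrow>
      (\<forall>w \<in> carrier (free_group S). h' w = h w))"
proof -
  interpret H: group H by fact
  interpret F: group "free_group S" by (rule group_free_group)
  define val where "val x = (if snd x then inv\<^bsub>H\<^esub> (f (fst x)) else f (fst x))" for x
  define h where "h w = foldr (\<lambda>x g. val x \<otimes>\<^bsub>H\<^esub> g) w \<one>\<^bsub>H\<^esub>" for w
  have val: "val x \<in> carrier H" if "fst x \<in> S" for x
    using that f by (auto simp: val_def)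
  have val_flip: "val x \<otimes>\<^bsub>H\<^esub> val (flip x) = \<one>\<^bsub>H\<^esub>" if "fst x \<in> S" for x
    using that f by (auto simp: val_def flip_def Pi_iff)
  have h_closed: "h w \<in> carrier H" if "set w \<subseteq> S \<times> UNIV" for w
    using that by (induction w) (auto simp: h_def intro!: H.m_closed val)
  have h_push: "h (push x w) = val x \<otimes>\<^bsub>H\<^esub> h w" if x: "fst x \<in> S" and w: "set w \<subseteq> S \<times> UNIV" for x w
  proof (cases "w \<noteq> [] \<and> hd w = flip x")
    case True
    then obtain v where v: "w = flip x # v" by (cases w) auto
    have "val x \<otimes>\<^bsub>H\<^esub> (val (flip x) \<otimes>\<^bsub>H\<^esub> h v) = h v"
      using x w v by (simp add: H.m_assoc[symmetric] val val_flip h_closed)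
    then show ?thesis by (simp add: v h_def)
  next
    case False
    then show ?thesis by (cases w) (auto simp: h_def)
  qed
  have h_mult: "h (foldr push u v) = h u \<otimes>\<^bsub>H\<^esub> h v"
    if u: "set u \<subseteq> S \<times> UNIV" and v: "set v \<subseteq> S \<times> UNIV" for u v
    using u
  proof (induction u)
    case Nil
    then show ?case using h_closed[OF v] by (simp add: h_def)
  next
    case (Cons x u)
    then have x: "fst x \<in> S" and u: "set u \<subseteq> S \<times> UNIV" by auto
    have "h (push x (foldr push u v)) = val x \<otimes>\<^bsub>H\<^esub> h (foldr push u v)"
      using set_foldr_push[of u v] u v by (intro h_push x) blast
    also have "\<dots> = val x \<otimes>\<^bsub>H\<^esub> h u \<otimes>\<^bsub>H\<^esub> h v"
      using Cons.IH[OF u] by (simp add: H.m_assoc val x h_closed u v)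
    also have "val x \<otimes>\<^bsub>H\<^esub> h u = h (x # u)" by (simp add: h_def)
    finally show ?case by simp
  qed
  have h_hom: "h \<in> hom (free_group S) H"
    by (auto simp: hom_def free_group_def h_closed h_mult)
  have h_gen: "h [(s, False)] = f s" if "s \<in> S" for s
    using f that by (auto simp: h_def val_def Pi_iff)
  have unique: "h' w = h w"
    if h': "h' \<in> hom (free_group S) H" and gen: "\<forall>s\<in>S. h' [(s, False)] = f s"
      and w: "w \<in> carrier (free_group S)" for h' w
  proof -
    interpret h': group_hom "free_group S" H h'
      by unfold_locales (rule h')
    have letter: "h' [x] = val x" if x: "fst x \<in> S" for x
    proof (cases "snd x")
      case False
      then show ?thesis using gen x by (cases x) (auto simp: val_def)
    next
      case True
      then obtain s where s: "x = (s, True)" "s \<in> S" using x by (cases x) auto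
      have c: "[(s, False)] \<in> carrier (free_group S)" "[(s, True)] \<in> carrier (free_group S)"
        using s by (auto simp: free_group_def reduced_def)
      have "[(s, True)] \<otimes>\<^bsub>free_group S\<^esub> [(s, False)] = \<one>\<^bsub>free_group S\<^esub>"
        by (simp add: free_group_def flip_def)
      then have "[(s, True)] = inv\<^bsub>free_group S\<^esub> [(s, False)]"
        using F.inv_equality c by metis
      then show ?thesis using s gen c by (simp add: val_def)
    qed
    show ?thesis
      using w
    proof (induction w)
      case Nil
      then show ?case using h'.hom_one by (simp add: free_group_def h_def)
    next
      case (Cons x w)
      then have x: "fst x \<in> S" and xc: "[x] \<in> carrier (free_group S)"
        and wc: "w \<in> carrier (free_group S)" and red: "reduced (x # w)"
        by (auto simp: free_group_def reduced_Cons)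
      have "x # w = [x] \<otimes>\<^bsub>free_group S\<^esub> w"
        by (simp add: free_group_def push_reduced[OF red])
      then have "h' (x # w) = h' [x] \<otimes>\<^bsub>H\<^esub> h' w"
        using h'.hom_mult[OF xc wc] by simp
      then show ?case using letter[OF x] Cons.IH[OF wc] by (simp add: h_def)
    qed
  qed
  show ?thesis
    using h_hom h_gen unique by blast
qed

section \<open>Left-invariant circular orders\<close>

text \<open>
  A circular order is a function on triples of group elements only; it is represented as an
  \<^emph>\<open>extensional\<close> function (\<open>undefined\<close> off the carrier), so that distinct representatives are
  distinct points of the product space.
\<close>

definition circular_orders :: "('a, 'b) monoid_scheme \<Rightarrow> ('a \<times> 'a \<times> 'a \<Rightarrow> int) set"
  where "circular_orders G =
    {c \<in> (carrier G \<times> carrier G \<times> carrier G) \<rightarrow>\<^sub>E {0, 1, -1}.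
      (\<forall>\<gamma>\<in>carrier G. \<forall>g0\<in>carrier G. \<forall>g1\<in>carrier G. \<forall>g2\<in>carrier G.
         c (\<gamma> \<otimes>\<^bsub>G\<^esub> g0, \<gamma> \<otimes>\<^bsub>G\<^esub> g1, \<gamma> \<otimes>\<^bsub>G\<^esub> g2) = c (g0, g1, g2)) \<and>
      (\<forall>g0\<in>carrier G. \<forall>g1\<in>carrier G. \<forall>g2\<in>carrier G. \<forall>g3\<in>carrier G.
         c (g1, g2, g3) - c (g0, g2, g3) + c (g0, g1, g3) - c (g0, g1, g2) = 0) \<and>
      (\<forall>g0\<in>carrier G. \<forall>g1\<in>carrier G. \<forall>g2\<in>carrier G.
         c (g0, g1, g2) = 0 \<longleftrightarrow> g0 = g1 \<or> g0 = g2 \<or> g1 = g2)}"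

definition CO :: "('a, 'b) monoid_scheme \<Rightarrow> ('a \<times> 'a \<times> 'a \<Rightarrow> int) topology"
  where "CO G =
    subtopology
      (product_topology (\<lambda>_. discrete_topology {0, 1, -1}) (carrier G \<times> carrier G \<times> carrier G))
      (circular_orders G)"

lemma topspace_CO: "topspace (CO G) = circular_orders G"
  by (auto simp: CO_def circular_orders_def)

definition isolated_point :: "'a topology \<Rightarrow> 'a \<Rightarrow> bool"
  where "isolated_point X x \<longleftrightarrow> x \<in> topspace X \<and> openin X {x}"

end

theory Submission
  imports Defs "HOL-Combinatorics.Permutations"
begin

text \<open>
  For even \<open>n\<close>, embed the Cayley tree in the plane in such a way that the associated ribbon graph has a single
  boundary component. In the circular order induced on the vertices, the words starting with a given letter
  form an interval with a first and a last element, and the ping-pong relations between finitely many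
  endpoints determine the order.

  Conversely, let \<open>c\<close> be determined by its restriction to a finite set, and let \<open>B\<close> be a finite suffix-closed
  set containing it. The constraints of \<open>B\<close> on the generators can be realized by an action on the circle. If they
  left enough freedom, some realization would give the base point a nontrivial stabilizer, and breaking ties
  by a left order on the free group or by its reverse would produce two circular orders that agree on \<open>B\<close>.
  Hence all group elements in one gap of \<open>B\<close> have the same first letter. By counting the edges of the tree
  \<open>B\<close>, some gap is empty, so \<open>1\<close> has an immediate successor \<open>t\<close>. The first letter changes from \<open>g\<close> to \<open>g t\<close> only
  if \<open>g\<close> is the inverse of a prefix of \<open>t\<close>, so that the circle is cut into arcs of constant first letter, one
  for each letter of \<open>t\<close>. The permutation of the positions of \<open>t\<close> that glues arcs is a product of two cycles of
  the same length, hence even; it also has exactly one cycle, of even length, for each generator.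
\<close>

section \<open>Circular orders on sets\<close>

text \<open>Two trees on the reduced words occur. Left translations preserve the one with edges from
  \<open>g\<close> to \<open>g x\<close>; it carries the explicit order. Finite approximations live
  on the one with edges from \<open>w\<close> to \<open>x w\<close>: on a suffix-closed set each
  generator is a partial injection, and since the group is free, these partial maps can be extended
  to the circle independently of each other. The freedom that remains in the extensions is what
  isolation forbids.

  A word enters such a set only together with all its suffixes. Hence the statement on first letters
  is proved for the elements of a gap that are minimal under suffixes before an induction on length
  reaches the others.

  The parity has a topological source: a compact orientable surface of genus \<open>h\<close> with
  one boundary component has a free fundamental group of rank \<open>2 h\<close>. For even
  \<open>n\<close> this surface is visible in the ribbon graph; in the converse no surface is built,
  and the sign of the gluing permutation takes the place of the Euler characteristic.\<close>

locale cyclic_order =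
  fixes X :: "'a set" and c :: "'a \<times> 'a \<times> 'a \<Rightarrow> int"
  assumes val: "\<lbrakk>a \<in> X; b \<in> X; d \<in> X\<rbrakk> \<Longrightarrow> c (a, b, d) \<in> {0, 1, -1}"
    and cocycle: "\<lbrakk>a \<in> X; b \<in> X; d \<in> X; e \<in> X\<rbrakk> \<Longrightarrow>
      c (b, d, e) - c (a, d, e) + c (a, b, e) - c (a, b, d) = 0"
    and zero_iff: "\<lbrakk>a \<in> X; b \<in> X; d \<in> X\<rbrakk> \<Longrightarrow> c (a, b, d) = 0 \<longleftrightarrow> a = b \<or> a = d \<or> b = d"
begin

lemma swap12: "\<lbrakk>a \<in> X; b \<in> X; d \<in> X\<rbrakk> \<Longrightarrow> c (b, a, d) = - c (a, b, d)"
  using cocycle[of a b a d] zero_iff[of a a d] zero_iff[of a b a] by auto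

lemma swap23: "\<lbrakk>a \<in> X; b \<in> X; d \<in> X\<rbrakk> \<Longrightarrow> c (a, d, b) = - c (a, b, d)"
  using cocycle[of a b d b] zero_iff[of a b b] zero_iff[of b d b] by auto

lemma rot: "\<lbrakk>a \<in> X; b \<in> X; d \<in> X\<rbrakk> \<Longrightarrow> c (b, d, a) = c (a, b, d)"
  using swap12[of a b d] swap23[of b a d] by simp

abbreviation btw :: "'a \<Rightarrow> 'a \<Rightarrow> 'a \<Rightarrow> bool"
  where "btw a b d \<equiv> c (a, b, d) = 1"

lemma btw_rot: "\<lbrakk>btw a b d; a \<in> X; b \<in> X; d \<in> X\<rbrakk> \<Longrightarrow> btw b d a"
  using rot[of a b d] by auto

lemma btw_distinct: "\<lbrakk>btw a b d; a \<in> X; b \<in> X; d \<in> X\<rbrakk> \<Longrightarrow> a \<noteq> b \<and> a \<noteq> d \<and> b \<noteq> d"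
  using zero_iff[of a b d] by auto

lemma btw_asym: "\<lbrakk>btw a b d; a \<in> X; b \<in> X; d \<in> X\<rbrakk> \<Longrightarrow> \<not> btw a d b"
  using swap23[of a b d] by auto

lemma btw_total: "\<lbrakk>a \<noteq> b; a \<noteq> d; b \<noteq> d; a \<in> X; b \<in> X; d \<in> X\<rbrakk> \<Longrightarrow> btw a b d \<or> btw a d b"
  using val[of a b d] zero_iff[of a b d] swap23[of a b d] by auto

lemma btw_trans:
  "\<lbrakk>btw a b d; btw a d e; a \<in> X; b \<in> X; d \<in> X; e \<in> X\<rbrakk> \<Longrightarrow> btw a b e"
  using cocycle[of a b d e] val[of b d e] val[of a b e] by auto

lemma btw_trans':
  "\<lbrakk>btw a b d; btw a d e; a \<in> X; b \<in> X; d \<in> X; e \<in> X\<rbrakk> \<Longrightarrow> btw b d e"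
  using cocycle[of a b d e] btw_trans[of a b d e] by auto

text \<open>By the cocycle identity, replacing \<open>g\<close> by \<open>h\<close> changes the
  value on \<open>(b, d)\<close> by the difference of the positions of \<open>d\<close> and
  \<open>b\<close> relative to \<open>g\<close> and \<open>h\<close>. A change therefore puts
  \<open>b\<close> and \<open>d\<close> on different arcs between \<open>g\<close> and
  \<open>h\<close>.\<close>

lemma same_side:
  assumes "a \<in> X" "g \<in> X" "h \<in> X" "b \<in> X" "d \<in> X" "g \<noteq> h"
    and "c (g, b, d) \<noteq> c (h, b, d)" "b \<noteq> g" "b \<noteq> h" "d \<noteq> g" "d \<noteq> h"
  shows "btw g b h \<and> btw g h d \<or> btw g d h \<and> btw g h b"
proof -
  have bd: "b \<noteq> d" using assms zero_iff[of g b b] zero_iff[of h b b] by auto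
  have "c (g, b, d) = c (h, b, d) + c (g, h, d) - c (g, h, b)"
    using cocycle[of g h b d] assms by simp
  then have "c (g, h, d) \<noteq> c (g, h, b)" using assms by auto
  moreover have "c (g, h, d) \<in> {1, -1}" "c (g, h, b) \<in> {1, -1}"
    using val zero_iff assms by (metis insert_iff)+
  ultimately show ?thesis using swap23[of g h b] swap23[of g h d] assms by auto
qed

text \<open>Encoding a gap by values of \<open>c\<close> makes it an equivalence class at once and
  lets it be transported by translations. The geometric meaning, that one of the two arcs between
  \<open>g\<close> and \<open>h\<close> misses \<open>B\<close>, is
  \<open>same_gap_iff\<close>.\<close>

definition same_gap :: "'a set \<Rightarrow> 'a \<Rightarrow> 'a \<Rightarrow> bool"
  where "same_gap B g h \<longleftrightarrow> (\<forall>b\<in>B. \<forall>d\<in>B. c (g, b, d) = c (h, b, d))"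

lemma same_gap_refl: "same_gap B g g"
  by (simp add: same_gap_def)

lemma same_gap_sym: "same_gap B g h \<Longrightarrow> same_gap B h g"
  by (simp add: same_gap_def)

lemma same_gap_trans: "same_gap B g h \<Longrightarrow> same_gap B h k \<Longrightarrow> same_gap B g k"
  by (simp add: same_gap_def)

lemma same_gap_iff:
  assumes "B \<subseteq> X" "g \<in> X - B" "h \<in> X - B"
  shows "same_gap B g h \<longleftrightarrow> \<not> (\<exists>b\<in>B. \<exists>d\<in>B. btw g b h \<and> btw g h d)"
proof
  assume same: "same_gap B g h"
  show "\<not> (\<exists>b\<in>B. \<exists>d\<in>B. btw g b h \<and> btw g h d)"
  proof
    assume "\<exists>b\<in>B. \<exists>d\<in>B. btw g b h \<and> btw g h d"
    then obtain b d where bd: "b \<in> B" "d \<in> B" "btw g b h" "btw g h d" by blast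
    then have X: "b \<in> X" "d \<in> X" "g \<in> X" "h \<in> X" using assms by auto
    have "btw g b d" using btw_trans[OF bd(3,4)] X by auto
    moreover have "btw h d b"
      using btw_trans'[OF bd(3,4)] X btw_rot[of b h d] by auto
    ultimately show False
      using same bd X btw_asym[of h d b] unfolding same_gap_def by metis
  qed
next
  assume sep: "\<not> (\<exists>b\<in>B. \<exists>d\<in>B. btw g b h \<and> btw g h d)"
  show "same_gap B g h"
    unfolding same_gap_def
  proof (intro ballI, rule ccontr)
    fix b d assume bd: "b \<in> B" "d \<in> B" "c (g, b, d) \<noteq> c (h, b, d)"
    then have "g \<noteq> h" by auto
    then have "btw g b h \<and> btw g h d \<or> btw g d h \<and> btw g h b"
      using bd assms by (intro same_side) auto
    then show False using sep bd by blast
  qed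
qed

text \<open>One of the arcs between \<open>g\<close> and \<open>h\<close> misses \<open>B\<close>
  and so lies in their gap, while two points that separate \<open>g\<close> from \<open>h\<close>
  occupy both arcs. In the degenerate case one of the separating points is \<open>g\<close> or
  \<open>h\<close> itself.\<close>

lemma gap_convex:
  assumes B: "B \<subseteq> X" and g: "g \<in> X - B" and h: "h \<in> X - B" and same: "same_gap B g h"
    and P: "P \<subseteq> X" "\<not> same_gap P g h"
  shows "\<exists>p\<in>P. p \<notin> B \<and> same_gap B g p"
proof -
  obtain p q where pq: "p \<in> P" "q \<in> P" "c (g, p, q) \<noteq> c (h, p, q)"
    using P by (auto simp: same_gap_def)
  have X: "p \<in> X" "q \<in> X" "g \<in> X" "h \<in> X" using pq P g h by auto
  consider "p = g \<or> p = h \<or> q = g \<or> q = h"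
    | "p \<noteq> g" "p \<noteq> h" "q \<noteq> g" "q \<noteq> h" by blast
  then show ?thesis
  proof cases
    case 1
    then show ?thesis using pq g h same same_gap_refl by blast
  next
    case 2
    have "g \<noteq> h" using pq by auto
    have "\<exists>u v. u \<in> P \<and> v \<in> P \<and> u \<in> X \<and> v \<in> X \<and> btw g u h \<and> btw g h v"
      using same_side[of p g h p q] pq X 2 \<open>g \<noteq> h\<close> by blast
    then obtain u v where uv: "u \<in> P" "v \<in> P" "u \<in> X" "v \<in> X" "btw g u h" "btw g h v" by blast
    have nosep: "\<not> (\<exists>b\<in>B. \<exists>d\<in>B. btw g b h \<and> btw g h d)"
      using same same_gap_iff[OF B g h] by blast
    then consider "\<forall>b\<in>B. \<not> btw g b h" | "\<forall>b\<in>B. \<not> btw g h b" by blast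
    then show ?thesis
    proof cases
      case 1
      then have u: "u \<notin> B" using uv by auto
      have "\<not> btw g b u" if "b \<in> B" for b
        using 1 that btw_trans[OF _ uv(5), of b] X uv(3) B by blast
      then have "same_gap B g u" using same_gap_iff[OF B g] u uv by blast
      then show ?thesis using u uv by blast
    next
      case 2
      then have v: "v \<notin> B" using uv by auto
      have "\<not> btw g v b" if "b \<in> B" for b
        using 2 that btw_trans[OF uv(6), of b] X uv(4) B by blast
      then have "same_gap B g v" using same_gap_iff[OF B g] v uv by blast
      then show ?thesis using v uv by blast
    qed
  qed
qed

definition right_gap :: "'a set \<Rightarrow> 'a \<Rightarrow> 'a \<Rightarrow> bool"
  where "right_gap B b g \<longleftrightarrow> g \<in> X - B \<and> (\<forall>d\<in>B. \<not> btw b d g)"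

text \<open>If \<open>g\<close> comes before \<open>h\<close> after \<open>b\<close>, the arc from
  \<open>g\<close> to \<open>h\<close> is part of the arc from \<open>b\<close> to \<open>h\<close>,
  which misses \<open>B\<close>.\<close>

lemma right_gap_same_gap:
  assumes B: "B \<subseteq> X" "b \<in> B" and g: "right_gap B b g" and h: "right_gap B b h"
  shows "same_gap B g h"
proof -
  have *: "same_gap B g h"
    if g: "right_gap B b g" and h: "right_gap B b h" and gh: "btw b g h" for g h
  proof -
    have X: "b \<in> X" "g \<in> X - B" "h \<in> X - B" using B g h by (auto simp: right_gap_def)
    have "\<not> btw g d h" if d: "d \<in> B" for d
    proof
      assume gdh: "btw g d h"
      have dX: "d \<in> X" using d B by auto
      have "btw h b g" using gh X btw_rot[of b g h] btw_rot[of g h b] by auto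
      moreover have "btw h g d" using gdh X dX btw_rot[of g d h] btw_rot[of d h g] by auto
      ultimately have "btw h b d" using btw_trans X dX by blast
      then have "btw b d h" using X dX btw_rot by blast
      then show False using h d by (auto simp: right_gap_def)
    qed
    then show ?thesis using same_gap_iff[of B g h] B X by blast
  qed
  have X: "b \<in> X" "g \<in> X - B" "h \<in> X - B" using assms by (auto simp: right_gap_def)
  consider "g = h" | "btw b g h" | "btw b h g" using X B btw_total[of b g h] by blast
  then show ?thesis
    using *[OF g h] *[OF h g] same_gap_refl same_gap_sym by cases blast+
qed

lemma right_gap_below:
  assumes "B \<subseteq> X" "b \<in> B" "right_gap B b g" "p \<in> X" "btw b p g"
  shows "right_gap B b p"
  using assms btw_trans[OF _ assms(5)] unfolding right_gap_def by blast

lemma ex_next: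
  assumes "finite S" "S \<subseteq> X" "b \<in> X" "S - {b} \<noteq> {}"
  shows "\<exists>d\<in>S - {b}. \<forall>e\<in>S. \<not> btw b e d"
proof -
  have *: "\<exists>d\<in>F. \<forall>e\<in>F. \<not> btw b e d" if "finite F" "F \<noteq> {}" "F \<subseteq> X" for F
    using that
  proof (induction F rule: finite_ne_induct)
    case (singleton x)
    then show ?case using assms(3) btw_distinct[of b x x] by auto
  next
    case (insert x F)
    then obtain d where d: "d \<in> F" "\<forall>e\<in>F. \<not> btw b e d" by auto
    have X: "x \<in> X" "d \<in> X" "F \<subseteq> X" using d insert.prems by auto
    show ?case
    proof (cases "btw b x d")
      case True
      have "\<not> btw b e x" if "e \<in> insert x F" for e
        using btw_trans[OF _ True, of e] btw_distinct[of b x x] assms(3) X that d by blast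
      then show ?thesis by blast
    next
      case False
      then show ?thesis using d by blast
    qed
  qed
  obtain d where d: "d \<in> S - {b}" "\<forall>e\<in>S - {b}. \<not> btw b e d"
    using *[of "S - {b}"] assms by auto
  have "\<not> btw b b d" using btw_distinct[of b b d] d(1) assms by auto
  then show ?thesis using d by blast
qed

end

section \<open>Words\<close>

definition words :: "'a set \<Rightarrow> 'a letter list set"
  where "words S = {w. reduced w \<and> set w \<subseteq> S \<times> UNIV}"

abbreviation mul :: "'a letter list \<Rightarrow> 'a letter list \<Rightarrow> 'a letter list"
  where "mul u v \<equiv> foldr push u v"

definition winv :: "'a letter list \<Rightarrow> 'a letter list"
  where "winv u = rev (map flip u)"

lemma flip_inj [simp]: "flip x = flip y \<longleftrightarrow> x = y"
  by (metis flip_flip)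

lemma reduced_append:
  "reduced (u @ v) \<longleftrightarrow> reduced u \<and> reduced v \<and> (u \<noteq> [] \<longrightarrow> v \<noteq> [] \<longrightarrow> hd v \<noteq> flip (last u))"
  by (auto simp: reduced_def successively_append_iff)

lemma words_Nil [simp]: "[] \<in> words S"
  by (simp add: words_def)

lemma words_Cons: "x # w \<in> words S \<longleftrightarrow> w \<in> words S \<and> fst x \<in> S \<and> (w \<noteq> [] \<longrightarrow> hd w \<noteq> flip x)"
  by (cases x) (auto simp: words_def reduced_Cons)

lemma words_append: "u @ v \<in> words S \<Longrightarrow> u \<in> words S \<and> v \<in> words S"
  by (auto simp: words_def reduced_append)

lemma push_words: "fst x \<in> S \<Longrightarrow> w \<in> words S \<Longrightarrow> push x w \<in> words S"
  using set_push[of x w] reduced_push[of w x] by (cases x) (auto simp: words_def)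

lemma mul_words: "u \<in> words S \<Longrightarrow> v \<in> words S \<Longrightarrow> mul u v \<in> words S"
  using set_foldr_push[of u v] reduced_foldr_push[of v u] by (auto simp: words_def)

lemma winv_words: "u \<in> words S \<Longrightarrow> winv u \<in> words S"
  using reduced_rev_flip[of u] by (fastforce simp: words_def winv_def flip_def)

lemma winv_winv [simp]: "winv (winv u) = u"
  by (simp add: winv_def rev_map comp_def)

lemma winv_Nil [simp]: "winv [] = []"
  by (simp add: winv_def)

lemma winv_Cons: "winv (x # u) = winv u @ [flip x]"
  by (simp add: winv_def)

lemma winv_eq_Nil [simp]: "winv u = [] \<longleftrightarrow> u = []"
  by (simp add: winv_def)

lemma length_winv [simp]: "length (winv u) = length u"
  by (simp add: winv_def)

lemma mul_Nil_right: "u \<in> words S \<Longrightarrow> mul u [] = u"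
  by (simp add: foldr_push_Nil words_def)

lemma mul_assoc: "w \<in> words S \<Longrightarrow> mul (mul u v) w = mul u (mul v w)"
  by (simp add: foldr_push_assoc words_def)

lemma mul_winv_left: "mul (winv u) u = []"
  by (simp add: winv_def foldr_push_rev)

lemma mul_winv_right: "mul u (winv u) = []"
  using mul_winv_left[of "winv u"] by simp

lemma mul_winv_cancel: "v \<in> words S \<Longrightarrow> mul (winv u) (mul u v) = v"
  using mul_assoc[of v S "winv u" u] by (simp add: mul_winv_left)

lemma mul_winv_cancel': "v \<in> words S \<Longrightarrow> mul u (mul (winv u) v) = v"
  using mul_winv_cancel[of v S "winv u"] by simp

lemma push_flip: "w \<in> words S \<Longrightarrow> push (flip x) (push x w) = w"
  by (simp add: push_flip_push words_def)

lemma push_flip': "w \<in> words S \<Longrightarrow> push x (push (flip x) w) = w"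
  by (simp add: push_push_flip words_def)

lemma push_eq_iff: "u \<in> words S \<Longrightarrow> v \<in> words S \<Longrightarrow> push x u = push x v \<longleftrightarrow> u = v"
  by (metis push_flip)

lemma mul_eq_iff: "u \<in> words S \<Longrightarrow> v \<in> words S \<Longrightarrow> mul g u = mul g v \<longleftrightarrow> u = v"
  by (metis mul_winv_cancel)

lemma mul_append: "reduced (u @ v) \<Longrightarrow> mul u v = u @ v"
proof (induction u)
  case (Cons x u)
  then show ?case by (simp add: reduced_Cons push_reduced)
qed simp

lemma push_words_eq: "x # w \<in> words S \<Longrightarrow> push x w = x # w"
  by (simp add: words_def push_reduced)

lemma push_noncancel: "w = [] \<or> hd w \<noteq> flip x \<Longrightarrow> push x w = x # w"
  by (cases w) auto

lemma mul_eq_Nil_iff: "u \<in> words S \<Longrightarrow> v \<in> words S \<Longrightarrow> mul (winv u) v = [] \<longleftrightarrow> u = v"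
  by (metis mul_Nil_right mul_winv_cancel' mul_winv_left)

text \<open>Cancellation consumes \<open>u\<close> from its end, so the first letter of
  \<open>u\<close> survives unless all of \<open>u\<close> has been cancelled.\<close>

lemma mul_cases:
  assumes "u \<in> words S" "v \<in> words S" "u \<noteq> []"
  shows "(mul u v \<noteq> [] \<and> hd (mul u v) = hd u) \<or> (\<exists>i. mul u v = drop i v)"
  using assms
proof (induction u)
  case (Cons x u)
  show ?case
  proof (cases "u = []")
    case True
    then show ?thesis
    proof (cases v)
      case (Cons y w)
      then have "push x v = drop 1 v \<or> push x v = x # v" by simp
      then show ?thesis using True by auto
    qed (use True in simp)
  next
    case False
    have u: "u \<in> words S" and hu: "hd u \<noteq> flip x" using Cons.prems False by (auto simp: words_Cons)
    from Cons.IH[OF u Cons.prems(2) False] show ?thesis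
    proof
      assume "mul u v \<noteq> [] \<and> hd (mul u v) = hd u"
      then show ?thesis using hu push_noncancel[of "mul u v" x] by simp
    next
      assume "\<exists>i. mul u v = drop i v"
      then obtain i where i: "mul u v = drop i v" ..
      show ?thesis
      proof (cases "drop i v")
        case Nil
        then show ?thesis using i by simp
      next
        case (Cons y w)
        then have "w = drop (Suc i) v" by (metis drop_Suc tl_drop list.sel(3))
        then have "mul (x # u) v = drop (Suc i) v \<or> mul (x # u) v = x # drop i v"
          using i Cons by simp
        then show ?thesis by (metis list.sel(1) list.distinct(1))
      qed
    qed
  qed
qed simp

section \<open>Suffixes of a word\<close>

fun tails :: "'a list \<Rightarrow> 'a list set" where
  "tails [] = {[]}"
| "tails (x # w) = insert (x # w) (tails w)"

lemma finite_tails [simp]: "finite (tails w)"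
  by (induction w) auto

lemma tails_self [simp]: "w \<in> tails w"
  by (cases w) auto

lemma Nil_in_tails [simp]: "[] \<in> tails w"
  by (induction w) auto

lemma tails_ConsD: "x # v \<in> tails w \<Longrightarrow> v \<in> tails w"
  by (induction w) auto

lemma tails_length: "v \<in> tails w \<Longrightarrow> length v \<le> length w"
  by (induction w) auto

lemma tails_neq_length: "v \<in> tails w \<Longrightarrow> v \<noteq> w \<Longrightarrow> length v < length w"
  by (cases w) (auto dest: tails_length)

lemma tails_words: "w \<in> words S \<Longrightarrow> tails w \<subseteq> words S"
  by (induction w) (auto simp: words_Cons)

lemma drop_in_tails: "drop i w \<in> tails w"
proof (induction w arbitrary: i)
  case (Cons x w)
  then show ?case by (cases i) auto
qed simp

section \<open>The circular order of a planar tree\<close>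

text \<open>
  A vertex of the Cayley tree sees the others in the directions \<open>Some x\<close>, and itself in the direction
  \<open>None\<close>. The rank places the directions in the cyclic order
  \<open>1, a, b\<^sup>-\<^sup>1, a\<^sup>-\<^sup>1, b\<close> for each pair \<open>a = 2i\<close>, \<open>b = 2i + 1\<close> of consecutive generators. For an even number of
  generators, a boundary walk around the resulting ribbon graph reads a product of commutators, so that it
  has a single boundary component.
\<close>

fun rank :: "nat letter option \<Rightarrow> int" where
  "rank None = 0"
| "rank (Some (k, s)) = (if even k then (if s then 2 * int k + 3 else 2 * int k + 1)
     else (if s then 2 * int k else 2 * int k + 2))"

definition side :: "nat letter option \<Rightarrow> nat letter option \<Rightarrow> int"
  where "side p q = sgn (rank q - rank p)"

lemma rank_inj: "rank p = rank q \<Longrightarrow> p = q"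
proof (cases p; cases q)
  fix x y assume pq: "p = Some x" "q = Some y" and r: "rank p = rank q"
  obtain k s l t where xy: "x = (k, s)" "y = (l, t)" by (cases x; cases y) auto
  have "k = l \<and> s = t"
    using r unfolding pq xy by (simp split: if_splits) presburger+
  then show "p = q" using pq xy by simp
qed (auto split: if_splits)

lemma side_refl [simp]: "side p p = 0"
  by (simp add: side_def)

lemma side_swap: "side q p = - side p q"
  by (simp add: side_def sgn_if)

lemma side_cases: "p \<noteq> q \<Longrightarrow> side p q = 1 \<or> side p q = -1"
  using rank_inj[of p q] by (auto simp: side_def sgn_if)

lemma side_odd: "p \<noteq> q \<Longrightarrow> odd (side p q)"
  using side_cases[of p q] by auto

lemma sgn_triple:
  fixes a b d :: "'a :: linordered_idom"
  shows "sgn (b - a) + sgn (d - b) + sgn (a - d) \<in> {0, 1, -1}"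
    "sgn (b - a) + sgn (d - b) + sgn (a - d) = 0 \<longleftrightarrow> a = b \<or> a = d \<or> b = d"
  by (cases a b rule: linorder_cases; cases b d rule: linorder_cases; cases a d rule: linorder_cases; simp)+

lemma side_triple:
  "side p q + side q r + side r p \<in> {0, 1, -1}"
  "side p q + side q r + side r p = 0 \<longleftrightarrow> p = q \<or> p = r \<or> q = r"
proof -
  have "p = q \<longleftrightarrow> rank p = rank q" "p = r \<longleftrightarrow> rank p = rank r" "q = r \<longleftrightarrow> rank q = rank r"
    using rank_inj by blast+
  then show "side p q + side q r + side r p \<in> {0, 1, -1}"
    "side p q + side q r + side r p = 0 \<longleftrightarrow> p = q \<or> p = r \<or> q = r"
    unfolding side_def using sgn_triple[of "rank q" "rank p" "rank r"] by blast+
qed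

text \<open>
  \<open>walk None w\<close> adds up the turns, with respect to the rank, of the path from \<open>1\<close> to \<open>w\<close> in the tree.
\<close>

fun walk :: "nat letter option \<Rightarrow> nat letter list \<Rightarrow> int" where
  "walk p [] = side p None"
| "walk p (y # w) = side p (Some y) + walk (Some (flip y)) w"

definition turning :: "nat letter list \<Rightarrow> int"
  where "turning w = walk None w"

definition dir :: "'a letter list \<Rightarrow> 'a letter option"
  where "dir w = (if w = [] then None else Some (hd w))"

lemma dir_simps [simp]: "dir [] = None" "dir (x # w) = Some x"
  by (auto simp: dir_def)

fun tail_turning :: "nat letter list \<Rightarrow> int" where
  "tail_turning [] = 0"
| "tail_turning (y # w) = walk (Some (flip y)) w"

lemma walk_eq: "walk p w = side p (dir w) + tail_turning w"
  by (cases w) auto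

text \<open>At the vertex \<open>1\<close> the walk coming from \<open>u\<close> does not stop but
  leaves towards \<open>v\<close>: the final turn into \<open>None\<close> is exchanged for the turn
  from \<open>dir u\<close> to \<open>dir v\<close>.\<close>

lemma walk_append: "u \<noteq> [] \<or> p = None \<Longrightarrow> walk p (winv u @ v) = walk p (winv u) - side (dir u) None
    + side (dir u) (dir v) + tail_turning v"
proof (induction "winv u" arbitrary: u p)
  case Nil
  then have "u = []" by (metis winv_eq_Nil)
  with Nil.prems show ?case by (simp add: walk_eq)
next
  case (Cons y w)
  have u: "u = winv w @ [flip y]"
    using Cons.hyps(2) by (metis winv_Cons winv_winv)
  show ?case
  proof (cases "w = []")
    case True
    then show ?thesis using u by (simp add: winv_Cons walk_eq)
  next
    case False
    then have "dir u = dir (winv w)"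
      using u by (simp add: dir_def)
    then show ?thesis
      using False Cons.hyps(1)[of "winv w" "Some (flip y)"] Cons.hyps(2)[symmetric] by simp
  qed
qed

lemma walk_winv: "walk None (winv u) = side (dir u) None - tail_turning u"
proof (induction u)
  case (Cons x u)
  have "walk None (winv u @ [flip x]) = walk None (winv u) - side (dir u) None
    + side (dir u) (Some (flip x)) + walk (Some x) []"
    using walk_append[of u None "[flip x]"] by simp
  then show ?case
    using Cons.IH walk_eq[of "Some (flip x)" u] side_swap[of "dir u" "Some (flip x)"] by (simp add: winv_Cons)
qed simp

lemma turning_winv: "turning (winv u) = - turning u"
  using side_swap[of None "dir u"] walk_eq[of None u] by (simp add: turning_def walk_winv)

text \<open>Encodes that \<open>1\<close> lies on the tree path from \<open>u\<close> to
  \<open>v\<close>, possibly as an endpoint, so that nothing cancels in the product of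
  \<open>winv u\<close> and \<open>v\<close>.\<close>

definition diverge :: "'a letter list \<Rightarrow> 'a letter list \<Rightarrow> bool"
  where "diverge u v \<longleftrightarrow> dir u = None \<or> dir v = None \<or> dir u \<noteq> dir v"

lemma last_winv: "u \<noteq> [] \<Longrightarrow> last (winv u) = flip (hd u)"
  by (cases u) (auto simp: winv_Cons)

lemma mul_diverge:
  assumes "u \<in> words S" "v \<in> words S" "diverge u v"
  shows "mul (winv u) v = winv u @ v"
proof -
  have "reduced (winv u)" "reduced v"
    using assms winv_words[of u S] by (auto simp: words_def)
  then have "reduced (winv u @ v)"
    using assms(3) by (auto simp: reduced_append last_winv diverge_def dir_def split: if_splits)
  then show ?thesis by (rule mul_append)
qed

lemma turning_diverge:
  assumes "u \<in> words S" "v \<in> words S" "diverge u v"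
  shows "turning (mul (winv u) v) = tail_turning v - tail_turning u + side (dir u) (dir v)"
  using walk_append[of u None v] by (simp add: mul_diverge[OF assms] turning_def walk_winv)

text \<open>The total turning around the triangle \<open>u\<close>, \<open>v\<close>,
  \<open>w\<close>. Every leg of the tripod is run through in both directions and its turns cancel;
  what remains is the cyclic position of three directions at the centre. Being the coboundary of an
  antisymmetric function, the sum is automatically a cocycle.\<close>

definition tree_order :: "nat letter list \<times> nat letter list \<times> nat letter list \<Rightarrow> int"
  where "tree_order = (\<lambda>(u, v, w). turning (mul (winv u) v) + turning (mul (winv v) w) + turning (mul (winv w) u))"

lemma tree_order_diverge:
  assumes "u \<in> words S" "v \<in> words S" "w \<in> words S" "diverge u v" "diverge v w" "diverge w u"
  shows "tree_order (u, v, w) = side (dir u) (dir v) + side (dir v) (dir w) + side (dir w) (dir u)"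
  using assms by (simp add: tree_order_def turning_diverge)

lemma winv_mul:
  assumes "g \<in> words S" "u \<in> words S"
  shows "winv (mul g u) = mul (winv u) (winv g)"
proof -
  have W: "winv u \<in> words S" "winv g \<in> words S" "mul g u \<in> words S" "winv (mul g u) \<in> words S"
    "mul (winv u) (winv g) \<in> words S"
    using assms by (auto intro: winv_words mul_words)
  have "mul (mul (winv u) (winv g)) (mul g u) = mul (winv u) (mul (winv g) (mul g u))"
    by (rule mul_assoc) (use W in blast)
  also have "\<dots> = []" using assms mul_winv_cancel[of u S g] by (simp add: mul_winv_left)
  finally have "mul (mul (mul (winv u) (winv g)) (mul g u)) (winv (mul g u)) = winv (mul g u)"
    by simp
  moreover have "mul (mul (mul (winv u) (winv g)) (mul g u)) (winv (mul g u))
    = mul (mul (winv u) (winv g)) (mul (mul g u) (winv (mul g u)))"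
    by (rule mul_assoc) (use W in blast)
  moreover have "\<dots> = mul (winv u) (winv g)"
    using mul_winv_right[of "mul g u"] mul_Nil_right[OF W(5)] by simp
  ultimately show ?thesis by simp
qed

lemma mul_winv_mul:
  assumes "g \<in> words S" "u \<in> words S" "v \<in> words S"
  shows "mul (winv (mul g u)) (mul g v) = mul (winv u) v"
  using assms mul_assoc[of "mul g v" S "winv u" "winv g"]
  by (simp add: winv_mul mul_winv_cancel mul_words)

lemma tree_order_invariant:
  assumes "g \<in> words S" "u \<in> words S" "v \<in> words S" "w \<in> words S"
  shows "tree_order (mul g u, mul g v, mul g w) = tree_order (u, v, w)"
  using assms by (simp add: tree_order_def mul_winv_mul)

lemma single_words: "fst x \<in> S \<Longrightarrow> [x] \<in> words S"
  by (simp add: words_Cons)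

text \<open>
  Two of three words with a common first letter can be shortened by a translation that lengthens the third
  by one letter at most.
\<close>

lemma words_triple_induct [consumes 3, case_names rotate diverge strip]:
  assumes "u \<in> words S" "v \<in> words S" "w \<in> words S"
    and rotate: "\<And>u v w. \<lbrakk>u \<in> words S; v \<in> words S; w \<in> words S; P u v w\<rbrakk> \<Longrightarrow> P v w u"
    and diverge: "\<And>u v w. \<lbrakk>u \<in> words S; v \<in> words S; w \<in> words S;
      diverge u v; diverge v w; diverge w u\<rbrakk> \<Longrightarrow> P u v w"
    and strip: "\<And>x u v w. \<lbrakk>fst x \<in> S; u \<in> words S; v \<in> words S; w \<in> words S; P u v w\<rbrakk>
      \<Longrightarrow> P (push x u) (push x v) (push x w)"
  shows "P u v w"
  using assms(1-3)
proof (induction "length u + length v + length w" arbitrary: u v w rule: less_induct)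
  case less
  have common: "P u v w"
    if uvw: "u \<in> words S" "v \<in> words S" "w \<in> words S"
      and len: "length u + length v + length w = n" and nd: "\<not> diverge u v"
      and IH: "\<And>u v w. length u + length v + length w < n \<Longrightarrow> u \<in> words S \<Longrightarrow> v \<in> words S \<Longrightarrow> w \<in> words S \<Longrightarrow> P u v w"
    for u v w n
  proof -
    obtain x u' v' where x: "u = x # u'" "v = x # v'"
      using nd by (cases u; cases v) (auto simp: diverge_def)
    define w' where "w' = push (flip x) w"
    have W: "fst x \<in> S" "u' \<in> words S" "v' \<in> words S" "w' \<in> words S"
      using uvw x push_words[of "flip x" S w] by (auto simp: words_Cons w'_def)
    have "length w' \<le> Suc (length w)" unfolding w'_def by (cases w) auto
    then have "P u' v' w'" using IH[of u' v' w'] len x W by auto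
    then have "P (push x u') (push x v') (push x w')" using strip W by blast
    moreover have "push x u' = u" "push x v' = v" "push x w' = w"
      using push_words_eq[of x u' S] push_words_eq[of x v' S] uvw x push_flip'[of w S x] by (simp_all add: w'_def)
    ultimately show ?thesis by simp
  qed
  let ?n = "length u + length v + length w"
  have IH: "P u v w" if "length u + length v + length w < ?n" "u \<in> words S" "v \<in> words S" "w \<in> words S"
    for u v w using less.hyps that by blast
  consider "diverge u v" "diverge v w" "diverge w u" | "\<not> diverge u v" | "\<not> diverge v w" | "\<not> diverge w u"
    by blast
  then show ?case
  proof cases
    case 1
    then show ?thesis using diverge less.prems by blast
  next
    case 2
    then show ?thesis using common[of u v w ?n] less.prems IH by blast
  next
    case 3
    then have "P v w u" using common[of v w u ?n] less.prems IH by (auto simp: add.commute add.left_commute)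
    then show ?thesis using rotate less.prems by blast
  next
    case 4
    then have "P w u v" using common[of w u v ?n] less.prems IH by (auto simp: add.commute add.left_commute)
    then show ?thesis using rotate less.prems by blast
  qed
qed

text \<open>Rotations and translations reduce to triples whose tripod is centred at
  \<open>1\<close>, where the order is that of the ranks of the three directions.\<close>

lemma tree_order_val:
  assumes "u \<in> words S" "v \<in> words S" "w \<in> words S"
  shows "tree_order (u, v, w) \<in> {0, 1, -1} \<and> (tree_order (u, v, w) = 0 \<longleftrightarrow> u = v \<or> u = w \<or> v = w)"
  using assms
proof (induction u v w rule: words_triple_induct)
  case (rotate u v w)
  have "tree_order (v, w, u) = tree_order (u, v, w)" by (simp add: tree_order_def)
  then show ?case using rotate by auto
next
  case (diverge u v w)
  have "dir u = dir v \<longleftrightarrow> u = v" "dir u = dir w \<longleftrightarrow> u = w" "dir v = dir w \<longleftrightarrow> v = w"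
    using diverge by (cases u; cases v; cases w; auto simp: diverge_def)+
  then show ?case
    unfolding tree_order_diverge[OF diverge]
    using side_triple[of "dir u" "dir v" "dir w"] by auto
next
  case (strip x u v w)
  then show ?case
    using tree_order_invariant[OF single_words, of x S u v w] by (auto simp: push_eq_iff)
qed

lemma turning_antisym:
  assumes "u \<in> words S" "v \<in> words S"
  shows "turning (mul (winv v) u) = - turning (mul (winv u) v)"
  using turning_winv[of "mul (winv u) v"] winv_mul[OF winv_words assms(2), of u] assms by simp

lemma tree_order_cyclic_order: "cyclic_order (words S) tree_order"
proof
  fix a b d e :: "nat letter list"
  assume W: "a \<in> words S" "b \<in> words S" "d \<in> words S" "e \<in> words S"
  show "tree_order (b, d, e) - tree_order (a, d, e) + tree_order (a, b, e) - tree_order (a, b, d) = 0"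
    using turning_antisym[of b S e] turning_antisym[of a S d] W by (simp add: tree_order_def)
qed (use tree_order_val in auto)

section \<open>A left order on free groups\<close>

definition exponent :: "'a letter list \<Rightarrow> int"
  where "exponent w = (\<Sum>x\<leftarrow>w. if snd x then -1 else 1)"

lemma exponent_push: "exponent (push x w) = (if snd x then -1 else 1) + exponent w"
  by (cases w) (auto simp: exponent_def flip_def)

lemma exponent_mul: "exponent (mul u v) = exponent u + exponent v"
  by (induction u) (auto simp: exponent_push, auto simp: exponent_def)

lemma exponent_winv: "exponent (winv u) = - exponent u"
  by (induction u) (auto simp: winv_def exponent_def flip_def)

lemma exponent_parity: "even (exponent w) \<longleftrightarrow> even (length w)"
  by (induction w) (auto simp: exponent_def)

text \<open>A path with \<open>l\<close> edges has \<open>l + 1\<close> turns, counting those at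
  both ends, and each of them is odd because the path never turns back.\<close>

lemma walk_parity: "reduced w \<Longrightarrow> p \<noteq> dir w \<Longrightarrow> even (walk p w) \<longleftrightarrow> odd (length w)"
proof (induction w arbitrary: p)
  case Nil
  then show ?case using side_odd[of p None] by simp
next
  case (Cons y w)
  then have "even (walk (Some (flip y)) w) \<longleftrightarrow> odd (length w)"
    by (intro Cons.IH) (auto simp: reduced_Cons dir_def)
  then show ?case using side_odd[of p "Some y"] Cons.prems by simp
qed

text \<open>
  Adding the exponent sum makes the turning odd, hence nonzero, on nontrivial words.
\<close>

definition order_sign :: "nat letter list \<Rightarrow> nat letter list \<Rightarrow> int"
  where "order_sign u v = sgn (turning (mul (winv u) v) + exponent (mul (winv u) v))"

lemma order_sign_antisym:
  assumes "u \<in> words S" "v \<in> words S"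
  shows "order_sign v u = - order_sign u v"
proof -
  have "exponent (mul (winv v) u) = - exponent (mul (winv u) v)"
    by (simp add: exponent_mul exponent_winv)
  then show ?thesis using turning_antisym[OF assms] by (simp add: order_sign_def sgn_if)
qed

lemma turning_exponent_odd:
  assumes "u \<in> words S" "v \<in> words S" "u \<noteq> v"
  shows "odd (turning (mul (winv u) v) + exponent (mul (winv u) v))"
proof -
  let ?w = "mul (winv u) v"
  have w: "?w \<in> words S" "?w \<noteq> []"
    using assms mul_words[OF winv_words, of u S v] by (auto simp: mul_eq_Nil_iff)
  then show ?thesis
    using walk_parity[of ?w None] exponent_parity[of ?w] by (auto simp: turning_def dir_def words_def)
qed

lemma order_sign_cases:
  assumes "u \<in> words S" "v \<in> words S"
  shows "u \<noteq> v \<Longrightarrow> order_sign u v = 1 \<or> order_sign u v = -1" "order_sign u u = 0"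
proof -
  show "order_sign u v = 1 \<or> order_sign u v = -1" if "u \<noteq> v"
  proof -
    have "turning (mul (winv u) v) + exponent (mul (winv u) v) \<noteq> 0"
      using turning_exponent_odd[OF assms that] by fastforce
    then show ?thesis by (simp add: order_sign_def sgn_if)
  qed
  show "order_sign u u = 0"
    by (simp add: order_sign_def mul_winv_left turning_def exponent_def)
qed

text \<open>This is transitivity: no cycle \<open>u < v < w < u\<close> exists. The exponent sum is
  a homomorphism and cancels around the triangle, so the three odd numbers add up to a value of
  \<open>tree_order\<close>. Three odd numbers of one sign would have a sum of absolute value at
  least 3.\<close>

lemma order_sign_triple:
  assumes W: "u \<in> words S" "v \<in> words S" "w \<in> words S" and "u \<noteq> v" "u \<noteq> w" "v \<noteq> w"
  shows "order_sign u v + order_sign v w + order_sign w u \<in> {1, -1}"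
proof -
  define a where "a = turning (mul (winv u) v) + exponent (mul (winv u) v)"
  define b where "b = turning (mul (winv v) w) + exponent (mul (winv v) w)"
  define d where "d = turning (mul (winv w) u) + exponent (mul (winv w) u)"
  have odd: "odd a" "odd b" "odd d"
    using turning_exponent_odd[of _ S] assms unfolding a_def b_def d_def by blast+
  have "a + b + d = tree_order (u, v, w)"
    by (simp add: a_def b_def d_def tree_order_def exponent_mul exponent_winv)
  then have sum: "a + b + d \<in> {0, 1, -1}" using tree_order_val[OF W] by auto
  have nz: "a \<noteq> 0" "b \<noteq> 0" "d \<noteq> 0" using odd by auto
  have "\<not> (a > 0 \<and> b > 0 \<and> d > 0)" "\<not> (a < 0 \<and> b < 0 \<and> d < 0)"
    using sum by auto
  then have ne: "\<not> (sgn a = sgn b \<and> sgn b = sgn d)"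
    using nz by (metis sgn_1_pos sgn_1_neg linorder_neqE_linordered_idom)
  have "sgn a \<in> {1, -1}" "sgn b \<in> {1, -1}" "sgn d \<in> {1, -1}"
    using nz by (auto simp: sgn_if)
  with ne have "sgn a + sgn b + sgn d \<in> {1, -1}" by fastforce
  then show ?thesis unfolding order_sign_def a_def b_def d_def .
qed

lemma order_sign_invariant:
  assumes "g \<in> words S" "u \<in> words S" "v \<in> words S"
  shows "order_sign (mul g u) (mul g v) = order_sign u v"
  using assms by (simp add: order_sign_def mul_winv_mul)

section \<open>Automorphisms of the circle\<close>

definition cmp :: "real \<Rightarrow> real \<Rightarrow> int"
  where "cmp x y = (if x < y then 1 else if y < x then -1 else 0)"

definition ccw :: "real \<times> real \<times> real \<Rightarrow> int"
  where "ccw = (\<lambda>(x, y, z). cmp x y + cmp y z + cmp z x)"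

lemma cmp_swap: "cmp y x = - cmp x y"
  by (simp add: cmp_def)

lemma ccw_val: "ccw (x, y, z) \<in> {0, 1, -1}"
  by (simp add: ccw_def cmp_def)

lemma ccw_zero: "ccw (x, y, z) = 0 \<longleftrightarrow> x = y \<or> x = z \<or> y = z"
  by (simp add: ccw_def cmp_def)

lemma ccw_cocycle: "ccw (b, d, e) - ccw (a, d, e) + ccw (a, b, e) - ccw (a, b, d) = 0"
  using cmp_swap[of e b] cmp_swap[of d a] by (simp add: ccw_def)

abbreviation circle :: "real set"
  where "circle \<equiv> {0..<1}"

definition circle_aut :: "(real \<Rightarrow> real) \<Rightarrow> bool"
  where "circle_aut f \<longleftrightarrow> bij_betw f circle circle \<and>
    (\<forall>x\<in>circle. \<forall>y\<in>circle. \<forall>z\<in>circle. ccw (f x, f y, f z) = ccw (x, y, z))"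

lemma circle_aut_in: "circle_aut f \<Longrightarrow> x \<in> circle \<Longrightarrow> f x \<in> circle"
  unfolding circle_aut_def using bij_betwE by blast

lemma circle_aut_ccw:
  "\<lbrakk>circle_aut f; x \<in> circle; y \<in> circle; z \<in> circle\<rbrakk> \<Longrightarrow> ccw (f x, f y, f z) = ccw (x, y, z)"
  unfolding circle_aut_def by blast

lemma circle_aut_inj: "\<lbrakk>circle_aut f; x \<in> circle; y \<in> circle\<rbrakk> \<Longrightarrow> f x = f y \<longleftrightarrow> x = y"
  unfolding circle_aut_def bij_betw_def inj_on_def by blast

lemma circle_aut_id: "circle_aut id"
  by (simp add: circle_aut_def)

lemma circle_aut_comp: "circle_aut f \<Longrightarrow> circle_aut g \<Longrightarrow> circle_aut (g \<circ> f)"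
  using circle_aut_in[of f] unfolding circle_aut_def by (auto intro: bij_betw_trans)

definition circle_inv :: "(real \<Rightarrow> real) \<Rightarrow> real \<Rightarrow> real"
  where "circle_inv f = inv_into circle f"

lemma circle_inv_left: "circle_aut f \<Longrightarrow> x \<in> circle \<Longrightarrow> circle_inv f (f x) = x"
  unfolding circle_aut_def circle_inv_def by (blast intro: bij_betw_inv_into_left)

lemma circle_inv_right: "circle_aut f \<Longrightarrow> x \<in> circle \<Longrightarrow> f (circle_inv f x) = x"
  unfolding circle_aut_def circle_inv_def by (blast intro: bij_betw_inv_into_right)

lemma circle_aut_inv:
  assumes "circle_aut f"
  shows "circle_aut (circle_inv f)"
proof -
  have bij: "bij_betw (circle_inv f) circle circle"
    using assms unfolding circle_aut_def circle_inv_def by (blast intro: bij_betw_inv_into)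
  have "ccw (circle_inv f x, circle_inv f y, circle_inv f z) = ccw (x, y, z)"
    if "x \<in> circle" "y \<in> circle" "z \<in> circle" for x y z
    using circle_aut_ccw[OF assms, of "circle_inv f x" "circle_inv f y" "circle_inv f z"]
      bij_betwE[OF bij] that circle_inv_right[OF assms] by simp
  then show ?thesis using bij by (simp add: circle_aut_def)
qed

definition rotation :: "real \<Rightarrow> real \<Rightarrow> real"
  where "rotation a x = (if x + a < 1 then x + a else x + a - 1)"

lemma rotation_aut:
  assumes "a \<in> circle"
  shows "circle_aut (rotation a)"
proof -
  have "bij_betw (rotation a) circle circle"
    by (rule bij_betwI[where g = "\<lambda>y. if a \<le> y then y - a else y - a + 1"])
      (use assms in \<open>auto simp: rotation_def\<close>)
  moreover have "ccw (rotation a x, rotation a y, rotation a z) = ccw (x, y, z)"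
    if "x \<in> circle" "y \<in> circle" "z \<in> circle" for x y z
  proof -
    \<comment> \<open>\<open>w\<close> counts wrap-arounds. A comparison is reversed exactly when
      one of the two points wraps, and the correction telescopes around a triple.\<close>
    define w :: "real \<Rightarrow> int" where "w x = (if x + a < 1 then 0 else 1)" for x
    have "cmp (rotation a x) (rotation a y) = cmp x y + 2 * (w x - w y)"
      if "x \<in> circle" "y \<in> circle" for x y
      using that assms by (auto simp: cmp_def rotation_def w_def)
    then show ?thesis using that by (simp add: ccw_def)
  qed
  ultimately show ?thesis by (simp add: circle_aut_def)
qed

lemma rotation_zero: "a \<in> circle \<Longrightarrow> rotation a 0 = a"
  by (simp add: rotation_def)

text \<open>The piecewise linear homeomorphism of the line that is supported between
  \<open>l\<close> and \<open>r\<close> and moves \<open>u\<close> to \<open>v\<close>.\<close>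

definition bump :: "real \<Rightarrow> real \<Rightarrow> real \<Rightarrow> real \<Rightarrow> real \<Rightarrow> real"
  where "bump l u v r x = (if x \<le> l \<or> r \<le> x then x
     else if x \<le> u then l + (x - l) * ((v - l) / (u - l))
     else r - (r - x) * ((r - v) / (r - u)))"

lemma bump_range:
  assumes "l < u" "u < r" "l < v" "v < r"
  shows "l < x \<Longrightarrow> x \<le> u \<Longrightarrow> l < bump l u v r x \<and> bump l u v r x \<le> v"
    and "u < x \<Longrightarrow> x < r \<Longrightarrow> v < bump l u v r x \<and> bump l u v r x < r"
proof -
  assume x: "l < x" "x \<le> u"
  have "(x - l) * ((v - l) / (u - l)) \<le> (u - l) * ((v - l) / (u - l))"
    using x assms by (intro mult_right_mono) auto
  also have "\<dots> = v - l" using assms by simp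
  finally show "l < bump l u v r x \<and> bump l u v r x \<le> v"
    using x assms by (simp add: bump_def)
next
  assume x: "u < x" "x < r"
  have "(r - x) * ((r - v) / (r - u)) < (r - u) * ((r - v) / (r - u))"
    using x assms by (intro mult_strict_right_mono) auto
  also have "\<dots> = r - v" using assms by simp
  finally show "v < bump l u v r x \<and> bump l u v r x < r"
    using x assms by (simp add: bump_def)
qed

lemma bump_point: "l < u \<Longrightarrow> u < r \<Longrightarrow> bump l u v r u = v"
  by (simp add: bump_def)

lemma bump_inverse:
  assumes "l < u" "u < r" "l < v" "v < r"
  shows "bump l v u r (bump l u v r x) = x"
proof -
  consider "x \<le> l \<or> r \<le> x" | "l < x" "x \<le> u" | "u < x" "x < r" by linarith
  then show ?thesis
  proof cases
    case 1
    then show ?thesis by (simp add: bump_def)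
  next
    case 2
    let ?y = "bump l u v r x"
    have y: "l < ?y" "?y \<le> v" "?y = l + (x - l) * ((v - l) / (u - l))"
      using 2 assms bump_range(1)[OF assms] by (auto simp: bump_def)
    have "bump l v u r ?y = l + (?y - l) * ((u - l) / (v - l))"
      unfolding bump_def[of l v u r ?y] using y(1,2) assms by simp
    moreover have "(?y - l) * ((u - l) / (v - l)) = x - l"
      unfolding y(3) using assms by simp
    ultimately show ?thesis by simp
  next
    case 3
    let ?y = "bump l u v r x"
    have y: "v < ?y" "?y < r" "?y = r - (r - x) * ((r - v) / (r - u))"
      using 3 assms bump_range(2)[OF assms] by (auto simp: bump_def)
    have "bump l v u r ?y = r - (r - ?y) * ((r - u) / (r - v))"
      unfolding bump_def[of l v u r ?y] using y(1,2) assms by simp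
    moreover have "(r - ?y) * ((r - u) / (r - v)) = r - x"
      unfolding y(3) using assms by simp
    ultimately show ?thesis by simp
  qed
qed

lemma bump_bij:
  assumes "l < u" "u < r" "l < v" "v < r"
  shows "bij (bump l u v r)"
  using bump_inverse[OF assms] bump_inverse[OF assms(3,4,1,2)] by (intro bijI') metis+

lemma bump_strict_mono:
  assumes "l < u" "u < r" "l < v" "v < r"
  shows "strict_mono (bump l u v r)"
proof (rule strict_monoI)
  fix x y :: real assume "x < y"
  note range = bump_range[OF assms]
  consider "x \<le> l" | "l < x" "x \<le> u" | "u < x" "x < r" | "r \<le> x" by linarith
  then show "bump l u v r x < bump l u v r y"
  proof cases
    case 1
    then have "bump l u v r x = x" by (simp add: bump_def)
    moreover have "x < bump l u v r y"
    proof (cases "y \<le> l \<or> r \<le> y")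
      case True
      then show ?thesis using \<open>x < y\<close> by (simp add: bump_def)
    next
      case False
      then have "l < bump l u v r y" using range[of y] assms by (cases "y \<le> u") auto
      then show ?thesis using 1 by simp
    qed
    ultimately show ?thesis by simp
  next
    case 2
    show ?thesis
    proof (cases "y \<le> u")
      case True
      then have "(x - l) * ((v - l) / (u - l)) < (y - l) * ((v - l) / (u - l))"
        using 2 \<open>x < y\<close> assms by (intro mult_strict_right_mono) auto
      then show ?thesis using 2 True \<open>x < y\<close> assms by (simp add: bump_def)
    next
      case False
      have "v < bump l u v r y"
        using False range(2)[of y] assms by (cases "r \<le> y") (auto simp: bump_def)
      then show ?thesis using range(1)[of x] 2 by simp
    qed
  next
    case 3
    show ?thesis
    proof (cases "y < r")
      case True
      then have "(r - y) * ((r - v) / (r - u)) < (r - x) * ((r - v) / (r - u))"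
        using 3 \<open>x < y\<close> assms by (intro mult_strict_right_mono) auto
      then show ?thesis using 3 True \<open>x < y\<close> assms by (simp add: bump_def)
    next
      case False
      then have "bump l u v r y = y" by (simp add: bump_def)
      then show ?thesis using range(2)[of x] 3 False by simp
    qed
  next
    case 4
    then show ?thesis using \<open>x < y\<close> by (simp add: bump_def)
  qed
qed

text \<open>Points are corrected one at a time: a bump takes \<open>h a\<close> to
  \<open>m a\<close>. Its support lies between the nearest prescribed values on either side, with 0
  and 1 counted among them, so earlier corrections persist.\<close>

lemma ex_mono_extension:
  fixes A :: "real set" and m :: "real \<Rightarrow> real"
  assumes "finite A" "A \<subseteq> {0<..<1}" "m ` A \<subseteq> {0<..<1}" "\<And>x y. x \<in> A \<Longrightarrow> y \<in> A \<Longrightarrow> x < y \<Longrightarrow> m x < m y"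
  shows "\<exists>h. strict_mono h \<and> bij h \<and> (\<forall>x\<in>A. h x = m x) \<and> (\<forall>x. x \<le> 0 \<or> 1 \<le> x \<longrightarrow> h x = x)"
  using assms
proof (induction A rule: finite_induct)
  case empty
  then show ?case by (intro exI[of _ id]) (simp add: strict_mono_def bij_id[unfolded id_def])
next
  case (insert a A)
  then obtain h where h: "strict_mono h" "bij h" "\<forall>x\<in>A. h x = m x" "\<forall>x. x \<le> 0 \<or> 1 \<le> x \<longrightarrow> h x = x"
    by auto
  define LS where "LS = insert 0 (m ` {x \<in> A. x < a})"
  define RS where "RS = insert 1 (m ` {x \<in> A. a < x})"
  define l where "l = Max LS"
  define r where "r = Min RS"
  have fin: "finite LS" "finite RS" "LS \<noteq> {}" "RS \<noteq> {}"
    using insert.hyps by (auto simp: LS_def RS_def)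
  have a: "0 < a" "a < 1" "0 < m a" "m a < 1" using insert.prems by auto
  have h01: "h 0 = 0" "h 1 = 1" using h(4) by auto
  have ha: "y < h a \<and> y < m a" if y: "y \<in> LS" for y
  proof (cases "y = 0")
    case True
    then show ?thesis using a strict_monoD[OF h(1), of 0 a] h01 by simp
  next
    case False
    then obtain x where x: "x \<in> A" "x < a" "y = m x" using y False by (auto simp: LS_def)
    then show ?thesis using strict_monoD[OF h(1), of x a] h(3) insert.prems(3)[of x a] by auto
  qed
  have ha': "h a < y \<and> m a < y" if y: "y \<in> RS" for y
  proof (cases "y = 1")
    case True
    then show ?thesis using a strict_monoD[OF h(1), of a 1] h01 by simp
  next
    case False
    then obtain x where x: "x \<in> A" "a < x" "y = m x" using y False by (auto simp: RS_def)
    then show ?thesis using strict_monoD[OF h(1), of a x] h(3) insert.prems(3)[of a x] by auto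
  qed
  have l: "l < h a" "l < m a" "0 \<le> l" using ha[OF Max_in] fin by (auto simp: l_def LS_def)
  have r: "h a < r" "m a < r" "r \<le> 1" using ha'[OF Min_in] fin by (auto simp: r_def RS_def)
  let ?b = "bump l (h a) (m a) r"
  have "?b (h x) = m x" if "x \<in> insert a A" for x
  proof (cases "x = a")
    case True
    then show ?thesis using l r bump_point by simp
  next
    case False
    then have x: "x \<in> A" "h x = m x" using that h by auto
    have "m x \<le> l \<or> r \<le> m x"
    proof (cases "x < a")
      case True
      then have "m x \<in> LS" using x by (auto simp: LS_def)
      then show ?thesis using fin by (auto simp: l_def)
    next
      case False
      then have "m x \<in> RS" using x \<open>x \<noteq> a\<close> by (auto simp: RS_def)
      then show ?thesis using fin by (auto simp: r_def)
    qed
    then show ?thesis using x by (simp add: bump_def)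
  qed
  moreover have "?b (h x) = x" if "x \<le> 0 \<or> 1 \<le> x" for x
    using that h(4) l r by (auto simp: bump_def)
  moreover have "strict_mono (?b \<circ> h)" using h(1) bump_strict_mono l r
    by (simp add: strict_mono_def)
  moreover have "bij (?b \<circ> h)" using h(2) bump_bij l r by (intro bij_comp) auto
  ultimately have "\<exists>k. strict_mono k \<and> bij k \<and> (\<forall>x\<in>insert a A. k x = m x) \<and> (\<forall>x. x \<le> 0 \<or> 1 \<le> x \<longrightarrow> k x = x)"
    unfolding comp_def by blast
  then show ?case .
qed

lemma strict_mono_circle_aut:
  assumes "strict_mono h" "bij h" "\<And>x. x \<le> 0 \<or> 1 \<le> x \<Longrightarrow> h x = x"
  shows "circle_aut h"
proof -
  have h01: "h 0 = 0" "h 1 = 1" using assms(3) by auto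
  have less: "h x < h y \<longleftrightarrow> x < y" for x y using assms(1) strict_mono_less by blast
  have "x \<in> circle \<longleftrightarrow> h x \<in> circle" for x
    using less[of x 0] less[of x 1] h01 by auto
  then have "h ` circle = circle"
    using bij_is_surj[OF assms(2)] by (metis (no_types, lifting) image_subsetI subsetI subset_antisym surjD image_eqI)
  then have "bij_betw h circle circle"
    using inj_on_subset[OF bij_is_inj[OF assms(2)]] by (simp add: bij_betw_def)
  moreover have "cmp (h x) (h y) = cmp x y" for x y
    by (simp add: cmp_def less)
  ultimately show ?thesis by (simp add: circle_aut_def ccw_def)
qed

text \<open>Rotating one pair of \<open>R\<close> to \<open>(0, 0)\<close> turns preservation of the
  cyclic order into monotonicity, so that the other pairs form an increasing partial map of the open
  interval.\<close>

lemma circle_extension: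
  assumes "finite R" "R \<subseteq> circle \<times> circle"
    and inj: "\<And>p q p' q'. \<lbrakk>(p, q) \<in> R; (p', q') \<in> R\<rbrakk> \<Longrightarrow> p = p' \<longleftrightarrow> q = q'"
    and ccw: "\<And>p q p' q' p'' q''. \<lbrakk>(p, q) \<in> R; (p', q') \<in> R; (p'', q'') \<in> R\<rbrakk> \<Longrightarrow> ccw (p, p', p'') = ccw (q, q', q'')"
  shows "\<exists>f. circle_aut f \<and> (\<forall>(p, q)\<in>R. f p = q)"
proof (cases "R = {}")
  case True
  then show ?thesis using circle_aut_id by auto
next
  case False
  then obtain p0 q0 where R0: "(p0, q0) \<in> R" by auto
  then have C0: "p0 \<in> circle" "q0 \<in> circle" using assms by auto
  define \<alpha> where "\<alpha> = circle_inv (rotation p0)"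
  define \<beta> where "\<beta> = circle_inv (rotation q0)"
  have aut: "circle_aut \<alpha>" "circle_aut \<beta>"
    unfolding \<alpha>_def \<beta>_def using circle_aut_inv[OF rotation_aut] C0 by blast+
  have zero: "\<alpha> p0 = 0" "\<beta> q0 = 0"
    using circle_inv_left[OF rotation_aut, of _ 0] rotation_zero C0 by (auto simp: \<alpha>_def \<beta>_def)
  define R' where "R' = (\<lambda>(p, q). (\<alpha> p, \<beta> q)) ` (R - {(p0, q0)})"
  have R': "\<exists>p q. (p, q) \<in> R \<and> p \<noteq> p0 \<and> q \<noteq> q0 \<and> x = \<alpha> p \<and> y = \<beta> q" if "(x, y) \<in> R'" for x y
    using that inj[OF _ R0] by (auto simp: R'_def)
  have pos: "x \<in> {0<..<1} \<and> y \<in> {0<..<1}" if xy: "(x, y) \<in> R'" for x y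
  proof -
    obtain p q where pq: "(p, q) \<in> R" "p \<noteq> p0" "q \<noteq> q0" "x = \<alpha> p" "y = \<beta> q" using R'[OF xy] by blast
    then have "p \<in> circle" "q \<in> circle" using assms by auto
    then have "x \<noteq> 0" "y \<noteq> 0" "x \<in> circle" "y \<in> circle"
      using pq zero circle_aut_inj[OF aut(1), of p p0] circle_aut_inj[OF aut(2), of q q0] C0
        circle_aut_in[OF aut(1)] circle_aut_in[OF aut(2)] by auto
    then show ?thesis by auto
  qed
  define m where "m x = (SOME y. (x, y) \<in> R')" for x
  have m: "(x, m x) \<in> R'" if "x \<in> fst ` R'" for x
    using that unfolding m_def by (auto intro: someI)
  have unique: "y = y'" if xy: "(x, y) \<in> R'" "(x, y') \<in> R'" for x y y'
  proof -
    obtain p q p' q' where pq: "(p, q) \<in> R" "x = \<alpha> p" "y = \<beta> q" "(p', q') \<in> R" "x = \<alpha> p'" "y' = \<beta> q'"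
      using R'[OF xy(1)] R'[OF xy(2)] by blast
    then have "p \<in> circle" "p' \<in> circle" using assms by auto
    then show ?thesis using pq circle_aut_inj[OF aut(1), of p p'] inj by metis
  qed
  have m_eq: "m x = y" if "(x, y) \<in> R'" for x y
  proof -
    have "x \<in> fst ` R'" using that by force
    then show ?thesis using m unique that by blast
  qed
  have mono: "y < y'" if R2: "(x, y) \<in> R'" "(x', y') \<in> R'" and "x < x'" for x y x' y'
  proof -
    obtain p q p' q' where pq: "(p, q) \<in> R" "x = \<alpha> p" "y = \<beta> q" "(p', q') \<in> R" "x' = \<alpha> p'" "y' = \<beta> q'"
      using R'[OF R2(1)] R'[OF R2(2)] by blast
    then have C: "p \<in> circle" "p' \<in> circle" "q \<in> circle" "q' \<in> circle" using assms by auto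
    have "ccw (0, x, x') = ccw (p0, p, p')"
      using circle_aut_ccw[OF aut(1), of p0 p p'] C C0 zero pq by simp
    also have "\<dots> = ccw (q0, q, q')" using ccw R0 pq by blast
    also have "\<dots> = ccw (0, y, y')"
      using circle_aut_ccw[OF aut(2), of q0 q q'] C C0 zero pq by simp
    finally have "ccw (0, x, x') = ccw (0, y, y')" .
    then show ?thesis using pos[OF R2(1)] pos[OF R2(2)] \<open>x < x'\<close>
      by (auto simp: ccw_def cmp_def split: if_splits)
  qed
  have "finite (fst ` R')" using assms(1) by (simp add: R'_def)
  moreover have "fst ` R' \<subseteq> {0<..<1}" using pos by force
  moreover have "m ` fst ` R' \<subseteq> {0<..<1}" using pos m by blast
  moreover have "\<And>x y. x \<in> fst ` R' \<Longrightarrow> y \<in> fst ` R' \<Longrightarrow> x < y \<Longrightarrow> m x < m y"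
    using mono m by blast
  ultimately obtain h where h: "strict_mono h" "bij h" "\<forall>x\<in>fst ` R'. h x = m x"
    "\<forall>x. x \<le> 0 \<or> 1 \<le> x \<longrightarrow> h x = x"
    using ex_mono_extension[of "fst ` R'" m] by blast
  define f where "f = rotation q0 \<circ> (h \<circ> \<alpha>)"
  have aut_h: "circle_aut h" using strict_mono_circle_aut h by blast
  have "circle_aut f"
    unfolding f_def using aut aut_h rotation_aut C0 by (intro circle_aut_comp) auto
  moreover have "f p = q" if "(p, q) \<in> R" for p q
  proof (cases "(p, q) = (p0, q0)")
    case True
    then show ?thesis using zero h rotation_zero C0 by (simp add: f_def)
  next
    case False
    then have "(\<alpha> p, \<beta> q) \<in> R'" using that by (force simp: R'_def)
    then have "h (\<alpha> p) = m (\<alpha> p)" "m (\<alpha> p) = \<beta> q" using h(3) m_eq by force+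
    then have "h (\<alpha> p) = \<beta> q" by simp
    then show ?thesis
      using circle_inv_right[OF rotation_aut, of q0 q] C0 that assms by (auto simp: f_def \<beta>_def)
  qed
  ultimately show ?thesis by auto
qed

section \<open>Actions on the circle and the orders they induce\<close>

definition letter_map :: "(nat \<Rightarrow> real \<Rightarrow> real) \<Rightarrow> nat letter \<Rightarrow> real \<Rightarrow> real"
  where "letter_map F x = (if snd x then circle_inv (F (fst x)) else F (fst x))"

definition action :: "(nat \<Rightarrow> real \<Rightarrow> real) \<Rightarrow> nat letter list \<Rightarrow> real \<Rightarrow> real"
  where "action F w = foldr (letter_map F) w"

definition orbit_tie :: "(nat \<Rightarrow> real \<Rightarrow> real) \<Rightarrow> nat letter list \<Rightarrow> nat letter list \<Rightarrow> int"
  where "orbit_tie F u v = (if action F u 0 = action F v 0 then order_sign u v else 0)"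

text \<open>Points with the same image in the orbit of \<open>0\<close> are ordered by the left order or by its reverse.\<close>

definition orbit_order :: "nat set \<Rightarrow> (nat \<Rightarrow> real \<Rightarrow> real) \<Rightarrow> int \<Rightarrow> nat letter list \<times> nat letter list \<times> nat letter list \<Rightarrow> int"
  where "orbit_order S F \<sigma> = restrict (\<lambda>(u, v, w). ccw (action F u 0, action F v 0, action F w 0)
    + \<sigma> * (orbit_tie F u v + orbit_tie F v w + orbit_tie F w u)) (words S \<times> words S \<times> words S)"

lemma circular_orders_iff:
  "c \<in> circular_orders (free_group S) \<longleftrightarrow> c \<in> extensional (words S \<times> words S \<times> words S) \<and>
    cyclic_order (words S) c \<and>
    (\<forall>g\<in>words S. \<forall>u\<in>words S. \<forall>v\<in>words S. \<forall>w\<in>words S. c (mul g u, mul g v, mul g w) = c (u, v, w))"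
proof -
  have [simp]: "carrier (free_group S) = words S" "monoid.mult (free_group S) = mul"
    by (simp_all add: free_group_def words_def)
  show ?thesis
    unfolding circular_orders_def cyclic_order_def PiE_def Pi_def by auto
qed

context
  fixes F :: "nat \<Rightarrow> real \<Rightarrow> real"
  assumes F: "\<And>k. circle_aut (F k)"
begin

lemma letter_map_aut: "circle_aut (letter_map F x)"
  using F circle_aut_inv by (simp add: letter_map_def)

lemma action_aut: "circle_aut (action F w)"
proof (induction w)
  case Nil
  then show ?case using circle_aut_id by (simp add: action_def id_def)
next
  case (Cons x w)
  have "action F (x # w) = letter_map F x \<circ> action F w"
    by (simp add: action_def)
  then show ?case using circle_aut_comp[OF Cons.IH letter_map_aut] by metis
qed

lemma action_in: "p \<in> circle \<Longrightarrow> action F w p \<in> circle"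
  using circle_aut_in[OF action_aut] .

lemma letter_map_flip: "p \<in> circle \<Longrightarrow> letter_map F x (letter_map F (flip x) p) = p"
  using circle_inv_left[OF F] circle_inv_right[OF F] by (simp add: letter_map_def flip_def)

lemma action_push: "p \<in> circle \<Longrightarrow> action F (push x w) p = letter_map F x (action F w p)"
proof (cases w)
  case (Cons y v)
  assume "p \<in> circle"
  then have "letter_map F x (letter_map F (flip x) (action F v p)) = action F v p"
    using letter_map_flip action_in by blast
  then show ?thesis using Cons by (simp add: action_def)
qed (simp add: action_def)

lemma action_mul: "p \<in> circle \<Longrightarrow> action F (mul u v) p = action F u (action F v p)"
proof (induction u)
  case (Cons x u)
  have "action F (mul (x # u) v) p = letter_map F x (action F (mul u v) p)"
    using action_push[OF Cons.prems, of x "mul u v"] by simp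
  then show ?case using Cons by (simp add: action_def)
qed (simp add: action_def)

text \<open>A lexicographic refinement: the tie term vanishes on triples with distinct images, and
  \<open>ccw\<close> vanishes on all others. Ties are antisymmetric in their two arguments, so their
  sum is a coboundary and the cocycle identity is inherited from \<open>ccw\<close>.\<close>

lemma orbit_order_circular:
  assumes \<sigma>: "\<sigma> \<in> {1, -1}"
  shows "orbit_order S F \<sigma> \<in> circular_orders (free_group S)"
  unfolding circular_orders_iff
proof (intro conjI ballI)
  let ?y = "\<lambda>u. action F u 0"
  let ?c = "orbit_order S F \<sigma>"
  have y: "?y u \<in> circle" for u by (intro action_in) simp
  show "?c \<in> extensional (words S \<times> words S \<times> words S)"
    by (simp add: orbit_order_def)
  have c: "?c (u, v, w) = ccw (?y u, ?y v, ?y w) + \<sigma> * (orbit_tie F u v + orbit_tie F v w + orbit_tie F w u)"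
    if "u \<in> words S" "v \<in> words S" "w \<in> words S" for u v w
    using that by (simp add: orbit_order_def)
  have tie: "orbit_tie F v u = - orbit_tie F u v" if "u \<in> words S" "v \<in> words S" for u v
    using order_sign_antisym[OF that] by (simp add: orbit_tie_def)
  have tie0: "orbit_tie F u u = 0" if "u \<in> words S" for u
    using order_sign_cases(2)[OF that that] by (simp add: orbit_tie_def)
  have val: "?c (u, v, w) \<in> {0, 1, -1} \<and> (?c (u, v, w) = 0 \<longleftrightarrow> u = v \<or> u = w \<or> v = w)"
    if W: "u \<in> words S" "v \<in> words S" "w \<in> words S" for u v w
  proof (cases "u = v \<or> u = w \<or> v = w")
    case True
    have "ccw (?y u, ?y v, ?y w) = 0" using True by (auto simp: ccw_zero)
    moreover have "orbit_tie F u v + orbit_tie F v w + orbit_tie F w u = 0"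
      using True tie[OF W(1,2)] tie[OF W(1,3)] tie[OF W(2,3)] tie0 W by auto
    ultimately show ?thesis using True c[OF W] by simp
  next
    case False
    have one: "\<sigma> * i \<in> {1, -1}" if "i = 1 \<or> i = -1" for i
      using that \<sigma> by auto
    have "?c (u, v, w) \<in> {1, -1}"
    proof -
      consider "?y u = ?y v" "?y v = ?y w" | "?y u = ?y v" "?y v \<noteq> ?y w" | "?y u \<noteq> ?y v" "?y v = ?y w"
        | "?y u \<noteq> ?y v" "?y v \<noteq> ?y w" "?y u = ?y w" | "?y u \<noteq> ?y v" "?y v \<noteq> ?y w" "?y u \<noteq> ?y w"
        by blast
      then show ?thesis
      proof cases
        case 1
        then have "?c (u, v, w) = \<sigma> * (order_sign u v + order_sign v w + order_sign w u)"
          using c[OF W] ccw_zero[of "?y u" "?y v" "?y w"] by (simp add: orbit_tie_def)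
        then show ?thesis using order_sign_triple[OF W] False one by simp
      next
        case 2
        then have "?c (u, v, w) = \<sigma> * order_sign u v"
          using c[OF W] ccw_zero[of "?y u" "?y v" "?y w"] by (auto simp: orbit_tie_def)
        then show ?thesis using order_sign_cases(1)[OF W(1,2)] False one by simp
      next
        case 3
        then have "?c (u, v, w) = \<sigma> * order_sign v w"
          using c[OF W] ccw_zero[of "?y u" "?y v" "?y w"] by (auto simp: orbit_tie_def)
        then show ?thesis using order_sign_cases(1)[OF W(2,3)] False one by simp
      next
        case 4
        then have "?c (u, v, w) = \<sigma> * order_sign w u"
          using c[OF W] ccw_zero[of "?y u" "?y v" "?y w"] by (auto simp: orbit_tie_def)
        then show ?thesis using order_sign_cases(1)[OF W(3,1)] False one by auto
      next
        case 5
        then have "?c (u, v, w) = ccw (?y u, ?y v, ?y w)"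
          using c[OF W] by (auto simp: orbit_tie_def)
        then show ?thesis using ccw_zero[of "?y u" "?y v" "?y w"] ccw_val[of "?y u" "?y v" "?y w"] 5 by auto
      qed
    qed
    then show ?thesis using False by auto
  qed
  show "cyclic_order (words S) ?c"
  proof
    fix a b d e :: "nat letter list"
    assume W: "a \<in> words S" "b \<in> words S" "d \<in> words S" "e \<in> words S"
    have "?c (b, d, e) - ?c (a, d, e) + ?c (a, b, e) - ?c (a, b, d)
      = \<sigma> * (orbit_tie F e b + orbit_tie F b e - orbit_tie F a d - orbit_tie F d a)"
      using ccw_cocycle[of "?y b" "?y d" "?y e" "?y a"] W by (simp add: c algebra_simps)
    then show "?c (b, d, e) - ?c (a, d, e) + ?c (a, b, e) - ?c (a, b, d) = 0"
      using tie[OF W(2,4)] tie[OF W(1,3)] by simp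
  qed (use val in auto)
  fix g u v w assume W: "g \<in> words S" "u \<in> words S" "v \<in> words S" "w \<in> words S"
  have tie_inv: "orbit_tie F (mul g u) (mul g v) = orbit_tie F u v" if "u \<in> words S" "v \<in> words S" for u v
    using order_sign_invariant[OF W(1) that] circle_aut_inj[OF action_aut y y, of g u v]
    by (simp add: orbit_tie_def action_mul)
  have "?c (mul g u, mul g v, mul g w) = ccw (?y (mul g u), ?y (mul g v), ?y (mul g w))
    + \<sigma> * (orbit_tie F u v + orbit_tie F v w + orbit_tie F w u)"
    unfolding c[OF mul_words[OF W(1,2)] mul_words[OF W(1,3)] mul_words[OF W(1,4)]]
      tie_inv[OF W(2,3)] tie_inv[OF W(3,4)] tie_inv[OF W(4,2)] ..
  also have "ccw (?y (mul g u), ?y (mul g v), ?y (mul g w)) = ccw (?y u, ?y v, ?y w)"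
    using circle_aut_ccw[OF action_aut y y y, of g u v w] by (simp add: action_mul)
  finally show "?c (mul g u, mul g v, mul g w) = ?c (u, v, w)"
    unfolding c[OF W(2-4)] .
qed

end

section \<open>Finite cyclic orders as subsets of the circle\<close>

lemma (in cyclic_order) circle_embedding:
  assumes B: "finite B" "B \<subseteq> X" and e: "e \<in> B"
  shows "\<exists>p. p e = 0 \<and> (\<forall>b\<in>B. p b \<in> circle) \<and> inj_on p B \<and> (\<forall>a\<in>B. \<forall>b\<in>B. \<forall>d\<in>B. ccw (p a, p b, p d) = c (a, b, d))"
proof -
  define below where "below b = {d \<in> B. btw e d b}" for b
  \<comment> \<open>Cutting at \<open>e\<close> orders \<open>B\<close> linearly, and
    \<open>card (below b)\<close> is the position of \<open>b\<close>. The summand 1 keeps the other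
    points away from 0, and the summand 2 keeps all quotients below 1.\<close>
  define p where "p b = (if b = e then 0 else (1 + real (card (below b))) / (2 + real (card B)))" for b
  have fin: "finite (below b)" for b using B by (simp add: below_def)
  have less: "p a < p b" if "a \<in> B" "b \<in> B" "btw e a b" for a b
  proof -
    have X: "a \<in> X" "b \<in> X" "e \<in> X" using that B e by auto
    have "below a \<subseteq> below b"
      using btw_trans[OF _ that(3)] B X unfolding below_def by blast
    moreover have "a \<in> below b" using that by (simp add: below_def)
    moreover have "a \<notin> below a" using btw_distinct[of e a a] X by (auto simp: below_def)
    ultimately have "card (below a) < card (below b)" by (intro psubset_card_mono fin) blast
    moreover have "a \<noteq> e" "b \<noteq> e" using btw_distinct[OF that(3)] X by auto
    ultimately show ?thesis by (simp add: p_def divide_strict_right_mono)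
  qed
  have pos: "0 < p b" "p b < 1" if "b \<noteq> e" for b
  proof -
    have "card (below b) \<le> card B" using B by (intro card_mono) (auto simp: below_def)
    then show "0 < p b" "p b < 1" using that by (auto simp: p_def)
  qed
  have pe: "p e = 0" by (simp add: p_def)
  \<comment> \<open>The sign of the linear order with least element \<open>e\<close>; its cyclic sum
    recovers \<open>c\<close> by the cocycle identity.\<close>
  define s where "s a b = (if a = b then 0 else if a = e then 1 else if b = e then -1 else c (e, a, b))" for a b
  have cmp: "cmp (p a) (p b) = s a b" if "a \<in> B" "b \<in> B" for a b
  proof -
    have X: "a \<in> X" "b \<in> X" "e \<in> X" using that B e by auto
    consider "a = b" | "a \<noteq> b" "a = e" | "a \<noteq> b" "b = e" | "a \<noteq> b" "a \<noteq> e" "b \<noteq> e" by blast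
    then show ?thesis
    proof cases
      case 4
      then consider "btw e a b" | "btw e b a" using btw_total[of e a b] X by blast
      then show ?thesis
      proof cases
        case 1
        then show ?thesis using less[OF that 1] 4 by (simp add: cmp_def s_def)
      next
        case 2
        then show ?thesis using less[OF that(2,1) 2] 4 swap23[of e b a] X by (simp add: cmp_def s_def)
      qed
    qed (use pos[of a] pos[of b] pe in \<open>auto simp: cmp_def s_def\<close>)
  qed
  have "inj_on p B"
  proof (rule inj_onI, rule ccontr)
    fix a b assume ab: "a \<in> B" "b \<in> B" "p a = p b" "a \<noteq> b"
    then have "s a b = 0" using cmp[OF ab(1,2)] by (simp add: cmp_def)
    then show False using ab B e zero_iff[of e a b] by (auto simp: s_def split: if_splits)
  qed
  moreover have "s a b + s b d + s d a = c (a, b, d)" if "a \<in> B" "b \<in> B" "d \<in> B" for a b d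
  proof -
    have X: "a \<in> X" "b \<in> X" "d \<in> X" "e \<in> X" using that B e by auto
    consider "a = b \<or> a = d \<or> b = d" | "a \<noteq> b" "a \<noteq> d" "b \<noteq> d" "a = e" | "a \<noteq> b" "a \<noteq> d" "b \<noteq> d" "b = e"
      | "a \<noteq> b" "a \<noteq> d" "b \<noteq> d" "d = e" | "a \<noteq> b" "a \<noteq> d" "b \<noteq> d" "a \<noteq> e" "b \<noteq> e" "d \<noteq> e" by blast
    then show ?thesis
    proof cases
      case 1
      then have "c (a, b, d) = 0" using zero_iff X by blast
      have s_swap: "s a b + s b a = 0" if "a \<in> X" "b \<in> X" for a b
        using swap23[of e b a] X that by (simp add: s_def)
      have s_refl: "s a a = 0" for a by (simp add: s_def)
      have "s a b + s b d + s d a = 0"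
        using 1
      proof (elim disjE)
        assume "a = b"
        then show ?thesis using s_swap[of a d] s_refl[of a] X by simp
      next
        assume "a = d"
        then show ?thesis using s_swap[of a b] s_refl[of a] X by simp
      next
        assume "b = d"
        then show ?thesis using s_swap[of a b] s_refl[of b] X by simp
      qed
      then show ?thesis using \<open>c (a, b, d) = 0\<close> by simp
    next
      case 2
      then show ?thesis by (simp add: s_def)
    next
      case 3
      then show ?thesis using rot[of e d a] rot[of d a e] X by (simp add: s_def)
    next
      case 4
      then show ?thesis using rot[of e a b] X by (simp add: s_def)
    next
      case 5
      then show ?thesis using cocycle[of e a b d] swap23[of e a d] X by (simp add: s_def)
    qed
  qed
  then have "\<forall>a\<in>B. \<forall>b\<in>B. \<forall>d\<in>B. ccw (p a, p b, p d) = c (a, b, d)"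
    by (simp add: ccw_def cmp)
  moreover have "p b \<in> circle" for b using pos[of b] pe by (cases "b = e") auto
  ultimately show ?thesis using pe by blast
qed

section \<open>Isolated orders\<close>

locale isolated_order = cyclic_order "words S" c
  for S :: "nat set" and c :: "nat letter list \<times> nat letter list \<times> nat letter list \<Rightarrow> int" +
  fixes K :: "nat letter list set"
  assumes invariant: "\<lbrakk>g \<in> words S; u \<in> words S; v \<in> words S; w \<in> words S\<rbrakk> \<Longrightarrow>
      c (mul g u, mul g v, mul g w) = c (u, v, w)"
    and K: "finite K" "K \<subseteq> words S"
    and determined: "\<lbrakk>c' \<in> circular_orders (free_group S);
        \<And>u v w. \<lbrakk>u \<in> K; v \<in> K; w \<in> K\<rbrakk> \<Longrightarrow> c' (u, v, w) = c (u, v, w);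
        u \<in> words S; v \<in> words S; w \<in> words S\<rbrakk> \<Longrightarrow> c' (u, v, w) = c (u, v, w)"
begin

lemma invariant_push: "\<lbrakk>fst x \<in> S; u \<in> words S; v \<in> words S; w \<in> words S\<rbrakk> \<Longrightarrow>
    c (push x u, push x v, push x w) = c (u, v, w)"
  using invariant[OF single_words, of x u v w] by simp

text \<open>Suffix-closure lets the image of the base point under a word of \<open>B\<close> be
  computed letter by letter through points of \<open>B\<close>. Since \<open>K\<close> is contained
  in \<open>B\<close>, a circular order that agrees with \<open>c\<close> on \<open>B\<close> is
  \<open>c\<close>.\<close>

definition good :: "nat letter list set \<Rightarrow> bool"
  where "good B \<longleftrightarrow> finite B \<and> B \<subseteq> words S \<and> K \<subseteq> B \<and> [] \<in> B \<and> (\<forall>x w. x # w \<in> B \<longrightarrow> w \<in> B)"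

lemma goodD:
  assumes "good B"
  shows "finite B" "B \<subseteq> words S" "K \<subseteq> B" "[] \<in> B" "\<And>x w. x # w \<in> B \<Longrightarrow> w \<in> B"
  using assms by (auto simp: good_def)

text \<open>
  If the constraint of \<open>B\<close> on the generator \<open>k\<close> allowed it to move \<open>u\<close> onto \<open>k v\<close>, some action
  would satisfy all constraints of \<open>B\<close> while the base point has a nontrivial stabilizer. Breaking the ties
  by a left order or by its reverse would yield two circular orders that agree on \<open>B\<close>.
\<close>

lemma not_same_gap_positive:
  assumes B: "good B" and k: "k \<in> S" "x = (k, False)"
    and u: "u \<in> B" "push x u \<notin> B" and v: "v \<in> words S" "v \<notin> B" "push x v \<in> B"
  shows "\<not> same_gap {b \<in> B. push x b \<in> B} u v"
proof
  assume same: "same_gap {b \<in> B. push x b \<in> B} u v"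
  obtain p where p: "p [] = 0" "\<And>b. b \<in> B \<Longrightarrow> p b \<in> circle" "inj_on p B"
    "\<And>a b d. \<lbrakk>a \<in> B; b \<in> B; d \<in> B\<rbrakk> \<Longrightarrow> ccw (p a, p b, p d) = c (a, b, d)"
    using circle_embedding[OF goodD(1,2,4)[OF B]] by blast
  have BX: "b \<in> words S" if "b \<in> B" for b using goodD(2)[OF B] that by blast
  have p_inj: "p a = p b \<longleftrightarrow> a = b" if "a \<in> B" "b \<in> B" for a b
    using p(3) that by (auto simp: inj_on_def)
  have extend: "\<exists>f. circle_aut f \<and> (\<forall>a\<in>A. f (p a) = p (t a))"
    if A: "A \<subseteq> B" and t: "\<And>a. a \<in> A \<Longrightarrow> t a \<in> B" "\<And>a b. \<lbrakk>a \<in> A; b \<in> A\<rbrakk> \<Longrightarrow> t a = t b \<longleftrightarrow> a = b"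
      "\<And>a b d. \<lbrakk>a \<in> A; b \<in> A; d \<in> A\<rbrakk> \<Longrightarrow> c (t a, t b, t d) = c (a, b, d)" for A t
  proof -
    let ?R = "(\<lambda>a. (p a, p (t a))) ` A"
    have fin: "finite ?R" using finite_subset[OF A goodD(1)[OF B]] by simp
    have sub: "?R \<subseteq> circle \<times> circle" using p(2) A t(1) by blast
    have inj: "y = y' \<longleftrightarrow> z = z'" if "(y, z) \<in> ?R" "(y', z') \<in> ?R" for y z y' z'
      using that t(1,2) A p_inj by (auto simp: subset_iff)
    have ccw: "ccw (y, y', y'') = ccw (z, z', z'')"
      if R: "(y, z) \<in> ?R" "(y', z') \<in> ?R" "(y'', z'') \<in> ?R" for y z y' z' y'' z''
    proof -
      obtain a b d where abd: "a \<in> A" "b \<in> A" "d \<in> A" "y = p a" "z = p (t a)" "y' = p b" "z' = p (t b)"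
        "y'' = p d" "z'' = p (t d)" using R by blast
      then have "a \<in> B" "b \<in> B" "d \<in> B" using A by auto
      then show ?thesis
        using p(4)[of a b d] p(4)[OF t(1)[OF abd(1)] t(1)[OF abd(2)] t(1)[OF abd(3)]] t(3)[OF abd(1-3)]
        unfolding abd(4-9) by simp
    qed
    have "\<exists>f. circle_aut f \<and> (\<forall>(y, z)\<in>?R. f y = z)"
      using circle_extension[OF fin sub inj ccw] .
    then show ?thesis by auto
  qed
  define P where "P = {b \<in> B. push x b \<in> B}"
  \<comment> \<open>The generator will send \<open>p u\<close> to \<open>p (push x v)\<close>, the
    value that belongs to \<open>v\<close>. As \<open>u\<close> and \<open>v\<close> have the same
    position relative to \<open>P\<close>, this respects the constraints on
    \<open>P\<close>.\<close>
  define hat where "hat a = (if a = u then v else a)" for a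
  have x: "fst x \<in> S" using k by simp
  have uv: "u \<notin> P" "v \<notin> P" "u \<noteq> v" using u v by (auto simp: P_def)
  have PX: "b \<in> words S" if "b \<in> insert u P" for b using that u BX by (auto simp: P_def)
  have hatX: "hat b \<in> words S" if "b \<in> insert u P" for b using PX[OF that] v by (simp add: hat_def)
  have hat_inj: "hat a = hat b \<longleftrightarrow> a = b" if "a \<in> insert u P" "b \<in> insert u P" for a b
    using that uv by (auto simp: hat_def)
  have hat_c: "c (hat a, hat b, hat d) = c (a, b, d)"
    if P: "a \<in> insert u P" "b \<in> insert u P" "d \<in> insert u P" for a b d
  proof (cases "a = b \<or> a = d \<or> b = d")
    case True
    then have "hat a = hat b \<or> hat a = hat d \<or> hat b = hat d" by auto
    then show ?thesis using True zero_iff[of a b d] zero_iff[of "hat a" "hat b" "hat d"] P PX hatX by metis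
  next
    case False
    have sg: "c (u, b, d) = c (v, b, d)" if "b \<in> P" "d \<in> P" for b d
      using same that by (simp add: same_gap_def P_def)
    consider "a = u" "b \<in> P" "d \<in> P" | "b = u" "a \<in> P" "d \<in> P" | "d = u" "a \<in> P" "b \<in> P"
      | "a \<in> P" "b \<in> P" "d \<in> P" using P False by blast
    then show ?thesis
    proof cases
      case 1
      then show ?thesis using sg uv by (auto simp: hat_def)
    next
      case 2
      then have "c (a, v, d) = c (a, u, d)"
        using sg[of d a] rot[of a v d] rot[of a u d] P PX v by simp
      then show ?thesis using 2 uv by (auto simp: hat_def)
    next
      case 3
      then have "c (a, b, v) = c (a, b, u)"
        using sg[of a b] rot[of v a b] rot[of u a b] P PX v by simp
      then show ?thesis using 3 uv by (auto simp: hat_def)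
    next
      case 4
      then show ?thesis using uv by (auto simp: hat_def)
    qed
  qed
  have "\<exists>f. circle_aut f \<and> (j \<in> S \<longrightarrow> (\<forall>b\<in>B. push (j, False) b \<in> B \<longrightarrow> f (p b) = p (push (j, False) b)))
    \<and> (j = k \<longrightarrow> f (p u) = p (push x v))" for j
  proof -
    consider "j = k" | "j \<noteq> k" "j \<in> S" | "j \<noteq> k" "j \<notin> S" by blast
    then show ?thesis
    proof cases
      case 1
      have "\<exists>f. circle_aut f \<and> (\<forall>a\<in>insert u P. f (p a) = p (push x (hat a)))"
      proof (rule extend)
        show "insert u P \<subseteq> B" using u by (auto simp: P_def)
        show "push x (hat a) \<in> B" if "a \<in> insert u P" for a
          using that v uv by (auto simp: hat_def P_def)
        show "push x (hat a) = push x (hat b) \<longleftrightarrow> a = b" if "a \<in> insert u P" "b \<in> insert u P" for a b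
          using hat_inj[OF that] push_eq_iff[OF hatX[OF that(1)] hatX[OF that(2)]] by simp
        show "c (push x (hat a), push x (hat b), push x (hat d)) = c (a, b, d)"
          if "a \<in> insert u P" "b \<in> insert u P" "d \<in> insert u P" for a b d
          using invariant_push[OF x hatX hatX hatX, OF that] hat_c[OF that] by simp
      qed
      then obtain f where f: "circle_aut f" "\<And>a. a \<in> insert u P \<Longrightarrow> f (p a) = p (push x (hat a))" by blast
      have "f (p u) = p (push x v)" using f(2)[of u] by (simp add: hat_def)
      moreover have "f (p b) = p (push x b)" if "b \<in> B" "push x b \<in> B" for b
        using f(2)[of b] that u by (auto simp: hat_def P_def split: if_splits)
      ultimately show ?thesis using f(1) 1 k by blast
    next
      case 2
      have "\<exists>f. circle_aut f \<and> (\<forall>a\<in>{b \<in> B. push (j, False) b \<in> B}. f (p a) = p (push (j, False) a))"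
        using invariant_push[of "(j, False)"] push_eq_iff[of _ S _ "(j, False)"] 2 BX
        by (intro extend) auto
      then show ?thesis using 2 by auto
    next
      case 3
      then show ?thesis using circle_aut_id by blast
    qed
  qed
  then obtain F where F: "\<And>j. circle_aut (F j)"
    and Fp: "\<And>j b. \<lbrakk>j \<in> S; b \<in> B; push (j, False) b \<in> B\<rbrakk> \<Longrightarrow> F j (p b) = p (push (j, False) b)"
    and Fu: "F k (p u) = p (push x v)"
    by metis
  \<comment> \<open>Each step stays inside \<open>B\<close>, where the generators are prescribed;
    for an inverse letter the constraint at the longer word is read backwards.\<close>
  have act: "action F b 0 = p b" if "b \<in> B" for b
    using that
  proof (induction b)
    case Nil
    then show ?case using p(1) by (simp add: action_def)
  next
    case (Cons y w)
    then have w: "w \<in> B" "action F w 0 = p w" using goodD(5)[OF B] by auto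
    obtain j s where y: "y = (j, s)" by (cases y)
    have j: "j \<in> S" using BX[OF Cons.prems] y by (simp add: words_Cons)
    have "letter_map F y (p w) = p (y # w)"
    proof (cases s)
      case False
      have "push y w = y # w" using push_words_eq BX[OF Cons.prems] by blast
      then show ?thesis using Fp[OF j w(1)] Cons.prems y False by (simp add: letter_map_def)
    next
      case True
      have "push (j, False) (y # w) = w" using y True by (simp add: flip_def)
      then have "F j (p (y # w)) = p w" using Fp[OF j Cons.prems] w(1) by simp
      then show ?thesis
        using circle_inv_left[OF F p(2)[OF Cons.prems], of j] y True by (simp add: letter_map_def)
    qed
    then show ?case using w by (simp add: action_def)
  qed
  have zero: "(0::real) \<in> circle" by simp
  let ?a = "push x u" and ?b = "push x v"
  \<comment> \<open>\<open>push x u\<close> and \<open>push x v\<close> both move the base point to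
    \<open>p (push x v)\<close>, so their quotient fixes it.\<close>
  define w where "w = mul (winv ?b) ?a"
  have W: "?a \<in> words S" "?b \<in> words S" "w \<in> words S" "mul w w \<in> words S"
    using push_words[OF x] BX u v by (auto simp: w_def intro!: mul_words winv_words)
  have "w \<noteq> []" using mul_eq_Nil_iff[OF W(2,1)] u v by (auto simp: w_def)
  have "action F ?a 0 = action F ?b 0"
    using action_push[of F 0 x u, OF F zero] act[OF u(1)] Fu act[OF v(3)] k by (simp add: letter_map_def F)
  then have "action F w 0 = action F (winv ?b) (action F ?b 0)"
    using action_mul[of F 0 "winv ?b" ?a, OF F zero] by (simp add: w_def)
  also have "\<dots> = 0" using action_mul[of F 0 "winv ?b" ?b, OF F zero] mul_winv_left[of ?b] by (simp add: action_def)
  finally have w0: "action F w 0 = 0" .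
  have ww0: "action F (mul w w) 0 = 0" using action_mul[of F 0 w w, OF F zero] w0 by simp
  have order: "orbit_order S F \<sigma> (y, z, t) = c (y, z, t)"
    if \<sigma>: "\<sigma> \<in> {1, -1}" and yz: "y \<in> words S" "z \<in> words S" "t \<in> words S" for \<sigma> y z t
  proof (rule determined[OF orbit_order_circular[OF F \<sigma>] _ yz])
    fix a b d assume "a \<in> K" "b \<in> K" "d \<in> K"
    then have K: "a \<in> B" "b \<in> B" "d \<in> B" using goodD(3)[OF B] by auto
    have "orbit_tie F a b = 0" if "a \<in> B" "b \<in> B" for a b
      using that act p_inj order_sign_cases(2)[of b S b] BX by (simp add: orbit_tie_def)
    then show "orbit_order S F \<sigma> (a, b, d) = c (a, b, d)"
      using K BX p(4) act by (simp add: orbit_order_def)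
  qed
  \<comment> \<open>The elements \<open>1\<close>, \<open>w\<close> and \<open>w w\<close> all fix
    the base point, so the order of this triple comes from the tie-breaking alone and changes sign
    with \<open>\<sigma>\<close>.\<close>
  define i where "i = order_sign [] w + order_sign w (mul w w) + order_sign (mul w w) []"
  have "orbit_order S F \<sigma> ([], w, mul w w) = \<sigma> * i" for \<sigma>
    using W w0 ww0 by (simp add: orbit_order_def orbit_tie_def i_def action_def ccw_def cmp_def)
  then have "i = - i" using order[of 1 "[]" w "mul w w"] order[of "-1" "[]" w "mul w w"] W by simp
  moreover have "i \<in> {1, -1}"
    unfolding i_def
  proof (rule order_sign_triple)
    have inv: "order_sign w (mul w w) = order_sign [] w"
      using order_sign_invariant[OF W(3) _ W(3), of "[]"] mul_Nil_right[OF W(3)] by simp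
    show "mul w w \<in> words S" "w \<in> words S" "[] \<in> words S" "[] \<noteq> w" using W \<open>w \<noteq> []\<close> by auto
    show "w \<noteq> mul w w"
      using mul_eq_iff[of "[]" S w w] W(3) mul_Nil_right[OF W(3)] \<open>w \<noteq> []\<close> by auto
    \<comment> \<open>An element of order two would lie on both sides of \<open>1\<close> in the
      left order.\<close>
    show "[] \<noteq> mul w w"
    proof
      assume "[] = mul w w"
      then have "order_sign [] w = - order_sign [] w"
        using inv order_sign_antisym[of "[]" S w] W(3) by simp
      then show False using order_sign_cases(1)[of "[]" S w] W(3) \<open>w \<noteq> []\<close> by auto
    qed
  qed
  ultimately show False by auto
qed

text \<open>For an inverse letter, translation by \<open>x\<close> turns the claim into the one for
  \<open>flip x\<close>, with \<open>push x v\<close> and \<open>push x u\<close> in the roles of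
  \<open>u\<close> and \<open>v\<close>.\<close>

lemma not_same_gap:
  assumes B: "good B" and x: "fst x \<in> S"
    and u: "u \<in> B" "push x u \<notin> B" and v: "v \<in> words S" "v \<notin> B" "push x v \<in> B"
  shows "\<not> same_gap {b \<in> B. push x b \<in> B} u v"
proof (cases "snd x")
  case False
  then have "x = (fst x, False)" by (cases x) simp
  then show ?thesis using not_same_gap_positive[OF B x _ u v] by blast
next
  case True
  then have y: "flip x = (fst x, False)" by (simp add: flip_def)
  have W: "u \<in> words S" using goodD(2)[OF B] u by blast
  have *: "\<not> same_gap {b \<in> B. push (flip x) b \<in> B} (push x v) (push x u)"
    using push_flip[OF W] push_flip[OF v(1)] u v push_words[OF x W]
    by (intro not_same_gap_positive[OF B x y]) auto
  show ?thesis
  proof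
    assume same: "same_gap {b \<in> B. push x b \<in> B} u v"
    have "c (push x v, b, d) = c (push x u, b, d)"
      if b: "b \<in> B" "push (flip x) b \<in> B" and d: "d \<in> B" "push (flip x) d \<in> B" for b d
    proof -
      have BW: "b \<in> words S" "d \<in> words S" "push (flip x) b \<in> words S" "push (flip x) d \<in> words S"
        using b d goodD(2)[OF B] by auto
      have "c (u, push (flip x) b, push (flip x) d) = c (v, push (flip x) b, push (flip x) d)"
        using same b d push_flip'[OF BW(1)] push_flip'[OF BW(2)] by (simp add: same_gap_def)
      then show ?thesis
        using invariant_push[OF x W BW(3,4)] invariant_push[OF x v(1) BW(3,4)]
          push_flip'[OF BW(1)] push_flip'[OF BW(2)] by simp
    qed
    then show False using * by (auto simp: same_gap_def)
  qed
qed

end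

section \<open>First letters are constant on gaps\<close>

context isolated_order
begin

lemma good_tails: "good B \<Longrightarrow> w \<in> B \<Longrightarrow> tails w \<subseteq> B"
  by (induction w) (auto dest: goodD)

lemma good_extend: "good B \<Longrightarrow> w \<in> words S \<Longrightarrow> good (B \<union> tails w)"
  using tails_words[of w S] by (auto simp: good_def dest: tails_ConsD)

lemma ex_good:
  assumes "finite A" "A \<subseteq> words S"
  shows "\<exists>B. good B \<and> A \<subseteq> B"
proof (intro exI conjI)
  let ?B = "insert [] (\<Union>w\<in>K \<union> A. tails w)"
  show "A \<subseteq> ?B" by auto
  have "K \<subseteq> ?B" by auto
  moreover have "?B \<subseteq> words S" using tails_words assms K by fastforce
  moreover have "w \<in> ?B" if "x # w \<in> ?B" for x w
  proof -
    obtain v where v: "v \<in> K \<union> A" "x # w \<in> tails v" using \<open>x # w \<in> ?B\<close> by auto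
    then show ?thesis using tails_ConsD[OF v(2)] by blast
  qed
  moreover have "finite ?B" using assms K by simp
  ultimately show "good ?B" unfolding good_def by blast
qed

definition gap_minimal :: "nat letter list set \<Rightarrow> nat letter list \<Rightarrow> bool"
  where "gap_minimal B g \<longleftrightarrow> g \<in> words S - B \<and> (\<forall>h\<in>tails g. h \<noteq> g \<longrightarrow> h \<notin> B \<longrightarrow> \<not> same_gap B g h)"

text \<open>If \<open>g\<close> begins with \<open>x\<close> and \<open>g'\<close> does not, add the
  proper suffixes of \<open>g\<close> and all suffixes of \<open>g'\<close> to \<open>B\<close>. By
  \<open>not_same_gap\<close> for \<open>flip x\<close>, the points of the enlarged set whose
  translates stay in it separate \<open>g\<close> from \<open>g'\<close>, so one of them lies in the
  common gap. Minimality leaves only \<open>g\<close> and \<open>g'\<close>, and neither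
  qualifies.\<close>

lemma gap_minimal_hd:
  assumes B: "good B" and g: "gap_minimal B g" and g': "gap_minimal B g'" and same: "same_gap B g g'"
  shows "hd g = hd g'"
proof (rule ccontr)
  assume ne: "hd g \<noteq> hd g'"
  have gB: "g \<in> words S - B" "g' \<in> words S - B" using g g' by (auto simp: gap_minimal_def)
  have minimal: "h = g" if "h \<in> tails g" "h \<notin> B" "same_gap B g h" for h
    using g that by (auto simp: gap_minimal_def)
  have minimal': "h = g'" if "h \<in> tails g'" "h \<notin> B" "same_gap B g' h" for h
    using g' that by (auto simp: gap_minimal_def)
  obtain x h where x: "g = x # h" using gB goodD(4)[OF B] by (cases g) auto
  have W: "h \<in> words S" "fst x \<in> S" using gB x by (auto simp: words_Cons)
  have "g' \<noteq> []" using gB goodD(4)[OF B] by auto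
  define B' where "B' = B \<union> tails h \<union> tails g'"
  have B': "good B'" unfolding B'_def using good_extend B W gB by blast
  have push_g': "push (flip x) g' = flip x # g'"
    using ne x by (intro push_noncancel) auto
  have u: "push (flip x) g' \<notin> B'"
  proof
    assume "push (flip x) g' \<in> B'"
    then consider "flip x # g' \<in> B" | "flip x # g' \<in> tails h" | "flip x # g' \<in> tails g'"
      using push_g' by (auto simp: B'_def)
    then show False
    proof cases
      case 1
      then show False using goodD(5)[OF B] gB by blast
    next
      case 2
      then have "g' \<in> tails g" using x tails_ConsD[OF 2] by simp
      then show False using minimal[of g'] gB same ne by blast
    next
      case 3
      then show False using tails_length by fastforce
    qed
  qed
  have v: "g \<notin> B'"
  proof
    assume "g \<in> B'"
    then have "g \<in> tails g'" using gB x tails_length[of g h] by (auto simp: B'_def)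
    then show False using minimal'[of g] gB same_gap_sym[OF same] ne by blast
  qed
  have "push (flip x) g = h" using x by simp
  then have "\<not> same_gap {b \<in> B'. push (flip x) b \<in> B'} g' g"
    using not_same_gap[OF B', of "flip x" g' g] u v gB W by (auto simp: B'_def)
  then obtain p where p: "p \<in> B'" "push (flip x) p \<in> B'" "p \<notin> B" "same_gap B g' p"
    using gap_convex[OF goodD(2)[OF B] gB(2,1) same_gap_sym[OF same], of "{b \<in> B'. push (flip x) b \<in> B'}"]
      goodD(2)[OF B'] by blast
  then consider "p \<in> tails h" | "p \<in> tails g'" by (auto simp: B'_def)
  then show False
  proof cases
    case 1
    then have "p = g" using minimal[of p] p same_gap_trans[OF same p(4)] x by auto
    then show False using v p by blast
  next
    case 2
    then have "p = g'" using minimal'[of p] p by auto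
    then show False using u p by blast
  qed
qed

lemma ex_gap_minimal:
  assumes "g \<in> words S - B"
  shows "\<exists>u\<in>tails g. gap_minimal B u \<and> same_gap B g u"
  using assms
proof (induction "length g" arbitrary: g rule: less_induct)
  case less
  show ?case
  proof (cases "gap_minimal B g")
    case True
    then show ?thesis using same_gap_refl tails_self by blast
  next
    case False
    then obtain h where h: "h \<in> tails g" "h \<noteq> g" "h \<notin> B" "same_gap B g h"
      using less.prems by (auto simp: gap_minimal_def)
    then obtain u where u: "u \<in> tails h" "gap_minimal B u" "same_gap B h u"
      using less.hyps[of h] tails_neq_length tails_words less.prems by blast
    have "tails h \<subseteq> tails g" using h(1) by (induction g) auto
    then show ?thesis using u same_gap_trans[OF h(4)] by blast
  qed
qed

text \<open>If \<open>g = y # h\<close> began differently from \<open>u\<close>, some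
  \<open>y # b\<close> with \<open>b\<close> in \<open>B\<close> would lie in the gap of
  \<open>g\<close>. Its proper suffixes belong to \<open>B\<close>, so it is minimal, and its first
  letter \<open>y\<close> contradicts \<open>gap_minimal_hd\<close>. To find \<open>b\<close>, two
  elements of the gap are translated by \<open>y^-1\<close>; their images begin differently and are
  shorter than \<open>g\<close>, so by induction \<open>B\<close> separates them.\<close>

lemma same_gap_minimal_hd:
  assumes B: "good B" and "g \<in> words S - B" "gap_minimal B u" "same_gap B g u"
  shows "hd g = hd u"
  using assms(2-)
proof (induction "length g" arbitrary: g u rule: less_induct)
  case less
  note IH = less.hyps
  show ?case
  proof (rule ccontr)
    assume ne: "hd g \<noteq> hd u"
    obtain y h where y: "g = y # h" using less.prems goodD(4)[OF B] by (cases g) auto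
    have W: "h \<in> words S" "fst y \<in> S" using less.prems y by (auto simp: words_Cons)
    obtain u0 where u0: "u0 \<in> tails g" "gap_minimal B u0" "same_gap B g u0"
      using ex_gap_minimal less.prems by blast
    have "same_gap B u0 u" using u0(3) less.prems(3) same_gap_sym same_gap_trans by blast
    then have hd_u0: "hd u0 = hd u" using gap_minimal_hd[OF B u0(2) less.prems(2)] by blast
    then have u0h: "u0 \<in> tails h" using u0(1) ne y by auto
    have u0B: "u0 \<in> words S - B" using u0(2) by (auto simp: gap_minimal_def)
    define B' where "B' = B \<union> tails h"
    have B': "good B'" unfolding B'_def using good_extend B W by blast
    have gB': "g \<notin> B'" using less.prems y tails_length[of g h] by (auto simp: B'_def)
    have push_g: "push (flip y) g = h" using y by simp
    \<comment> \<open>The second element of the gap has to be a proper suffix of \<open>g\<close>,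
      and so must its translate be, to stay within reach of the induction. If the translate of
      \<open>u0\<close> leaves \<open>B'\<close>, a separating point replaces
      \<open>u0\<close>.\<close>
    have "\<exists>p\<in>tails h. p \<notin> B \<and> same_gap B g p \<and> push (flip y) p \<in> B'"
    proof (cases "push (flip y) u0 \<in> B'")
      case True
      then show ?thesis using u0h u0B u0(3) by blast
    next
      case False
      then have "\<not> same_gap {b \<in> B'. push (flip y) b \<in> B'} u0 g"
        using not_same_gap[OF B', of "flip y" u0 g] gB' push_g less.prems W u0h by (auto simp: B'_def)
      then obtain p where "p \<in> B'" "push (flip y) p \<in> B'" "p \<notin> B" "same_gap B u0 p"
        using gap_convex[OF goodD(2)[OF B] u0B less.prems(1) same_gap_sym[OF u0(3)],
            of "{b \<in> B'. push (flip y) b \<in> B'}"] goodD(2)[OF B'] by blast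
      then show ?thesis using same_gap_trans[OF u0(3)] by (auto simp: B'_def)
    qed
    then obtain p where p: "p \<in> tails h" "p \<notin> B" "same_gap B g p" "push (flip y) p \<in> B'" by blast
    have pW: "p \<in> words S - B" using p tails_words[OF W(1)] by blast
    have "length p < length g" using tails_length[OF p(1)] y by simp
    then have "hd p = hd u"
      using IH[of p u] pW less.prems(2,3) same_gap_trans[OF same_gap_sym[OF p(3)]] by blast
    then have push_p: "push (flip y) p = flip y # p" using ne y by (intro push_noncancel) auto
    define k where "k = flip y # p"
    have "k \<notin> B" using goodD(5)[OF B, of "flip y" p] p(2) by (auto simp: k_def)
    then have k: "k \<in> tails h" "k \<notin> B" using p(4) push_p by (auto simp: k_def B'_def)
    have kW: "k \<in> words S - B" using k tails_words[OF W(1)] by blast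
    have kp: "push y k = p" by (simp add: k_def)
    have hg: "push y h = g" using push_words_eq y less.prems(1) by blast
    have "\<exists>b\<in>B. push y b \<notin> B \<and> same_gap B g (push y b)"
    proof (cases "h \<in> B")
      case True
      then show ?thesis using hg less.prems(1) same_gap_refl by (intro bexI[of _ h]) auto
    next
      case False
      \<comment> \<open>In a common gap \<open>h\<close> would share the first letter
        \<open>flip y\<close> of \<open>k\<close>, but \<open>y # h\<close> is reduced.\<close>
      have "\<not> same_gap B h k"
      proof
        assume hk: "same_gap B h k"
        obtain u1 where u1: "gap_minimal B u1" "same_gap B h u1"
          using ex_gap_minimal[of h B] W False by blast
        have "hd h = hd u1" using IH[of h u1] u1 W False y by auto
        moreover have "hd k = hd u1"
          using IH[of k u1] kW u1 same_gap_trans[OF same_gap_sym[OF hk]] tails_length[OF k(1)] y by auto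
        ultimately have "hd h = flip y" by (simp add: k_def)
        moreover have "h \<noteq> []" using False goodD(4)[OF B] by auto
        ultimately show False using less.prems(1) y by (auto simp: words_Cons)
      qed
      then obtain b d where bd: "b \<in> B" "d \<in> B" "c (h, b, d) \<noteq> c (k, b, d)" by (auto simp: same_gap_def)
      have bdW: "b \<in> words S" "d \<in> words S" using bd goodD(2)[OF B] by auto
      have "c (g, push y b, push y d) \<noteq> c (p, push y b, push y d)"
        using invariant_push[OF W(2,1) bdW] invariant_push[OF W(2) _ bdW, of k] kW bd hg kp by auto
      then have "\<not> same_gap (push y ` B) g p" using bd by (auto simp: same_gap_def)
      moreover have "push y ` B \<subseteq> words S" using push_words[OF W(2)] goodD(2)[OF B] by blast
      ultimately show ?thesis
        using gap_convex[OF goodD(2)[OF B] less.prems(1) pW p(3), of "push y ` B"] by blast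
    qed
    then obtain b where b: "b \<in> B" "push y b \<notin> B" "same_gap B g (push y b)" by blast
    have pb: "push y b = y # b"
      using b goodD(5)[OF B] by (cases b) (auto split: if_splits)
    have "gap_minimal B (y # b)"
      using b pb good_tails[OF B b(1)] push_words[OF W(2), of b] goodD(2)[OF B]
      by (auto simp: gap_minimal_def)
    moreover have "same_gap B (y # b) u"
      using same_gap_trans[OF same_gap_sym[OF b(3)] less.prems(3)] pb by simp
    ultimately have "hd (y # b) = hd u" using gap_minimal_hd[OF B _ less.prems(2)] by blast
    then show False using ne y by simp
  qed
qed

lemma same_gap_hd:
  assumes B: "good B" and "g \<in> words S - B" "g' \<in> words S - B" "same_gap B g g'"
  shows "hd g = hd g'"
proof -
  obtain u where u: "gap_minimal B u" "same_gap B g u" using ex_gap_minimal assms by blast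
  then have "same_gap B g' u" using assms(4) same_gap_sym same_gap_trans by blast
  then show ?thesis using same_gap_minimal_hd[OF B] assms u by metis
qed

lemma right_gap_hd:
  assumes "good B" "b \<in> B" "right_gap B b g" "right_gap B b h"
  shows "hd g = hd h"
  using assms same_gap_hd right_gap_same_gap[OF goodD(2)] by (meson right_gap_def)

section \<open>The tree edge selected by the gap after a point\<close>

lemma btw_push:
  "\<lbrakk>fst x \<in> S; u \<in> words S; v \<in> words S; w \<in> words S\<rbrakk> \<Longrightarrow> btw (push x u) (push x v) (push x w) \<longleftrightarrow> btw u v w"
  by (simp add: invariant_push)

text \<open>Write \<open>g = y # h\<close> and suppose that \<open>y^-1 b\<close> is outside
  \<open>B\<close>. If the gap after \<open>b\<close> contains some \<open>push y b'\<close> with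
  \<open>b'\<close> in \<open>B\<close>, then \<open>not_same_gap\<close> places a point of
  \<open>B\<close> before it. Otherwise translation by \<open>y^-1\<close> carries the arc from
  \<open>b\<close> to \<open>g\<close> to an arc that misses \<open>B\<close>, although its
  endpoints \<open>y^-1 b\<close> and \<open>h\<close> begin differently.\<close>

lemma right_gap_push:
  assumes B: "good B" and b: "b \<in> B" and g: "right_gap B b g"
  shows "push (flip (hd g)) b \<in> B"
proof (rule ccontr)
  have gW: "g \<in> words S - B" and bW: "b \<in> words S" using g b goodD(2)[OF B] by (auto simp: right_gap_def)
  obtain y h where y: "g = y # h" using gW goodD(4)[OF B] by (cases g) auto
  have W: "h \<in> words S" "fst y \<in> S" "fst (flip y) \<in> S" using gW y by (auto simp: words_Cons)
  assume "push (flip (hd g)) b \<notin> B"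
  then have xb: "push (flip y) b \<notin> B" using y by simp
  show False
  proof (cases "\<exists>b'\<in>B. right_gap B b (push y b')")
    case True
    then obtain b' where b': "b' \<in> B" "right_gap B b (push y b')" by blast
    have b'W: "b' \<in> words S" using b' goodD(2)[OF B] by blast
    have v: "push y b' \<in> words S" "push y b' \<notin> B" using b' by (auto simp: right_gap_def)
    let ?P = "{b \<in> B. push (flip y) b \<in> B}"
    have "\<not> same_gap ?P b (push y b')"
      using not_same_gap[OF B W(3) b xb v] push_flip[OF b'W] b' by simp
    then have "\<exists>p\<in>?P. btw b p (push y b')"
      using same_gap_iff[of ?P b "push y b'"] goodD(2)[OF B] bW xb v by blast
    then show False using b' by (auto simp: right_gap_def)
  next
    case False
    have yh: "push y h = g" using push_words_eq y gW by blast
    have yxb: "push y (push (flip y) b) = b" using push_flip'[OF bW] .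
    have xbW: "push (flip y) b \<in> words S" using push_words W bW by blast
    have hB: "h \<notin> B" using False yh g by auto
    have "\<not> btw (push (flip y) b) d h" if "d \<in> B" for d
    proof
      assume "btw (push (flip y) b) d h"
      moreover have dW: "d \<in> words S" using that goodD(2)[OF B] by blast
      ultimately have "btw b (push y d) g"
        using btw_push[OF W(2) xbW dW W(1)] yh yxb by simp
      then have "right_gap B b (push y d)"
        using right_gap_below[OF goodD(2)[OF B] b g] push_words[OF W(2) dW] by blast
      then show False using False that by blast
    qed
    then have "same_gap B (push (flip y) b) h"
      using same_gap_iff[OF goodD(2)[OF B], of "push (flip y) b" h] xb xbW hB W by blast
    then have "hd (push (flip y) b) = hd h" using same_gap_hd[OF B] xb xbW hB W by blast
    moreover have "push (flip y) b = flip y # b"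
      using b xb goodD(5)[OF B] by (cases b) (auto split: if_splits)
    moreover have "h \<noteq> []" using hB goodD(4)[OF B] by auto
    ultimately show False using gW y by (auto simp: words_Cons)
  qed
qed

text \<open>Write \<open>g = y # h\<close> and compare \<open>h\<close> with \<open>k\<close> on the
  arc after \<open>y^-1 b\<close>. If \<open>h\<close> comes earlier, it lies in the gap of
  \<open>k\<close> but cannot begin with \<open>y^-1\<close>; if \<open>k\<close> does, then
  \<open>y k\<close> lies in the gap of \<open>g\<close> but cannot begin with
  \<open>y\<close>.\<close>

lemma right_gap_no_return:
  assumes B: "good B" and b: "b \<in> B" and g: "right_gap B b g"
    and k: "right_gap B (push (flip (hd g)) b) k" and hd_k: "hd k = flip (hd g)"
  shows False
proof -
  have gW: "g \<in> words S - B" and bW: "b \<in> words S" and kW: "k \<in> words S - B"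
    using g k b goodD(2)[OF B] by (auto simp: right_gap_def)
  obtain y h where y: "g = y # h" using gW goodD(4)[OF B] by (cases g) auto
  obtain k' where k': "k = flip y # k'" using kW goodD(4)[OF B] hd_k y by (cases k) auto
  have W: "h \<in> words S" "fst y \<in> S" "fst (flip y) \<in> S" "k' \<in> words S" using gW kW y k' by (auto simp: words_Cons)
  let ?xb = "push (flip y) b"
  have xb: "?xb \<in> B" using right_gap_push[OF B b g] y by simp
  have xbW: "?xb \<in> words S" using xb goodD(2)[OF B] by blast
  have k2: "right_gap B ?xb k" using k y by simp
  have yh: "push y h = g" using push_words_eq y gW by blast
  have yxb: "push y ?xb = b" using push_flip'[OF bW] .
  have yk: "push y k = k'" using k' by simp
  have h_hd: "h = [] \<or> hd h \<noteq> flip y" using gW y by (auto simp: words_Cons)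
  have k'_hd: "k' = [] \<or> hd k' \<noteq> y" using kW k' by (auto simp: words_Cons)
  have "h \<noteq> k" using h_hd k' by auto
  moreover have "?xb \<noteq> h" using yh yxb b gW by auto
  moreover have "?xb \<noteq> k" using xb kW by auto
  ultimately consider "btw ?xb h k" | "btw ?xb k h" using btw_total[of ?xb h k] xbW W kW by blast
  then show False
  proof cases
    case 1
    then have h: "right_gap B ?xb h" using right_gap_below[OF goodD(2)[OF B] xb k2] W by blast
    then have "h \<noteq> []" using goodD(4)[OF B] by (auto simp: right_gap_def)
    moreover have "hd h = hd k" using right_gap_hd[OF B xb h k2] .
    ultimately show False using h_hd k' by simp
  next
    case 2
    then have "btw b k' g" using btw_push[OF W(2) xbW _ W(1), of k] kW yk yh yxb by simp
    then have r: "right_gap B b k'" using right_gap_below[OF goodD(2)[OF B] b g] W by blast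
    then have "k' \<noteq> []" using goodD(4)[OF B] by (auto simp: right_gap_def)
    moreover have "hd k' = hd g" using right_gap_hd[OF B b r g] .
    ultimately show False using k'_hd y by simp
  qed
qed

section \<open>Existence of an immediate successor\<close>

lemma btw_mul:
  "\<lbrakk>g \<in> words S; u \<in> words S; v \<in> words S; w \<in> words S\<rbrakk> \<Longrightarrow> btw (mul g u) (mul g v) (mul g w) \<longleftrightarrow> btw u v w"
  by (simp add: invariant)

text \<open>
  Otherwise every point of a finite suffix-closed set \<open>B\<close> would have an outgoing edge inside the tree \<open>B\<close>,
  determined by the gap on its right, and no edge would be used twice: too many edges for a tree.
\<close>

lemma ex_successor:
  assumes "S \<noteq> {}"
  shows "\<exists>t\<in>words S. t \<noteq> [] \<and> (\<forall>g\<in>words S. \<not> btw [] g t)"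
proof (rule ccontr)
  assume no: "\<not> ?thesis"
  obtain s where s: "s \<in> S" using assms by blast
  obtain B where B: "good B" and sB: "[(s, False)] \<in> B"
    using ex_good[of "{[(s, False)]}"] single_words[of "(s, False)" S] s by auto
  have "\<exists>g. right_gap B b g" if b: "b \<in> B" for b
  proof -
    have bW: "b \<in> words S" using b goodD(2)[OF B] by blast
    have "B - {b} \<noteq> {}" using goodD(4)[OF B] sB by (cases "b = []") auto
    then obtain d where d: "d \<in> B" "d \<noteq> b" "\<forall>e\<in>B. \<not> btw b e d"
      using ex_next[OF goodD(1,2)[OF B] bW] by blast
    have dW: "d \<in> words S" using d goodD(2)[OF B] by blast
    have "mul (winv b) d \<in> words S" "mul (winv b) d \<noteq> []"
      using mul_words[OF winv_words[OF bW] dW] mul_eq_Nil_iff[OF bW dW] d by auto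
    then obtain g where g: "g \<in> words S" "btw [] g (mul (winv b) d)" using no by blast
    then have "btw (mul b []) (mul b g) (mul b (mul (winv b) d))"
      using btw_mul[OF bW words_Nil g(1)] mul_words[OF winv_words[OF bW] dW] by blast
    then have bt: "btw b (mul b g) d" using mul_Nil_right[OF bW] mul_winv_cancel'[OF dW] by simp
    have gW: "mul b g \<in> words S" using mul_words bW g by blast
    have "\<not> btw b e (mul b g)" if "e \<in> B" for e
      using btw_trans[OF _ bt, of e] d that bW dW gW goodD(2)[OF B] by blast
    moreover have "mul b g \<notin> B" using d bt by blast
    ultimately show ?thesis using gW by (auto simp: right_gap_def)
  qed
  then obtain G where G: "\<And>b. b \<in> B \<Longrightarrow> right_gap B b (G b)" by metis
  \<comment> \<open>An edge is named by its endpoint farther from \<open>1\<close>, so names range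
    over \<open>B - {[]}\<close>. The edge chosen at \<open>b\<close> leads to its translate by
    \<open>flip (hd (G b))\<close>, which is shorter than \<open>b\<close> exactly in the first
    case.\<close>
  define edge where "edge b = (if b \<noteq> [] \<and> hd b = hd (G b) then b else flip (hd (G b)) # b)" for b
  have push_B: "push (flip (hd (G b))) b \<in> B" if "b \<in> B" for b
    using right_gap_push[OF B that G[OF that]] .
  have edge_B: "edge b \<in> B - {[]}" if "b \<in> B" for b
    using push_B[OF that] that push_noncancel[of b "flip (hd (G b))"] by (auto simp: edge_def)
  have no_return: False if b: "b \<in> B" "b' \<in> B" and e: "edge b = edge b'" and "b \<noteq> []" "hd b = hd (G b)"
    "\<not> (b' \<noteq> [] \<and> hd b' = hd (G b'))" for b b'
  proof -
    have "b = flip (hd (G b')) # b'" using that by (simp add: edge_def)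
    then have "b' = push (flip (hd (G b))) b" "hd (G b') = flip (hd (G b))"
      using that(5) by auto
    then show False using right_gap_no_return[OF B b(1) G[OF b(1)], of "G b'"] G[OF b(2)] by simp
  qed
  have "inj_on edge B"
  proof (rule inj_onI)
    fix b b' assume b: "b \<in> B" "b' \<in> B" and e: "edge b = edge b'"
    show "b = b'"
    proof (cases "b \<noteq> [] \<and> hd b = hd (G b)"; cases "b' \<noteq> [] \<and> hd b' = hd (G b')")
      assume "b \<noteq> [] \<and> hd b = hd (G b)" "b' \<noteq> [] \<and> hd b' = hd (G b')"
      then show ?thesis using e by (simp add: edge_def)
    next
      assume "b \<noteq> [] \<and> hd b = hd (G b)" "\<not> (b' \<noteq> [] \<and> hd b' = hd (G b'))"
      then show ?thesis using no_return[OF b e] by blast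
    next
      assume "\<not> (b \<noteq> [] \<and> hd b = hd (G b))" "b' \<noteq> [] \<and> hd b' = hd (G b')"
      then show ?thesis using no_return[OF b(2,1) e[symmetric]] by blast
    next
      assume "\<not> (b \<noteq> [] \<and> hd b = hd (G b))" "\<not> (b' \<noteq> [] \<and> hd b' = hd (G b'))"
      then show ?thesis using e by (auto simp: edge_def split: if_splits)
    qed
  qed
  moreover have "edge ` B \<subseteq> B - {[]}" by (intro image_subsetI edge_B)
  ultimately have "card B \<le> card (B - {[]})"
    by (rule card_inj_on_le) (simp add: goodD(1)[OF B])
  then show False using card_Diff1_less[OF goodD(1,4)[OF B]] by simp
qed

end

section \<open>Signs of cyclic permutations\<close>

lemma funpow_in: "f permutes A \<Longrightarrow> x \<in> A \<Longrightarrow> (f ^^ n) x \<in> A"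
  by (induction n) (auto simp: permutes_in_image)

text \<open>Composing with the transposition of \<open>a\<close> and \<open>f a\<close> cuts
  \<open>a\<close> out of the cycle and reverses the sign.\<close>

lemma sign_transitive:
  assumes "finite A" "A \<noteq> {}" "f permutes A" "\<And>x y. x \<in> A \<Longrightarrow> y \<in> A \<Longrightarrow> \<exists>n. (f ^^ n) x = y"
  shows "sign f = (-1) ^ (card A - 1)"
  using assms
proof (induction "card A" arbitrary: A f rule: less_induct)
  case less
  obtain a where a: "a \<in> A" using less.prems by blast
  show ?case
  proof (cases "f a = a")
    case True
    then have "(f ^^ n) a = a" for n by (induction n) auto
    then have "x = a" if "x \<in> A" for x using less.prems(4)[OF a that] by metis
    then have "A = {a}" using a by blast
    then have "f = id" using less.prems(3) by simp
    then show ?thesis using \<open>A = {a}\<close> by simp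
  next
    case False
    define g where "g = transpose a (f a) \<circ> f"
    have fa: "f a \<in> A" using less.prems(3) a by (simp add: permutes_in_image)
    have g_perm: "g permutes A"
      unfolding g_def using less.prems(3) permutes_swap_id[OF a fa] permutes_compose by blast
    have ga: "g a = a" by (simp add: g_def)
    have g_perm': "g permutes (A - {a})"
    proof (rule permutes_superset[OF g_perm])
      fix x assume "x \<in> A - (A - {a})"
      then show "g x = x" using ga by auto
    qed
    have g_eq: "g x = f x" if "f x \<noteq> a" "f x \<noteq> f a" for x
      using that by (simp add: g_def transpose_def)
    have g_a: "g x = f a" if "f x = a" for x
      using that by (simp add: g_def)
    have trans: "\<exists>n. (g ^^ n) x = y" if x: "x \<in> A - {a}" and y: "y \<in> A - {a}" for x y
    proof -
      \<comment> \<open>The two orbits agree except when the \<open>f\<close>-orbit visits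
        \<open>a\<close>; the \<open>g\<close>-orbit is then already at \<open>f a\<close>.\<close>
      have "\<exists>j. (f ^^ n) x = (g ^^ j) x \<or> (f ^^ n) x = a \<and> f a = (g ^^ j) x" for n
      proof (induction n)
        case 0
        then show ?case by (intro exI[of _ 0]) simp
      next
        case (Suc n)
        then obtain j where "(f ^^ n) x = (g ^^ j) x \<or> (f ^^ n) x = a \<and> f a = (g ^^ j) x" by blast
        then show ?case
        proof
          assume z: "(f ^^ n) x = (g ^^ j) x"
          have "(g ^^ j) x \<in> A - {a}" using funpow_in[OF g_perm' x] .
          then have "(g ^^ j) x \<noteq> a" by blast
          then have "f ((g ^^ j) x) \<noteq> f a" using permutes_inj[OF less.prems(3)] by (auto dest: injD)
          then have "g ((g ^^ j) x) = (if f ((g ^^ j) x) = a then f a else f ((g ^^ j) x))"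
            using g_eq g_a by simp
          then show ?thesis using z by (intro exI[of _ "Suc j"]) simp
        next
          assume "(f ^^ n) x = a \<and> f a = (g ^^ j) x"
          then show ?thesis by (intro exI[of _ j]) simp
        qed
      qed
      moreover obtain n where "(f ^^ n) x = y" using less.prems(4) x y by blast
      ultimately show ?thesis using y by (metis DiffE insertI1)
    qed
    have card: "card (A - {a}) = card A - 1" "card A > 1"
      using a fa False less.prems(1) card_mono[of A "{a, f a}"] by auto
    have "sign g = (-1) ^ (card (A - {a}) - 1)"
      using trans g_perm' less.prems(1) card fa False
      by (intro less.hyps) auto
    moreover have "sign g = - sign f"
    proof -
      have "permutation f" using less.prems(1,3) permutation_permutes by blast
      then show ?thesis
        using False by (simp add: g_def sign_compose permutation_swap_id sign_swap_id)
    qed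
    moreover have "card A - 1 = Suc (card (A - {a}) - 1)" using card by simp
    ultimately show ?thesis by simp
  qed
qed

lemma sign_transitive_parts:
  assumes "finite I" "\<And>i. i \<in> I \<Longrightarrow> finite (P i) \<and> P i \<noteq> {}"
    and "\<And>i j. \<lbrakk>i \<in> I; j \<in> I; i \<noteq> j\<rbrakk> \<Longrightarrow> P i \<inter> P j = {}"
    and "f permutes (\<Union>i\<in>I. P i)" "\<And>i x. i \<in> I \<Longrightarrow> x \<in> P i \<Longrightarrow> f x \<in> P i"
    and "\<And>i x y. \<lbrakk>i \<in> I; x \<in> P i; y \<in> P i\<rbrakk> \<Longrightarrow> \<exists>n. (f ^^ n) x = y"
  shows "sign f = (\<Prod>i\<in>I. (-1) ^ (card (P i) - 1))"
  using assms
proof (induction I arbitrary: f rule: finite_induct)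
  case empty
  then show ?case by (simp add: sign_id)
next
  case (insert i I)
  define g where "g x = (if x \<in> P i then f x else x)" for x
  define h where "h x = (if x \<in> P i then x else f x)" for x
  have inj: "inj f" using permutes_inj insert.prems(3) by blast
  have gP: "f x \<in> P i \<longleftrightarrow> x \<in> P i" for x
  proof
    assume fx: "f x \<in> P i"
    then have "x \<in> (\<Union>i\<in>insert i I. P i)"
      using permutes_in_image[OF insert.prems(3), of x] by blast
    then obtain j where j: "j \<in> insert i I" "x \<in> P j" by blast
    then have "f x \<in> P j" using insert.prems(4) by blast
    then have "i = j" using insert.prems(2)[of i j] fx j by blast
    then show "x \<in> P i" using j by simp
  qed (use insert.prems(4) in blast)
  have "finite (P i)" using insert.prems(1) by blast
  have "g permutes P i"
  proof (rule bij_imp_permutes)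
    have "inj_on g (P i)" using inj by (auto simp: inj_on_def g_def)
    moreover have "g ` P i \<subseteq> P i" using gP by (auto simp: g_def)
    ultimately show "bij_betw g (P i) (P i)"
      using \<open>finite (P i)\<close> by (simp add: bij_betw_def endo_inj_surj)
  qed (simp add: g_def)
  have "h permutes (\<Union>i\<in>I. P i)"
  proof (rule bij_imp_permutes)
    let ?U = "\<Union>i\<in>I. P i"
    have disj: "x \<notin> P i" if "x \<in> ?U" for x using insert.prems(2) insert.hyps(2) that by blast
    have "inj_on h ?U" using inj disj by (auto simp: inj_on_def h_def)
    moreover have "h ` ?U \<subseteq> ?U" using insert.prems(4) disj by (auto simp: h_def)
    moreover have "finite ?U" using insert.hyps insert.prems(1) by blast
    ultimately show "bij_betw h ?U ?U" by (simp add: bij_betw_def endo_inj_surj)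
    show "h x = x" if "x \<notin> ?U" for x
      using that permutes_not_in[OF insert.prems(3), of x] by (auto simp: h_def)
  qed
  have gh: "f = g \<circ> h" using gP by (auto simp: g_def h_def fun_eq_iff)
  have gn: "(g ^^ n) x = (f ^^ n) x" if "x \<in> P i" for x n
  proof -
    have "(g ^^ n) x = (f ^^ n) x \<and> (f ^^ n) x \<in> P i"
      by (induction n) (use that gP in \<open>auto simp: g_def\<close>)
    then show ?thesis ..
  qed
  have hn: "(h ^^ n) x = (f ^^ n) x" if "x \<in> P j" "j \<in> I" for x n j
  proof -
    have "P i \<inter> P j = {}" using insert.prems(2)[of i j] that insert.hyps(2) by blast
    then have "(h ^^ n) x = (f ^^ n) x \<and> (f ^^ n) x \<in> P j"
      using that insert.prems(4)[of j] by (induction n) (auto simp: h_def)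
    then show ?thesis ..
  qed
  have "sign g = (-1) ^ (card (P i) - 1)"
    using insert.prems(1)[of i] insert.prems(5)[of i] gn \<open>g permutes P i\<close>
    by (intro sign_transitive) auto
  moreover have "sign h = (\<Prod>i\<in>I. (-1) ^ (card (P i) - 1))"
  proof (rule insert.IH)
    show "h x \<in> P j" if "j \<in> I" "x \<in> P j" for j x using that insert.prems(4) by (auto simp: h_def)
    show "\<exists>n. (h ^^ n) x = y" if "j \<in> I" "x \<in> P j" "y \<in> P j" for j x y
      using insert.prems(5)[of j x y] hn[OF that(2,1)] that by auto
  qed (use insert.prems \<open>h permutes (\<Union>i\<in>I. P i)\<close> in auto)
  moreover have "permutation g" "permutation h"
    using \<open>g permutes P i\<close> \<open>h permutes (\<Union>i\<in>I. P i)\<close> \<open>finite (P i)\<close> insert.hyps insert.prems(1)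
    unfolding permutation_permutes by blast+
  moreover have "sign f = sign g * sign h"
    unfolding gh by (rule sign_compose) fact+
  ultimately show ?case using insert.hyps by simp
qed

lemma transitive_permutes:
  assumes "finite A" "f ` A \<subseteq> A" "\<And>x. x \<notin> A \<Longrightarrow> f x = x" "\<And>x y. x \<in> A \<Longrightarrow> y \<in> A \<Longrightarrow> \<exists>n. (f ^^ n) x = y"
  shows "f permutes A"
proof -
  have "A \<subseteq> f ` A"
  proof
    fix y assume y: "y \<in> A"
    then obtain n where n: "(f ^^ n) (f y) = y" using assms(2,4) by blast
    have "(f ^^ n) y \<in> A" using y assms(2) by (induction n) auto
    moreover have "y = f ((f ^^ n) y)" using n by (simp add: funpow_swap1)
    ultimately show "y \<in> f ` A" by blast
  qed
  then have "f ` A = A" using assms(2) by blast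
  then have "bij_betw f A A" using assms(1) by (simp add: bij_betw_def eq_card_imp_inj_on)
  then show ?thesis using assms(3) by (intro bij_imp_permutes) auto
qed

section \<open>Successors within a finite subset\<close>

context cyclic_order
begin

text \<open>The default keeps the iteration inside a one-element set; otherwise the choice is
  forced, by \<open>nxt_eqI\<close>.\<close>

definition nxt :: "'a set \<Rightarrow> 'a \<Rightarrow> 'a"
  where "nxt A a = (if A - {a} = {} then a else SOME d. d \<in> A - {a} \<and> (\<forall>e\<in>A. \<not> btw a e d))"

lemma nxt_properties:
  assumes "finite A" "A \<subseteq> X" "a \<in> A"
  shows "nxt A a \<in> A" "\<And>e. e \<in> A \<Longrightarrow> \<not> btw a e (nxt A a)" "A \<noteq> {a} \<Longrightarrow> nxt A a \<noteq> a"
proof -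
  have *: "nxt A a \<in> A \<and> (\<forall>e\<in>A. \<not> btw a e (nxt A a)) \<and> (A \<noteq> {a} \<longrightarrow> nxt A a \<noteq> a)"
  proof (cases "A - {a} = {}")
    case True
    then have "A = {a}" using assms by blast
    then show ?thesis using True assms btw_distinct[of a a a] by (auto simp: nxt_def)
  next
    case False
    then have "nxt A a \<in> A - {a} \<and> (\<forall>e\<in>A. \<not> btw a e (nxt A a))"
      unfolding nxt_def using ex_next[OF assms(1,2) _ False] assms
      by (simp del: Diff_iff) (rule someI_ex, blast)
    then show ?thesis by blast
  qed
  then show "nxt A a \<in> A" "\<And>e. e \<in> A \<Longrightarrow> \<not> btw a e (nxt A a)" "A \<noteq> {a} \<Longrightarrow> nxt A a \<noteq> a"
    by blast+
qed

lemma nxt_eqI: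
  assumes "finite A" "A \<subseteq> X" "a \<in> A" "d \<in> A" "d \<noteq> a" "\<And>e. e \<in> A \<Longrightarrow> \<not> btw a e d"
  shows "nxt A a = d"
proof (rule ccontr)
  assume ne: "nxt A a \<noteq> d"
  have n: "nxt A a \<in> A" "nxt A a \<noteq> a" "\<not> btw a d (nxt A a)"
    using nxt_properties[OF assms(1-3)] assms(4,5) by auto
  have X: "a \<in> X" "d \<in> X" "nxt A a \<in> X" using n(1) assms(2-4) by auto
  have "btw a (nxt A a) d"
    using btw_total[OF n(2)[symmetric] assms(5)[symmetric] ne X(1,3,2)] n(3) by simp
  then show False using assms(6)[OF n(1)] by simp
qed

lemma nxt_transitive:
  assumes "finite A" "A \<subseteq> X" "a \<in> A" "b \<in> A"
  shows "\<exists>n. (nxt A ^^ n) a = b"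
  using assms(3)
proof (induction "card {e \<in> A. btw a e b}" arbitrary: a rule: less_induct)
  case less
  let ?a = "nxt A a"
  note nxt = nxt_properties[OF assms(1,2) less.prems]
  show ?case
  proof (cases "a = b \<or> ?a = b")
    case True
    then show ?thesis
    proof
      assume "a = b"
      then show ?thesis by (intro exI[of _ 0]) simp
    next
      assume "?a = b"
      then show ?thesis by (intro exI[of _ 1]) simp
    qed
  next
    case False
    then have "A \<noteq> {a}" using assms by auto
    have X: "a \<in> X" "?a \<in> X" "b \<in> X" using nxt less.prems assms by auto
    have bt: "btw a ?a b"
      using btw_total[of a ?a b] nxt(2)[OF assms(4)] nxt(3)[OF \<open>A \<noteq> {a}\<close>] False X by metis
    have "{e \<in> A. btw ?a e b} \<subseteq> {e \<in> A. btw a e b}"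
    proof
      fix e assume e: "e \<in> {e \<in> A. btw ?a e b}"
      then have eX: "e \<in> X" using assms by auto
      have "btw b a ?a" "btw b ?a e"
        using e eX bt X btw_rot[of a ?a b] btw_rot[of ?a b a] btw_rot[of ?a e b] btw_rot[of e b ?a] by auto
      then have "btw b a e" using btw_trans X eX by blast
      then show "e \<in> {e \<in> A. btw a e b}" using e eX X btw_rot by blast
    qed
    moreover have "?a \<in> {e \<in> A. btw a e b}" using bt nxt by blast
    moreover have "?a \<notin> {e \<in> A. btw ?a e b}" using btw_distinct[of ?a ?a b] X by auto
    ultimately have "card {e \<in> A. btw ?a e b} < card {e \<in> A. btw a e b}"
      using assms(1) by (intro psubset_card_mono) auto
    then obtain n where "(nxt A ^^ n) ?a = b" using less.hyps nxt(1) by blast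
    then show ?thesis by (intro exI[of _ "Suc n"]) (simp add: funpow_swap1)
  qed
qed

end

section \<open>The boundary word of an isolated order\<close>

locale isolated_successor = isolated_order S c K
  for S :: "nat set" and c :: "nat letter list \<times> nat letter list \<times> nat letter list \<Rightarrow> int" and K +
  fixes t :: "nat letter list"
  assumes t: "t \<in> words S" "t \<noteq> []" "\<And>g. g \<in> words S \<Longrightarrow> \<not> btw [] g t"
begin

lemma successor:
  assumes "u \<in> words S" "g \<in> words S"
  shows "\<not> btw u g (mul u t)"
proof
  assume "btw u g (mul u t)"
  then have "btw (mul (winv u) u) (mul (winv u) g) (mul (winv u) (mul u t))"
    using btw_mul[OF winv_words[OF assms(1)] assms mul_words[OF assms(1) t(1)]] by blast
  then show False
    using t(3)[OF mul_words[OF winv_words[OF assms(1)] assms(2)]] mul_winv_left[of u] mul_winv_cancel[OF t(1)]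
    by simp
qed

lemma mul_t_neq: "u \<in> words S \<Longrightarrow> mul u t \<noteq> u"
  using mul_eq_iff[OF t(1) words_Nil, of u] mul_Nil_right[of u S] t(2) by auto

lemma mul_t_cancel: "u \<in> words S \<Longrightarrow> mul (mul u t) (winv t) = u"
  using mul_assoc[OF winv_words[OF t(1)], of u t] mul_winv_right[of t] mul_Nil_right[of u S] by simp

lemma mul_winv_t_cancel: "u \<in> words S \<Longrightarrow> mul (mul u (winv t)) t = u"
  using mul_assoc[OF t(1), of u "winv t"] mul_winv_left[of t] mul_Nil_right[of u S] by simp

text \<open>A product that leaves the suffix-closed set is no suffix of \<open>v\<close>, so
  \<open>u\<close> is not cancelled completely.\<close>

lemma mul_right_hd:
  assumes B: "good B" "v \<in> B" and u: "u \<in> B" and "mul u v \<notin> B"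
  shows "dir u = Some (hd (mul u v))"
proof -
  have W: "u \<in> words S" "v \<in> words S" using goodD(2)[OF B(1)] B u by auto
  have "u \<noteq> []" using assms by auto
  moreover have "mul u v \<noteq> drop i v" for i
    using good_tails[OF B] drop_in_tails assms(4) by (metis subsetD)
  ultimately show ?thesis using mul_cases[OF W] by (auto simp: dir_def)
qed

text \<open>Since \<open>b t\<close> is the immediate successor of \<open>b\<close> and
  \<open>d t^-1\<close> the immediate predecessor of \<open>d\<close>, both lie strictly between
  \<open>b\<close> and \<open>d\<close>. They share a gap and hence a first letter. Having left
  \<open>B\<close>, they have kept the first letters of \<open>b\<close> and
  \<open>d\<close>.\<close>

lemma adjacent_dir:
  assumes B: "good B" "t \<in> B" "winv t \<in> B" and b: "b \<in> B" and d: "d \<in> B" "d \<noteq> b"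
    and nx: "\<And>e. e \<in> B \<Longrightarrow> \<not> btw b e d" and "d \<noteq> mul b t"
  shows "dir b = dir d"
proof -
  have W: "b \<in> words S" "d \<in> words S" using b d goodD(2)[OF B(1)] by auto
  let ?a = "mul d (winv t)"
  have W': "mul b t \<in> words S" "?a \<in> words S"
    using mul_words[OF W(1) t(1)] mul_words[OF W(2) winv_words[OF t(1)]] by auto
  have at: "mul ?a t = d" using mul_winv_t_cancel[OF W(2)] .
  have bt: "btw b (mul b t) d"
    using btw_total[of b "mul b t" d] successor[OF W] mul_t_neq[OF W(1)] assms(8) d(2) W W' by metis
  then have btB: "mul b t \<notin> B" using nx by blast
  have "?a \<noteq> b"
  proof
    assume "?a = b"
    then show False using at assms(8) by simp
  qed
  moreover have "?a \<noteq> d" using mul_t_neq[OF W'(2)] at by auto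
  moreover have "\<not> btw ?a b d" using successor[OF W'(2) W(1)] at by simp
  ultimately have "btw ?a d b" using btw_total[of ?a d b] d(2) W W' by blast
  then have ba: "btw b ?a d" using btw_rot W W' by blast
  then have aB: "?a \<notin> B" using nx by blast
  have "\<not> btw b e (mul b t)" "\<not> btw b e ?a" if "e \<in> B" for e
    using nx[OF that] btw_trans[OF _ bt, of e] btw_trans[OF _ ba, of e] W W' that goodD(2)[OF B(1)] by blast+
  then have "right_gap B b (mul b t)" "right_gap B b ?a"
    using btB aB W' by (auto simp: right_gap_def)
  then have "hd (mul b t) = hd ?a" using right_gap_hd[OF B(1) b] by blast
  then show ?thesis
    using mul_right_hd[OF B(1,2) b btB] mul_right_hd[OF B(1,3) d(1) aB] by simp
qed

text \<open>Run from \<open>a\<close> to \<open>b\<close> through consecutive points of a good set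
  containing \<open>t\<close> and its inverse: by \<open>adjacent_dir\<close>, the first letter can
  change only in a step from \<open>g\<close> to \<open>g t\<close>.\<close>

lemma change_between:
  assumes "a \<in> words S" "b \<in> words S" "dir a \<noteq> dir b"
  shows "\<exists>g\<in>words S. (g = a \<or> btw a g b) \<and> dir g \<noteq> dir (mul g t)"
proof -
  have "{a, b, t, winv t} \<subseteq> words S" using assms t winv_words by auto
  then obtain B where B: "good B" "{a, b, t, winv t} \<subseteq> B" using ex_good[of "{a, b, t, winv t}"] by auto
  note fin = goodD(1)[OF B(1)] and BX = goodD(2)[OF B(1)]
  have "\<exists>g\<in>words S. (g = a \<or> btw a g b) \<and> dir g \<noteq> dir (mul g t)" if "a \<in> B" "b \<in> B" "dir a \<noteq> dir b" for a
    using that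
  proof (induction "card {e \<in> B. btw a e b}" arbitrary: a rule: less_induct)
    case less
    then have ab: "a \<noteq> b" by auto
    note nxt = nxt_properties[OF fin BX less.prems(1)]
    let ?a = "nxt B a"
    have X: "a \<in> words S" "b \<in> words S" "?a \<in> words S" using less.prems nxt BX by auto
    have neq: "?a \<noteq> a" using nxt(3) ab less.prems by auto
    show ?case
    proof (cases "dir a = dir ?a")
      case False
      then have "?a = mul a t"
        using adjacent_dir[OF B(1) _ _ less.prems(1) nxt(1) neq nxt(2)] B(2) by blast
      then show ?thesis using False X by auto
    next
      case True
      then have "?a \<noteq> b" using less.prems by auto
      have bt: "btw a ?a b"
        using btw_total[of a ?a b] nxt(2)[OF less.prems(2)] neq ab \<open>?a \<noteq> b\<close> X by metis
      have sub: "btw a e b" if "btw ?a e b" "e \<in> words S" for e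
      proof -
        have "btw b a ?a" "btw b ?a e"
          using btw_rot[of a ?a b] btw_rot[of ?a b a] btw_rot[of ?a e b] btw_rot[of e b ?a] that bt X by auto
        then have "btw b a e" using btw_trans X that(2) by blast
        then show ?thesis using btw_rot X that(2) by blast
      qed
      have "?a \<notin> {e \<in> B. btw ?a e b}" using btw_distinct[of ?a ?a b] X by auto
      moreover have "?a \<in> {e \<in> B. btw a e b}" using bt nxt by blast
      moreover have "{e \<in> B. btw ?a e b} \<subseteq> {e \<in> B. btw a e b}" using sub BX by auto
      ultimately have "card {e \<in> B. btw ?a e b} < card {e \<in> B. btw a e b}"
        using fin by (intro psubset_card_mono) auto
      then obtain g where g: "g \<in> words S" "g = ?a \<or> btw ?a g b" "dir g \<noteq> dir (mul g t)"
        using less.hyps[of ?a] nxt(1) less.prems True by auto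
      then have "btw a g b" using bt sub by blast
      then show ?thesis using g by blast
    qed
  qed
  then show ?thesis using B assms by auto
qed

section \<open>Cuts of the circle and the arcs between them\<close>

abbreviation "m \<equiv> length t"

text \<open>Both \<open>1\<close> and \<open>winv t\<close> are included, so there are
  \<open>m + 1\<close> cuts, and the index of a cut is its length.\<close>

definition cut :: "nat \<Rightarrow> nat letter list"
  where "cut i = winv (take i t)"

lemma cut_words: "cut i \<in> words S"
proof -
  have "take i t @ drop i t \<in> words S" using t by simp
  then show ?thesis unfolding cut_def by (intro winv_words) (blast dest: words_append)
qed

lemma length_cut: "i \<le> m \<Longrightarrow> length (cut i) = i"
  by (simp add: cut_def)

lemma cut_0: "cut 0 = []"
  by (simp add: cut_def)

lemma cut_Suc: "i < m \<Longrightarrow> cut (Suc i) = flip (t ! i) # cut i"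
  by (simp add: cut_def take_Suc_conv_app_nth winv_def)

lemma mul_cut: "mul (cut i) t = drop i t"
proof -
  have "take i t @ drop i t \<in> words S" using t by simp
  then have "mul (take i t) (drop i t) = t" "drop i t \<in> words S"
    using mul_append[of "take i t" "drop i t"] words_append[of "take i t" "drop i t" S] t
    by (auto simp: words_def)
  then show ?thesis using mul_winv_cancel[of "drop i t" S "take i t"] by (simp add: cut_def)
qed

lemma nth_Suc_neq: "Suc i < m \<Longrightarrow> t ! Suc i \<noteq> flip (t ! i)"
  using t(1) by (auto simp: words_def reduced_def successively_conv_nth)

text \<open>A nonempty \<open>g\<close> loses its first letter only by being cancelled completely;
  then \<open>g t\<close> is a suffix of \<open>t\<close>, which determines
  \<open>g\<close>.\<close>

lemma change_cut:
  assumes "g \<in> words S" "dir g \<noteq> dir (mul g t)"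
  shows "\<exists>i\<le>m. g = cut i"
proof (cases "g = []")
  case True
  then show ?thesis using cut_0 by auto
next
  case False
  then obtain i where i: "mul g t = drop i t"
    using mul_cases[OF assms(1) t(1)] assms(2) by (auto simp: dir_def)
  then have "mul g t = mul (cut (min i m)) t" using mul_cut[of "min i m"] by (auto simp: min_def)
  then have "g = cut (min i m)" using mul_t_cancel assms(1) cut_words by metis
  then show ?thesis by (intro exI[of _ "min i m"]) auto
qed

definition cuts :: "nat letter list set"
  where "cuts = cut ` {..m}"

lemma cuts: "finite cuts" "cuts \<subseteq> words S" "i \<le> m \<Longrightarrow> cut i \<in> cuts"
  using cut_words by (auto simp: cuts_def)

lemma cuts_cut_length: "g \<in> cuts \<Longrightarrow> length g \<le> m \<and> g = cut (length g)"
  using length_cut by (auto simp: cuts_def)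

definition succ_cut :: "nat \<Rightarrow> nat"
  where "succ_cut i = (if i \<le> m then length (nxt cuts (cut i)) else i)"

lemma succ_cut:
  assumes "i \<le> m"
  shows "succ_cut i \<le> m" "cut (succ_cut i) = nxt cuts (cut i)"
    "\<And>j. j \<le> m \<Longrightarrow> \<not> btw (cut i) (cut j) (cut (succ_cut i))" "cut (succ_cut i) \<noteq> cut i"
proof -
  note nxt = nxt_properties[OF cuts(1,2) cuts(3)[OF assms]]
  show *: "succ_cut i \<le> m" "cut (succ_cut i) = nxt cuts (cut i)"
    using cuts_cut_length[OF nxt(1)] assms by (auto simp: succ_cut_def)
  show "\<not> btw (cut i) (cut j) (cut (succ_cut i))" if "j \<le> m" for j
    using nxt(2)[OF cuts(3)[OF that]] * by simp
  have "cut 0 \<in> cuts" "cut m \<in> cuts" by (rule cuts(3), simp)+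
  moreover have "cut 0 \<noteq> cut m" using length_cut[of 0] length_cut[of m] t(2) by auto
  ultimately have "cuts \<noteq> {cut i}" by (metis singletonD)
  then show "cut (succ_cut i) \<noteq> cut i" using nxt(3) *(2) by simp
qed

text \<open>A change at \<open>g\<close> takes effect in the step from \<open>g\<close> to
  \<open>g t\<close>. Hence cuts are excluded from the arc that contains \<open>a\<close> but not
  \<open>b\<close>.\<close>

lemma dir_next_cut:
  assumes "a \<in> words S" "b \<in> words S" "a \<in> cuts \<Longrightarrow> a = b" "\<And>i. i \<le> m \<Longrightarrow> \<not> btw a (cut i) b"
  shows "dir a = dir b"
  using change_between[OF assms(1,2)] change_cut assms(3,4) cuts(3) by metis

text \<open>Directly after \<open>cut i\<close> comes \<open>drop i t\<close>, which begins with
  \<open>t ! i\<close>. The letter stays the same up to and including the next cut, and a nonempty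
  cut begins with the inverse of the last letter of its prefix.\<close>

lemma succ_cut_letter:
  assumes "i < m"
  shows "\<exists>q<m. succ_cut i = Suc q \<and> t ! q = flip (t ! i)"
proof -
  have i: "i \<le> m" using assms by simp
  note s = succ_cut[OF i]
  let ?a = "drop i t" and ?b = "cut (succ_cut i)"
  have a: "?a = mul (cut i) t" "?a \<in> words S"
    using mul_cut mul_words[OF cut_words t(1)] by auto
  have aneq: "?a \<noteq> cut i" using a mul_t_neq[OF cut_words] by simp
  have between: "?a = ?b \<or> btw (cut i) ?a ?b"
    using btw_total[of "cut i" ?a ?b] successor[OF cut_words[of i] cut_words[of "succ_cut i"]]
      s(4) aneq a cut_words by metis
  have "dir ?a = dir ?b"
  proof (cases "?a = ?b")
    case False
    then have bt: "btw (cut i) ?a ?b" using between by blast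
    show ?thesis
    proof (rule dir_next_cut[OF a(2) cut_words])
      assume "?a \<in> cuts"
      then have "\<not> btw (cut i) ?a ?b"
        using cuts_cut_length[of ?a] s(3)[of "length ?a"] by metis
      then show "?a = ?b" using bt by blast
    next
      fix j assume j: "j \<le> m"
      show "\<not> btw ?a (cut j) ?b"
      proof
        assume "btw ?a (cut j) ?b"
        then have "btw ?b ?a (cut j)" "btw ?b (cut i) ?a"
          using bt btw_rot cut_words a(2) by meson+
        then have "btw ?b (cut i) (cut j)" using btw_trans cut_words a(2) by blast
        then have "btw (cut i) (cut j) ?b" using btw_rot cut_words by blast
        then show False using s(3)[OF j] by blast
      qed
    qed
  qed simp
  moreover have "dir ?a = Some (t ! i)" using assms by (simp add: dir_def hd_drop_conv_nth)
  ultimately have dir: "dir ?b = Some (t ! i)" by simp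
  then obtain q where q: "succ_cut i = Suc q" using cut_0 by (cases "succ_cut i") auto
  then have "q < m" using s(1) by simp
  then have "dir ?b = Some (flip (t ! q))" using q cut_Suc by simp
  then have "t ! q = flip (t ! i)" using dir by auto
  then show ?thesis using q \<open>q < m\<close> by blast
qed

lemma succ_cut_last: "succ_cut m = 0"
proof -
  have "cut m = winv t" by (simp add: cut_def)
  have "nxt cuts (cut m) = cut 0"
  proof (rule nxt_eqI[OF cuts(1,2)])
    show "cut 0 \<noteq> cut m" using length_cut[of 0] length_cut[of m] t(2) by auto
    show "\<not> btw (cut m) e (cut 0)" if "e \<in> cuts" for e
      using successor[OF cut_words[of m], of e] mul_cut[of m] that cuts(2) cut_0 by auto
  qed (use cuts in auto)
  then show ?thesis by (simp add: succ_cut_def cut_0)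
qed

text \<open>The arc after \<open>cut i\<close> ends at the cut with index
  \<open>Suc (glue i)\<close>. Index \<open>m\<close> is fixed because nothing lies between
  \<open>cut m\<close> and \<open>cut 0\<close>: multiplying \<open>winv t\<close> by
  \<open>t\<close> gives \<open>1\<close>.\<close>

definition glue :: "nat \<Rightarrow> nat"
  where "glue i = (if i < m then succ_cut i - 1 else i)"

lemma glue:
  assumes "i < m"
  shows "glue i < m" "t ! glue i = flip (t ! i)" "succ_cut i = Suc (glue i)"
  using succ_cut_letter[OF assms] assms by (auto simp: glue_def)

definition letter_cuts :: "nat letter \<Rightarrow> nat letter list set"
  where "letter_cuts y = {cut l |l. l < m \<and> t ! l = y}"

lemma push_cut:
  assumes "i < m"
  shows "push (flip (t ! i)) (cut i) = cut (Suc i)" "push (t ! i) (cut (Suc i)) = cut i"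
proof -
  show "push (flip (t ! i)) (cut i) = cut (Suc i)"
    using cut_Suc[OF assms] cut_words[of "Suc i"] push_words_eq by metis
  then show "push (t ! i) (cut (Suc i)) = cut i"
    using push_flip[OF cut_words, of "flip (t ! i)" i] by simp
qed

text \<open>
  Translation by the letter \<open>t ! glue l\<close> maps the complementary arc after \<open>cut (succ_cut l)\<close> to an arc between
  consecutive cuts. Hence two steps of \<open>glue\<close> lead to the next arc with the same letter.
\<close>

lemma glue_glue:
  assumes l: "l < m"
  shows "nxt (letter_cuts (t ! l)) (cut l) = cut (glue (glue l))"
proof -
  define y where "y = t ! l"
  define q where "q = glue l"
  define k where "k = glue q"
  have q: "q < m" "t ! q = flip y" "succ_cut l = Suc q" using glue[OF l] by (auto simp: q_def y_def)
  have k: "k < m" "t ! k = y" "succ_cut q = Suc k" using glue[OF q(1)] q(2) by (auto simp: k_def)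
  let ?A = "letter_cuts y"
  have A: "finite ?A" "?A \<subseteq> words S" using cut_words by (auto simp: letter_cuts_def)
  have cl: "cut l \<in> ?A" "cut k \<in> ?A" using l k by (auto simp: letter_cuts_def y_def)
  have W: "fst (flip y) \<in> S"
  proof -
    have "y \<in> set t" using l by (auto simp: y_def)
    then show ?thesis using t(1) by (auto simp: words_def)
  qed
  \<comment> \<open>After translation by \<open>flip y\<close> the outer points are
    \<open>cut q\<close> and \<open>cut (Suc k)\<close>, which are consecutive cuts, and the middle
    point is again a cut.\<close>
  have second: "\<not> btw (cut (Suc q)) s (cut k)" if s: "s \<in> ?A" for s
  proof
    assume bt: "btw (cut (Suc q)) s (cut k)"
    obtain l' where l': "l' < m" "t ! l' = y" "s = cut l'" using s by (auto simp: letter_cuts_def)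
    have "btw (push (flip y) (cut (Suc q))) (push (flip y) s) (push (flip y) (cut k))"
      using btw_push[OF W cut_words _ cut_words] bt l'(3) cut_words by blast
    then have "btw (cut q) (cut (Suc l')) (cut (Suc k))"
      using push_cut(2)[OF q(1)] push_cut(1)[OF l'(1)] push_cut(1)[OF k(1)] q k l' by simp
    then show False using succ_cut(3)[of q "Suc l'"] q k l' by simp
  qed
  have first: "btw (cut l) (cut (Suc q)) s" if s: "s \<in> ?A" "s \<noteq> cut l" for s
  proof -
    obtain l' where l': "l' < m" "t ! l' = y" "s = cut l'" using s by (auto simp: letter_cuts_def)
    \<comment> \<open>Otherwise \<open>y\<close> would stand at position \<open>Suc q\<close>,
      directly behind its inverse at position \<open>q\<close>.\<close>
    have "s \<noteq> cut (Suc q)"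
    proof
      assume "s = cut (Suc q)"
      then have "length (cut l') = length (cut (Suc q))" using l'(3) by simp
      then have "l' = Suc q" using l'(1) q(1) length_cut[of l'] length_cut[of "Suc q"] by simp
      then show False using nth_Suc_neq[of q] l' q by simp
    qed
    moreover have "cut (Suc q) \<noteq> cut l" "\<not> btw (cut l) s (cut (Suc q))"
      using succ_cut(3,4)[of l] l l' q by auto
    ultimately show ?thesis using btw_total[of "cut l" "cut (Suc q)" s] s cut_words l'(3) by metis
  qed
  have no: "\<not> btw (cut l) s (cut k)" if s: "s \<in> ?A" for s
  proof
    assume bt: "btw (cut l) s (cut k)"
    then have "s \<noteq> cut l" using btw_distinct[OF bt] s A cut_words by blast
    then have "btw (cut (Suc q)) s (cut k)"
      using btw_trans'[OF first[OF s] bt] s A cut_words by blast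
    then show False using second[OF s] by blast
  qed
  have "nxt ?A (cut l) = cut k"
  proof (cases "cut k = cut l")
    case True
    have "s = cut l" if s: "s \<in> ?A" for s
    proof (rule ccontr)
      assume "s \<noteq> cut l"
      then have "btw (cut l) (cut (Suc q)) s" using first s by blast
      then have "btw (cut (Suc q)) s (cut k)" using btw_rot True s A cut_words by (metis subsetD)
      then show False using second[OF s] by blast
    qed
    then have "?A = {cut l}" using cl by blast
    then show ?thesis using True by (simp add: nxt_def)
  next
    case False
    then show ?thesis using nxt_eqI[OF A cl False no] by blast
  qed
  then show ?thesis by (simp add: k_def q_def y_def)
qed

lemma glue_transitive_letter:
  assumes "l < m" "l' < m" "t ! l = t ! l'"
  shows "\<exists>n. (glue ^^ n) l = l'"
proof -
  let ?A = "letter_cuts (t ! l)"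
  have A: "finite ?A" "?A \<subseteq> words S" "cut l \<in> ?A" "cut l' \<in> ?A"
    using cut_words assms by (auto simp: letter_cuts_def)
  obtain n where n: "(nxt ?A ^^ n) (cut l) = cut l'" using nxt_transitive[OF A] by blast
  have "(glue ^^ (2 * n)) l < m \<and> t ! ((glue ^^ (2 * n)) l) = t ! l \<and> cut ((glue ^^ (2 * n)) l) = (nxt ?A ^^ n) (cut l)" for n
  proof (induction n)
    case (Suc n)
    let ?i = "(glue ^^ (2 * n)) l"
    have i: "?i < m" "t ! ?i = t ! l" "cut ?i = (nxt ?A ^^ n) (cut l)" using Suc by auto
    have "(glue ^^ (2 * Suc n)) l = glue (glue ?i)" by simp
    then show ?case
      using glue[OF i(1)] glue[OF glue(1)[OF i(1)]] glue_glue[OF i(1)] i by simp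
  qed (use assms in simp)
  then have "(glue ^^ (2 * n)) l < m" "cut ((glue ^^ (2 * n)) l) = cut l'" using n by auto
  then have "(glue ^^ (2 * n)) l = l'" using length_cut assms by (metis less_imp_le)
  then show ?thesis by blast
qed

definition positions :: "nat \<Rightarrow> nat set"
  where "positions a = {l. l < m \<and> fst (t ! l) = a}"

lemma glue_transitive:
  assumes "l \<in> positions a" "l' \<in> positions a"
  shows "\<exists>n. (glue ^^ n) l = l'"
proof (cases "t ! l = t ! l'")
  case True
  then show ?thesis using glue_transitive_letter assms by (simp add: positions_def)
next
  case False
  have l: "l < m" "l' < m" "fst (t ! l) = fst (t ! l')" using assms by (auto simp: positions_def)
  have "flip (t ! l) = t ! l'" using False l(3) by (auto simp: flip_def prod_eq_iff)
  then obtain n where "(glue ^^ n) (glue l) = l'"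
    using glue_transitive_letter[of "glue l" l'] glue[OF l(1)] l(2) by auto
  then show ?thesis by (intro exI[of _ "Suc n"]) (simp add: funpow_swap1)
qed

end

section \<open>Parity of the number of generators\<close>

context isolated_successor
begin

lemma succ_cut_transitive:
  assumes "i \<le> m" "j \<le> m"
  shows "\<exists>n. (succ_cut ^^ n) i = j"
proof -
  obtain n where n: "(nxt cuts ^^ n) (cut i) = cut j" using nxt_transitive[OF cuts(1,2) cuts(3)[OF assms(1)] cuts(3)[OF assms(2)]] by blast
  have *: "(succ_cut ^^ n) i \<le> m \<and> cut ((succ_cut ^^ n) i) = (nxt cuts ^^ n) (cut i)" for n
    using succ_cut(1,2) assms(1) by (induction n) simp_all
  have "cut ((succ_cut ^^ n) i) = cut j" using *[of n, THEN conjunct2] n by (rule trans)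
  then have "length (cut ((succ_cut ^^ n) i)) = length (cut j)" by (rule arg_cong)
  then have "(succ_cut ^^ n) i = j"
    unfolding length_cut[OF *[of n, THEN conjunct1]] length_cut[OF assms(2)] .
  then show ?thesis by blast
qed

definition pred_cut :: "nat \<Rightarrow> nat"
  where "pred_cut i = (if i = 0 then m else if i \<le> m then i - 1 else i)"

lemma pred_cut_transitive:
  assumes "i \<le> m" "j \<le> m"
  shows "\<exists>n. (pred_cut ^^ n) i = j"
proof -
  have down: "(pred_cut ^^ k) i = i - k" if "k \<le> i" "i \<le> m" for k i
    using that by (induction k) (auto simp: pred_cut_def)
  have "(pred_cut ^^ Suc i) i = m" using down[of i i] assms by (simp add: pred_cut_def)
  then have "(pred_cut ^^ (m - j)) ((pred_cut ^^ Suc i) i) = j"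
    using down[of "m - j" m] assms by simp
  then have "(pred_cut ^^ (m - j + Suc i)) i = j" by (simp only: funpow_add comp_apply)
  then show ?thesis by blast
qed

lemma cut_permutes: "succ_cut permutes {..m}" "pred_cut permutes {..m}"
proof -
  show "succ_cut permutes {..m}"
  proof (rule transitive_permutes)
    show "succ_cut ` {..m} \<subseteq> {..m}" using succ_cut(1) by blast
    show "succ_cut x = x" if "x \<notin> {..m}" for x using that by (simp add: succ_cut_def)
  qed (use succ_cut_transitive in auto)
  show "pred_cut permutes {..m}"
  proof (rule transitive_permutes)
    show "pred_cut ` {..m} \<subseteq> {..m}" by (auto simp: pred_cut_def)
    show "pred_cut x = x" if "x \<notin> {..m}" for x using that by (auto simp: pred_cut_def)
  qed (use pred_cut_transitive in auto)
qed

text \<open>A generator missing from \<open>t\<close> begins no cut, yet its one-letter word has the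
  same first letter as the next cut. The positions of a letter and of its inverse are equinumerous
  because \<open>glue\<close> maps each set injectively into the other.\<close>

lemma card_positions:
  assumes a: "a \<in> S"
  shows "finite (positions a)" "positions a \<noteq> {}" "even (card (positions a))"
proof -
  show fin: "finite (positions a)" by (simp add: positions_def)
  show "positions a \<noteq> {}"
  proof (rule ccontr)
    assume empty: "\<not> positions a \<noteq> {}"
    define x where "x = (a, False)"
    have x: "[x] \<in> words S" using single_words[of "(a, False)" S] a by (simp add: x_def)
    have neq: "flip (t ! q) \<noteq> x" if "q < m" for q
    proof
      assume "flip (t ! q) = x"
      then have "fst (t ! q) = a" using fst_flip[of "t ! q"] by (simp add: x_def)
      then show False using empty that by (auto simp: positions_def)
    qed
    have cut_dir: "dir (cut j) \<noteq> Some x" if "j \<le> m" for j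
      using that neq cut_0 cut_Suc by (cases j) auto
    have notin: "[x] \<notin> cuts" using cut_dir cuts_cut_length[of "[x]"] by (metis dir_simps(2))
    then have "cuts - {[x]} \<noteq> {}" using cuts(3)[of 0] by auto
    then obtain e where e: "e \<in> cuts" "\<And>d. d \<in> cuts \<Longrightarrow> \<not> btw [x] d e"
      using ex_next[OF cuts(1,2) x] by blast
    have "dir [x] = dir e"
      using dir_next_cut[OF x] e cuts notin by blast
    then show False using cut_dir cuts_cut_length[OF e(1)] by (metis dir_simps(2))
  qed
  define L where "L y = {l. l < m \<and> t ! l = y}" for y
  have finL: "finite (L y)" for y by (simp add: L_def)
  have inj: "inj_on glue {..<m}"
  proof (rule inj_onI)
    fix i j assume ij: "i \<in> {..<m}" "j \<in> {..<m}" "glue i = glue j"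
    then have "succ_cut i = succ_cut j" using glue(3) by simp
    then show "i = j" using permutes_inj[OF cut_permutes(1)] by (metis injD)
  qed
  have "card (L y) \<le> card (L (flip y))" for y
  proof (rule card_inj_on_le[OF _ _ finL])
    show "inj_on glue (L y)" by (rule inj_on_subset[OF inj]) (auto simp: L_def)
    show "glue ` L y \<subseteq> L (flip y)" using glue(1,2) by (auto simp: L_def)
  qed
  from this[of "(a, False)"] this[of "(a, True)"]
  have "card (L (a, False)) = card (L (a, True))" by (simp add: flip_def)
  moreover have "positions a = L (a, False) \<union> L (a, True)" "L (a, False) \<inter> L (a, True) = {}"
    by (auto simp: positions_def L_def prod_eq_iff)
  ultimately show "even (card (positions a))" using finL by (simp add: card_Un_disjoint)
qed

lemma even_card_generators:
  assumes "finite S"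
  shows "even (card S)"
proof -
  note perm = cut_permutes
  \<comment> \<open>Both factors are cycles on the same \<open>m + 1\<close> indices; the index
    \<open>m\<close> goes to 0 and back, so the product acts on the \<open>m\<close> positions of
    \<open>t\<close>.\<close>
  have eq: "glue = pred_cut \<circ> succ_cut"
  proof
    fix i
    consider "i < m" | "i = m" | "i > m" by linarith
    then show "glue i = (pred_cut \<circ> succ_cut) i"
    proof cases
      case 1
      then show ?thesis using glue[OF 1] by (simp add: pred_cut_def)
    next
      case 2
      then show ?thesis using succ_cut_last by (simp add: pred_cut_def glue_def)
    next
      case 3
      then show ?thesis by (simp add: pred_cut_def glue_def succ_cut_def)
    qed
  qed
  have "sign succ_cut = (-1) ^ m" "sign pred_cut = (-1) ^ m"
    using sign_transitive[OF _ _ perm(1)] sign_transitive[OF _ _ perm(2)]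
      succ_cut_transitive pred_cut_transitive by auto
  moreover have "permutation succ_cut" "permutation pred_cut"
    using perm permutation_permutes by blast+
  ultimately have "sign glue = 1" by (simp add: eq sign_compose flip: power_mult_distrib)
  have "glue permutes {..m}" unfolding eq using permutes_compose[OF perm] .
  then have glue_perm: "glue permutes {..<m}"
    by (rule permutes_superset) (auto simp: glue_def)
  have union: "(\<Union>a\<in>S. positions a) = {..<m}"
  proof -
    have "fst (t ! l) \<in> S" if "l < m" for l
      using t(1) nth_mem[OF that] by (auto simp: words_def)
    then show ?thesis by (auto simp: positions_def)
  qed
  have "sign glue = (\<Prod>a\<in>S. (-1) ^ (card (positions a) - 1))"
  proof (rule sign_transitive_parts[OF assms])
    show "finite (positions a) \<and> positions a \<noteq> {}" if "a \<in> S" for a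
      using card_positions that by blast
    show "glue permutes (\<Union>a\<in>S. positions a)" using glue_perm union by simp
    show "glue x \<in> positions a" if "x \<in> positions a" for a x
      using that glue[of x] by (auto simp: positions_def)
    show "\<exists>n. (glue ^^ n) x = y" if "x \<in> positions a" "y \<in> positions a" for a x y
      using glue_transitive that by blast
  qed (auto simp: positions_def)
  also have "\<dots> = (\<Prod>a\<in>S. -1)"
  proof (rule prod.cong)
    fix a assume "a \<in> S"
    then have "card (positions a) \<noteq> 0" "even (card (positions a))" using card_positions by auto
    then have "odd (card (positions a) - 1)" by simp
    then show "(-1) ^ (card (positions a) - 1) = (-1 :: int)" by simp
  qed simp
  also have "\<dots> = (-1) ^ card S" by simp
  finally show ?thesis using \<open>sign glue = 1\<close> by (metis neg_one_odd_power one_neq_neg_one)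
qed

end

section \<open>An isolated order for an even number of generators\<close>

text \<open>The base points \<open>[]\<close> and \<open>[x]\<close> are neighbours. Exchanging them
  changes the value by a difference of two terms that depend only on the common direction of
  \<open>h\<close> and \<open>k\<close>.\<close>

lemma tree_order_same_dir:
  assumes "h \<in> words S" "k \<in> words S" "dir h = dir k" "dir h \<noteq> Some x" "fst x \<in> S"
  shows "tree_order ([x], h, k) = tree_order ([], h, k)"
proof -
  interpret cyclic_order "words S" tree_order by (rule tree_order_cyclic_order)
  have x: "[x] \<in> words S" using assms(5) by (rule single_words)
  have "tree_order ([], [x], k) = tree_order ([], [x], h)"
    using assms x tree_order_diverge[of "[]" S "[x]" k] tree_order_diverge[of "[]" S "[x]" h]
    by (simp add: diverge_def)
  then show ?thesis using cocycle[of "[]" "[x]" h k] x assms by simp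
qed

text \<open>
  For \<open>\<sigma> = 1\<close> (\<open>\<sigma> = -1\<close>) the last (first) word starting with \<open>x\<close> continues with the last (first) direction
  seen from the vertex \<open>x\<close> when turning around it from \<open>flip x\<close>; \<open>f\<close> witnesses that this path ends.
\<close>

lemma ex_extreme:
  fixes f :: "nat letter \<Rightarrow> nat"
  assumes nb: "\<And>x y. fst x \<in> S \<Longrightarrow> nb x = Some y \<Longrightarrow> fst y \<in> S \<and> y \<noteq> flip x \<and> f y < f x"
    and side: "\<And>x z. \<lbrakk>fst x \<in> S; \<forall>y. z = Some y \<longrightarrow> fst y \<in> S; z \<noteq> Some (flip x); z \<noteq> nb x\<rbrakk> \<Longrightarrow>
      side (Some (flip x)) z + side z (nb x) + side (nb x) (Some (flip x)) = \<sigma>"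
    and x: "fst x \<in> S"
  shows "\<exists>r\<in>words S. dir r = Some x \<and> (\<forall>g\<in>words S. dir g = Some x \<longrightarrow> g \<noteq> r \<longrightarrow> tree_order ([], g, r) = \<sigma>)"
  using x
proof (induction "f x" arbitrary: x rule: less_induct)
  case less
  have fx: "[flip x] \<in> words S" using less.prems single_words[of "flip x" S] by simp
  have "\<exists>r'\<in>words S. dir r' = nb x \<and> (\<forall>h\<in>words S. dir h = nb x \<longrightarrow> h \<noteq> r' \<longrightarrow> tree_order ([], h, r') = \<sigma>)"
  proof (cases "nb x")
    case None
    then show ?thesis by (intro bexI[of _ "[]"]) (auto simp: dir_def)
  next
    case (Some y)
    then show ?thesis using less.hyps[of y] nb[OF less.prems] by simp
  qed
  then obtain r' where r': "r' \<in> words S" "dir r' = nb x"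
    "\<And>h. \<lbrakk>h \<in> words S; dir h = nb x; h \<noteq> r'\<rbrakk> \<Longrightarrow> tree_order ([], h, r') = \<sigma>" by blast
  have nb_x: "nb x \<noteq> Some (flip x)" using nb[OF less.prems] by blast
  have r: "x # r' \<in> words S"
    using r'(1,2) nb_x less.prems by (auto simp: words_Cons dir_def)
  show ?case
  proof (intro bexI[OF _ r] conjI ballI impI)
    fix g assume g: "g \<in> words S" "dir g = Some x" "g \<noteq> x # r'"
    obtain h where h: "g = x # h" using g by (cases g) auto
    have hW: "h \<in> words S" "dir h \<noteq> Some (flip x)" using g h by (auto simp: words_Cons dir_def)
    \<comment> \<open>Translation by \<open>x^-1\<close> moves the vertex \<open>x\<close> to
      \<open>1\<close>, from where the old base point is seen in the direction
      \<open>flip x\<close>.\<close>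
    have "tree_order ([], g, x # r') = tree_order (mul [flip x] [], mul [flip x] g, mul [flip x] (x # r'))"
      using tree_order_invariant[OF fx words_Nil g(1) r] by simp
    also have "\<dots> = tree_order ([flip x], h, r')" by (simp add: h)
    also have "\<dots> = \<sigma>"
    proof (cases "dir h = nb x")
      case True
      then have "tree_order ([flip x], h, r') = tree_order ([], h, r')"
        using tree_order_same_dir[OF hW(1) r'(1) _ hW(2)] r'(2) less.prems by simp
      then show ?thesis using r'(3)[OF hW(1) True] g(3) h by simp
    next
      case False
      have "\<forall>y. dir h = Some y \<longrightarrow> fst y \<in> S" using hW(1) by (cases h) (auto simp: words_Cons)
      then have "side (Some (flip x)) (dir h) + side (dir h) (nb x) + side (nb x) (Some (flip x)) = \<sigma>"
        using side[OF less.prems] hW(2) False by blast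
      then show ?thesis
        using tree_order_diverge[OF fx hW(1) r'(1)] hW(2) False r'(2) nb_x by (auto simp: diverge_def)
    qed
    finally show "tree_order ([], g, x # r') = \<sigma>" .
  qed simp
qed

section \<open>Neighbouring directions and extreme words\<close>

lemma side_pred:
  assumes "rank q = rank p - 1" "z \<noteq> p" "z \<noteq> q"
  shows "side p z + side z q + side q p = 1"
proof -
  have "rank z \<noteq> rank p" "rank z \<noteq> rank q" using assms rank_inj by blast+
  then show ?thesis using assms(1) by (auto simp: side_def sgn_if)
qed

lemma side_succ:
  assumes "rank q = rank p + 1" "z \<noteq> p" "z \<noteq> q"
  shows "side p z + side z q + side q p = -1"
proof -
  have "rank z \<noteq> rank p" "rank z \<noteq> rank q" using assms rank_inj by blast+
  then show ?thesis using assms(1) by (auto simp: side_def sgn_if)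
qed

lemma rank_nonneg: "0 \<le> rank p"
  by (cases p rule: rank.cases) auto

lemma rank_le: "even n \<Longrightarrow> k < n \<Longrightarrow> rank (Some (k, s)) \<le> 2 * int n"
  by auto presburger+

text \<open>The direction one place before \<open>flip x\<close>. Every letter has positive rank, so
  no wrap-around occurs.\<close>

fun prev_dir :: "nat letter \<Rightarrow> nat letter option" where
  "prev_dir (k, s) = (if even k then (if s then (if k = 0 then None else Some (k - 1, False)) else Some (k + 1, True))
     else Some (k - 1, s))"

lemma rank_prev_dir: "rank (prev_dir x) = rank (Some (flip x)) - 1"
  by (cases x) (auto simp: flip_def of_nat_diff elim!: oddE)

text \<open>The direction one place after \<open>flip x\<close>, where the top rank is followed by
  \<open>None\<close>.\<close>

fun next_dir :: "nat \<Rightarrow> nat letter \<Rightarrow> nat letter option" where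
  "next_dir n (k, s) = (if even k then Some (k + 1, s)
     else if s then (if k + 1 < n then Some (k + 1, False) else None) else Some (k - 1, True))"

lemma rank_next_dir: "next_dir n x \<noteq> None \<Longrightarrow> rank (next_dir n x) = rank (Some (flip x)) + 1"
  by (cases x) (auto simp: flip_def of_nat_diff elim!: oddE split: if_splits)

lemma ex_last:
  assumes "even n" "fst x < n"
  shows "\<exists>r\<in>words {..<n}. dir r = Some x \<and>
    (\<forall>g\<in>words {..<n}. dir g = Some x \<longrightarrow> g \<noteq> r \<longrightarrow> tree_order ([], g, r) = 1)"
\<comment> \<open>Each step of \<open>prev_dir\<close> lowers \<open>f\<close> by exactly one:
  \<open>a\<close>, \<open>b^-1\<close>, \<open>a^-1\<close> are followed by \<open>b\<close> and
  \<open>a\<close> of the preceding pair. This single path through all letters is the boundary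
  component.\<close>
proof (rule ex_extreme[where nb = prev_dir
      and f = "\<lambda>(k, s). if even k then (if s then 2 * k else 2 * k + 2) else (if s then 2 * k - 1 else 2 * k + 1)"])
  fix x y assume "fst x \<in> {..<n}" "prev_dir x = Some y"
  then show "fst y \<in> {..<n} \<and> y \<noteq> flip x \<and>
    (case y of (k, s) \<Rightarrow> if even k then (if s then 2 * k else 2 * k + 2) else (if s then 2 * k - 1 else 2 * k + 1))
    < (case x of (k, s) \<Rightarrow> if even k then (if s then 2 * k else 2 * k + 2) else (if s then 2 * k - 1 else 2 * k + 1))"
    using assms(1) by (cases x; cases y) (auto simp: flip_def split: if_splits elim!: evenE oddE)
qed (use assms side_pred[OF rank_prev_dir] in auto)

lemma ex_first:
  assumes "even n" "fst x < n"
  shows "\<exists>r\<in>words {..<n}. dir r = Some x \<and>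
    (\<forall>g\<in>words {..<n}. dir g = Some x \<longrightarrow> g \<noteq> r \<longrightarrow> tree_order ([], g, r) = -1)"
\<comment> \<open>The subtracted number grows by one in each step of \<open>next_dir\<close> and
  stays below \<open>2 * n\<close>, so the subtraction is never truncated.\<close>
proof (rule ex_extreme[where nb = "next_dir n"
      and f = "\<lambda>(k, s). 2 * n + 2 - (if even k then (if s then 2 * k + 2 else 2 * k) else (if s then 2 * k + 1 else 2 * k - 1))"])
  fix x y assume "fst x \<in> {..<n}" "next_dir n x = Some y"
  then show "fst y \<in> {..<n} \<and> y \<noteq> flip x \<and>
    (case y of (k, s) \<Rightarrow> 2 * n + 2 - (if even k then (if s then 2 * k + 2 else 2 * k) else (if s then 2 * k + 1 else 2 * k - 1)))
    < (case x of (k, s) \<Rightarrow> 2 * n + 2 - (if even k then (if s then 2 * k + 2 else 2 * k) else (if s then 2 * k + 1 else 2 * k - 1)))"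
    using assms(1) by (cases x; cases y) (auto simp: flip_def split: if_splits elim!: evenE oddE)
next
  fix x z assume x: "fst x \<in> {..<n}" and z: "\<forall>y. z = Some y \<longrightarrow> fst y \<in> {..<n}" "z \<noteq> Some (flip x)" "z \<noteq> next_dir n x"
  show "side (Some (flip x)) z + side z (next_dir n x) + side (next_dir n x) (Some (flip x)) = -1"
  proof (cases "next_dir n x")
    case None
    obtain k s where k: "x = (k, s)" by (cases x)
    \<comment> \<open>The path ends where \<open>flip x\<close> has the top rank; the next direction
      in the cyclic order is \<open>None\<close>, of rank 0.\<close>
    have "rank (Some (flip x)) = 2 * int n"
      using None x k assms(1) by (auto simp: flip_def split: if_splits)
    moreover obtain y where y: "z = Some y" "fst y < n" using z None by (cases z) auto
    moreover have "rank z \<noteq> rank (Some (flip x))" using z(2) rank_inj by blast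
    moreover have "rank z \<le> 2 * int n" using rank_le[OF assms(1), of "fst y" "snd y"] y by simp
    moreover have "0 < rank z" using rank_nonneg[of z] rank_inj[of z None] y by fastforce
    ultimately show ?thesis using None by (simp add: side_def sgn_if)
  next
    case (Some y)
    then show ?thesis using side_succ[OF rank_next_dir, of n x z] z by simp
  qed
qed (use assms in auto)

lemma tree_order_circular: "restrict tree_order (words S \<times> words S \<times> words S) \<in> circular_orders (free_group S)"
proof -
  interpret T: cyclic_order "words S" tree_order by (rule tree_order_cyclic_order)
  have "cyclic_order (words S) (restrict tree_order (words S \<times> words S \<times> words S))"
    using T.val T.cocycle T.zero_iff by unfold_locales simp_all
  then show ?thesis
    using tree_order_invariant by (auto simp: circular_orders_iff mul_words)
qed

text \<open>\<open>K\<close> records the endpoints \<open>L x\<close> and \<open>R x\<close> of the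
  interval of each letter and the inclusion of the translated interval of \<open>y\<close> in that
  of \<open>x\<close> for \<open>y \<noteq> flip x\<close>. The one-letter words start the induction
  that confines every word to the interval of its first letter.\<close>

lemma tree_order_determined:
  assumes n: "even n"
  shows "\<exists>K. finite K \<and> K \<subseteq> words {..<n} \<and> (\<forall>c\<in>circular_orders (free_group {..<n}).
    (\<forall>u\<in>K. \<forall>v\<in>K. \<forall>w\<in>K. c (u, v, w) = tree_order (u, v, w)) \<longrightarrow>
    (\<forall>u\<in>words {..<n}. \<forall>v\<in>words {..<n}. \<forall>w\<in>words {..<n}. c (u, v, w) = tree_order (u, v, w)))"
proof -
  let ?S = "{..<n}"
  define X where "X = {..<n} \<times> (UNIV :: bool set)"
  have memX: "x \<in> X \<longleftrightarrow> fst x < n" for x by (auto simp: X_def mem_Times_iff)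
  let ?W = "words {..<n}"
  interpret T: cyclic_order ?W tree_order by (rule tree_order_cyclic_order)
  obtain R where R: "\<And>x. x \<in> X \<Longrightarrow> R x \<in> ?W" "\<And>x. x \<in> X \<Longrightarrow> dir (R x) = Some x"
    "\<And>x g. \<lbrakk>x \<in> X; g \<in> ?W; dir g = Some x; g \<noteq> R x\<rbrakk> \<Longrightarrow> tree_order ([], g, R x) = 1"
    using ex_last[OF n] by (metis memX)
  obtain L where L: "\<And>x. x \<in> X \<Longrightarrow> L x \<in> ?W" "\<And>x. x \<in> X \<Longrightarrow> dir (L x) = Some x"
    "\<And>x g. \<lbrakk>x \<in> X; g \<in> ?W; dir g = Some x; g \<noteq> L x\<rbrakk> \<Longrightarrow> tree_order ([], g, L x) = -1"
    using ex_first[OF n] by (metis memX)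
  define K where "K = insert [] (\<Union>x\<in>X. {[x], R x, L x} \<union> (\<Union>y\<in>X. {push x (R y), push x (L y)}))"
  have XS: "fst x \<in> ?S" if "x \<in> X" for x using that by (simp add: memX)
  have K: "finite K" "K \<subseteq> ?W"
  proof -
    show "finite K" by (simp add: K_def X_def)
    show "K \<subseteq> ?W"
      using R(1) L(1) single_words[OF XS] push_words[OF XS] words_Nil unfolding K_def by blast
  qed
  have in_K: "[] \<in> K" "\<And>x. x \<in> X \<Longrightarrow> [x] \<in> K" "\<And>x. x \<in> X \<Longrightarrow> R x \<in> K" "\<And>x. x \<in> X \<Longrightarrow> L x \<in> K"
    "\<And>x y. \<lbrakk>x \<in> X; y \<in> X\<rbrakk> \<Longrightarrow> push x (R y) \<in> K" "\<And>x y. \<lbrakk>x \<in> X; y \<in> X\<rbrakk> \<Longrightarrow> push x (L y) \<in> K"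
    by (auto simp: K_def)
  have "c (u, v, w) = tree_order (u, v, w)"
    if c: "c \<in> circular_orders (free_group ?S)" and agree: "\<forall>u\<in>K. \<forall>v\<in>K. \<forall>w\<in>K. c (u, v, w) = tree_order (u, v, w)"
      and uvw: "u \<in> ?W" "v \<in> ?W" "w \<in> ?W" for c u v w
  proof -
    interpret C: cyclic_order ?W c using c by (simp add: circular_orders_iff)
    have inv: "c (push x u, push x v, push x w) = c (u, v, w)"
      if "x \<in> X" "u \<in> ?W" "v \<in> ?W" "w \<in> ?W" for x u v w
    proof -
      have "c (mul [x] u, mul [x] v, mul [x] w) = c (u, v, w)"
        using c that single_words[OF XS[OF that(1)]] unfolding circular_orders_iff by blast
      then show ?thesis by simp
    qed
    \<comment> \<open>The linear order obtained by cutting \<open>c\<close> at \<open>1\<close>,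
      with \<open>1\<close> as least element.\<close>
    define le where "le u v \<longleftrightarrow> u = v \<or> C.btw [] u v" for u v
    have le_trans: "le u w" if "le u v" "le v w" "u \<in> ?W" "v \<in> ?W" "w \<in> ?W" for u v w
      using that C.btw_trans[of "[]" u v w] by (auto simp: le_def)
    have le_K: "le u v" if "u \<in> K" "v \<in> K" "u = v \<or> tree_order ([], u, v) = 1" for u v
      using that agree in_K(1) by (auto simp: le_def)
    have le_R: "le g (R x)" if "g \<in> K" "x \<in> X" "dir g = Some x" for g x
      using le_K[OF that(1) in_K(3)[OF that(2)]] R(3)[OF that(2) _ that(3)] K that(1) by blast
    have le_L: "le (L x) g" if "g \<in> K" "x \<in> X" "dir g = Some x" for g x
    proof -
      have gW: "g \<in> ?W" using that K by blast
      show ?thesis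
        using le_K[OF in_K(4)[OF that(2)] that(1)] L(3)[OF that(2) gW that(3)]
          T.swap23[OF words_Nil gW L(1)[OF that(2)]] by auto
    qed
    have between: "le (L x) g \<and> le g (R x)" if "g \<in> ?W" "dir g = Some x" for g x
      using that
    proof (induction g arbitrary: x)
      case (Cons z h)
      then have z: "z = x" by simp
      have hW: "h \<in> ?W" "x \<in> X" using Cons.prems z by (auto simp: words_Cons memX)
      show ?case
      proof (cases "h = []")
        case True
        then show ?thesis using le_R[of "[x]" x] le_L[of "[x]" x] in_K(2) hW z by simp
      next
        case False
        define y where "y = hd h"
        have hy: "dir h = Some y" using False by (simp add: dir_def y_def)
        have y: "y \<in> X" "y \<noteq> flip x"
          using Cons.prems(1) False z by (cases h; auto simp: words_Cons y_def memX)+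
        let ?b = "push x (L y)" and ?d = "push x (R y)"
        have bd: "?b \<in> ?W" "?d \<in> ?W" "x # h \<in> ?W"
          using in_K(5,6)[OF hW(2) y(1)] K Cons.prems z by auto
        have xh: "push x h = x # h" using push_words_eq bd(3) by blast
        have dir_bd: "dir ?b = Some x" "dir ?d = Some x"
          using L(2)[OF y(1)] R(2)[OF y(1)] y(2) push_noncancel[of "L y" x] push_noncancel[of "R y" x]
          by (auto simp: dir_def split: if_splits)
        have Lb: "le (L x) ?b" and dR: "le ?d (R x)"
          using le_L[OF in_K(6)[OF hW(2) y(1)] hW(2) dir_bd(1)] le_R[OF in_K(5)[OF hW(2) y(1)] hW(2) dir_bd(2)] .
        have "?b = ?d \<or> tree_order ([], ?b, ?d) = 1"
        proof (cases "L y = R y")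
          case False
          have fx: "[flip x] \<in> ?W" using single_words[of "flip x" ?S] XS[OF hW(2)] by simp
          have "tree_order ([], L y, R y) = 1" using R(3)[OF y(1) L(1)[OF y(1)] L(2)[OF y(1)] False] .
          moreover have "tree_order ([flip x], L y, R y) = tree_order ([], L y, R y)"
            using L(1,2)[OF y(1)] R(1,2)[OF y(1)] y(2) XS[OF hW(2)] by (intro tree_order_same_dir[of _ ?S]) auto
          moreover have "tree_order (mul [x] [flip x], mul [x] (L y), mul [x] (R y)) = tree_order ([flip x], L y, R y)"
            using single_words[OF XS[OF hW(2)]] fx L(1)[OF y(1)] R(1)[OF y(1)] by (intro tree_order_invariant)
          ultimately show ?thesis by simp
        qed simp
        then have bd_le: "le ?b ?d" using le_K in_K(5,6)[OF hW(2) y(1)] by blast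
        have IH: "le (L y) h" "le h (R y)" using Cons.IH[OF hW(1) hy] by auto
        have "le ?b (x # h) \<and> le (x # h) ?d"
        proof (cases "h = L y \<or> h = R y")
          case True
          then show ?thesis using bd_le xh by (auto simp: le_def)
        next
          case False
          then have "C.btw [] (L y) h" "C.btw [] h (R y)" using IH by (auto simp: le_def)
          then have "C.btw (L y) h (R y)"
            using C.btw_trans'[of "[]" "L y" h "R y"] hW L(1)[OF y(1)] R(1)[OF y(1)] by simp
          then have bt: "C.btw ?b (x # h) ?d" using inv[OF hW(2) L(1)[OF y(1)] hW(1) R(1)[OF y(1)]] xh by simp
          then have "?b \<noteq> ?d" using C.btw_distinct bd by blast
          \<comment> \<open>As \<open>1\<close> lies on the arc from \<open>?d\<close> back to
            \<open>?b\<close>, cutting there leaves \<open>?b\<close>, \<open>x # h\<close>,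
            \<open>?d\<close> in this order.\<close>
          then have "C.btw [] ?b ?d" using bd_le by (auto simp: le_def)
          then have "C.btw ?d [] ?b" using C.btw_rot bd words_Nil by blast
          moreover have "C.btw ?d ?b (x # h)" using bt C.btw_rot bd by blast
          ultimately have "C.btw ?d [] (x # h)" "C.btw [] ?b (x # h)"
            using C.btw_trans C.btw_trans' bd words_Nil by blast+
          moreover from this(1) have "C.btw [] (x # h) ?d" using C.btw_rot bd words_Nil by blast
          ultimately show ?thesis by (simp add: le_def)
        qed
        then show ?thesis
          using le_trans[OF Lb, of "x # h"] le_trans[OF _ dR, of "x # h"] bd L(1)[OF hW(2)] R(1)[OF hW(2)] z by blast
      qed
    qed simp
    have base_less: "C.btw [] u v"
      if "u \<in> ?W" "v \<in> ?W" "dir u = Some x" "dir v = Some y" "x \<noteq> y" "T.btw [] (R x) (L y)" for u v x y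
    proof -
      have xy: "x \<in> X" "y \<in> X" using that(1-4) by (cases u; cases v; auto simp: words_Cons memX)+
      have "le (R x) (L y)" using le_K[OF in_K(3)[OF xy(1)] in_K(4)[OF xy(2)]] that(6) by blast
      moreover have "le u (R x)" "le (L y) v" using between that by blast+
      ultimately have "le u v"
        using le_trans that(1,2) R(1)[OF xy(1)] L(1)[OF xy(2)] by metis
      moreover have "u \<noteq> v" using that by auto
      ultimately show ?thesis by (simp add: le_def)
    qed
    have base: "c ([], u, v) = tree_order ([], u, v)" if uv: "u \<in> ?W" "v \<in> ?W" "diverge u v" for u v
    proof (cases "u = [] \<or> v = []")
      case True
      then show ?thesis using C.zero_iff T.zero_iff uv words_Nil by metis
    next
      case False
      then obtain x y where xy: "dir u = Some x" "dir v = Some y" "x \<noteq> y"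
        using uv by (auto simp: dir_def diverge_def)
      have X: "x \<in> X" "y \<in> X" using uv xy by (cases u; cases v; auto simp: words_Cons memX)+
      have tree: "tree_order ([], g, h) = side None (Some x) + side (Some x) (Some y) + side (Some y) None"
        if "g \<in> ?W" "h \<in> ?W" "dir g = Some x" "dir h = Some y" "x \<noteq> y" for g h x y
        using tree_order_diverge[OF words_Nil that(1,2)] that by (simp add: diverge_def)
      have eq: "tree_order ([], R x, L y) = tree_order ([], u, v)" "tree_order ([], R y, L x) = tree_order ([], v, u)"
        using tree R L X uv xy by metis+
      have "u \<noteq> v" using xy by auto
      then consider "T.btw [] u v" | "T.btw [] v u"
        using T.btw_total[of "[]" u v] uv(1,2) False by auto
      then show ?thesis
      proof cases
        case 1
        then show ?thesis using base_less[OF uv(1,2) xy] eq by simp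
      next
        case 2
        then have "C.btw [] v u" using base_less[OF uv(2,1) xy(2,1)] xy eq by simp
        then show ?thesis using 2 C.swap23[of "[]" v u] T.swap23[of "[]" v u] uv by simp
      qed
    qed
    show ?thesis
      using uvw
    proof (induction u v w rule: words_triple_induct)
      case (rotate u v w)
      then show ?case using C.rot[of u v w] T.rot[of u v w] by simp
    next
      case (diverge u v w)
      have "c ([], u, w) = tree_order ([], u, w)"
        using diverge by (intro base) (auto simp: diverge_def)
      then show ?case
        using C.cocycle[of "[]" u v w] T.cocycle[of "[]" u v w] base[of u v] base[of v w] diverge by simp
    next
      case (strip x u v w)
      have "x \<in> X" using strip(1) by (simp add: memX)
      then show ?case
        using inv[of x u v w] tree_order_invariant[OF single_words, of x ?S u v w] strip by simp
    qed
  qed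
  then show ?thesis
    by (intro exI[of _ K] conjI ballI impI K)
qed

section \<open>Isolated points\<close>

text \<open>A basic open set of the product constrains finitely many triples; \<open>K\<close>
  collects their components. Conversely, prescribing the values on the finitely many triples from
  \<open>K\<close> is an open condition.\<close>

lemma isolated_point_iff:
  fixes G :: "('a, 'b) monoid_scheme"
  shows "isolated_point (CO G) c \<longleftrightarrow> c \<in> circular_orders G \<and>
    (\<exists>K. finite K \<and> K \<subseteq> carrier G \<and> (\<forall>c'\<in>circular_orders G.
      (\<forall>u\<in>K. \<forall>v\<in>K. \<forall>w\<in>K. c' (u, v, w) = c (u, v, w)) \<longrightarrow> c' = c))"
    (is "_ \<longleftrightarrow> c \<in> ?C \<and> ?P")
proof -
  let ?I = "carrier G \<times> carrier G \<times> carrier G"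
  let ?D = "{0, 1, -1} :: int set"
  let ?T = "product_topology (\<lambda>_. discrete_topology ?D) ?I"
  have C_sub: "?C \<subseteq> ?I \<rightarrow>\<^sub>E ?D" by (auto simp: circular_orders_def)
  have "openin (CO G) {c} \<longleftrightarrow> ?P" if c: "c \<in> ?C"
  proof
    assume "openin (CO G) {c}"
    then obtain U where U: "openin ?T U" "{c} = U \<inter> ?C"
      by (auto simp: CO_def openin_subtopology)
    then have "c \<in> U" by blast
    then obtain V where V: "finite {i \<in> ?I. V i \<noteq> topspace (discrete_topology ?D)}" "c \<in> Pi\<^sub>E ?I V" "Pi\<^sub>E ?I V \<subseteq> U"
      using U(1)[unfolded openin_product_topology_alt, THEN bspec, OF \<open>c \<in> U\<close>] by (elim exE conjE)
    define J where "J = {i \<in> ?I. V i \<noteq> topspace (discrete_topology ?D)}"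
    define K where "K = fst ` J \<union> (fst \<circ> snd) ` J \<union> (snd \<circ> snd) ` J"
    have "finite K" "K \<subseteq> carrier G" using V(1) by (auto simp: K_def J_def)
    moreover have "c' = c" if c': "c' \<in> ?C" "\<forall>u\<in>K. \<forall>v\<in>K. \<forall>w\<in>K. c' (u, v, w) = c (u, v, w)" for c'
    proof -
      have "c' \<in> Pi\<^sub>E ?I V"
      proof (rule PiE_I)
        fix i assume i: "i \<in> ?I"
        show "c' i \<in> V i"
        proof (cases "i \<in> J")
          case True
          then have "fst i \<in> K" "fst (snd i) \<in> K" "snd (snd i) \<in> K" by (auto simp: K_def)
          then have "c' (fst i, fst (snd i), snd (snd i)) = c (fst i, fst (snd i), snd (snd i))" using c' by blast
          then show ?thesis using V(2) i by auto
        next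
          case False
          then have "V i = ?D" using i by (simp add: J_def)
          then show ?thesis using c'(1) C_sub i by (auto simp: PiE_iff)
        qed
      next
        fix i assume "i \<notin> ?I"
        then show "c' i = undefined" using c'(1) C_sub by (auto simp: PiE_iff extensional_def)
      qed
      then show ?thesis using V(3) U(2) c'(1) by blast
    qed
    ultimately show ?P by (intro exI[of _ K] conjI ballI impI)
  next
    assume ?P
    then obtain K where K: "finite K" "K \<subseteq> carrier G"
      "\<forall>c'\<in>?C. (\<forall>u\<in>K. \<forall>v\<in>K. \<forall>w\<in>K. c' (u, v, w) = c (u, v, w)) \<longrightarrow> c' = c" by (elim exE conjE)
    define V where "V i = (if i \<in> K \<times> K \<times> K then {c i} else ?D)" for i
    have "finite {i \<in> ?I. V i \<noteq> ?D}"
      by (rule finite_subset[of _ "K \<times> K \<times> K"]) (use K(1) in \<open>auto simp: V_def split: if_splits\<close>)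
    moreover have "V i \<subseteq> ?D" if "i \<in> ?I" for i
      using that c C_sub by (auto simp: V_def PiE_iff)
    ultimately have "openin ?T (Pi\<^sub>E ?I V)"
      unfolding openin_PiE_gen by simp
    moreover have "{c} = Pi\<^sub>E ?I V \<inter> ?C"
    proof
      show "{c} \<subseteq> Pi\<^sub>E ?I V \<inter> ?C"
        using c C_sub by (auto simp: V_def PiE_iff)
      show "Pi\<^sub>E ?I V \<inter> ?C \<subseteq> {c}"
      proof
        fix c' assume c': "c' \<in> Pi\<^sub>E ?I V \<inter> ?C"
        have "c' (u, v, w) = c (u, v, w)" if "u \<in> K" "v \<in> K" "w \<in> K" for u v w
        proof -
          have "(u, v, w) \<in> ?I" using that K(2) by auto
          then have "c' (u, v, w) \<in> V (u, v, w)" using c' by (auto simp: PiE_iff)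
          then show ?thesis using that by (simp add: V_def)
        qed
        then have "c' = c" using K(3) c' by blast
        then show "c' \<in> {c}" by simp
      qed
    qed
    ultimately show "openin (CO G) {c}" unfolding CO_def openin_subtopology by blast
  qed
  then show ?thesis by (auto simp: isolated_point_def topspace_CO)
qed

lemma carrier_free_group: "carrier (free_group S) = words S"
  by (simp add: free_group_def words_def)

lemma isolated_point_free_group_iff:
  "(\<exists>c. isolated_point (CO (free_group S)) c) \<longleftrightarrow>
    (\<exists>c\<in>circular_orders (free_group S). \<exists>K. finite K \<and> K \<subseteq> words S \<and> (\<forall>c'\<in>circular_orders (free_group S).
      (\<forall>u\<in>K. \<forall>v\<in>K. \<forall>w\<in>K. c' (u, v, w) = c (u, v, w)) \<longrightarrow> c' = c))"
  by (simp add: isolated_point_iff carrier_free_group Bex_def)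

theorem theorem1p3:
  fixes n :: nat
  assumes "n > 0"
  shows "(\<exists>c. isolated_point (CO (free_group {..<n})) c) \<longleftrightarrow> even n"
proof
  assume "\<exists>c. isolated_point (CO (free_group {..<n})) c"
  then obtain c K where c: "c \<in> circular_orders (free_group {..<n})" and K: "finite K" "K \<subseteq> words {..<n}"
    and det: "\<forall>c'\<in>circular_orders (free_group {..<n}).
      (\<forall>u\<in>K. \<forall>v\<in>K. \<forall>w\<in>K. c' (u, v, w) = c (u, v, w)) \<longrightarrow> c' = c"
    unfolding isolated_point_free_group_iff by (elim bexE exE conjE)
  interpret cyclic_order "words {..<n}" c
    using c by (simp add: circular_orders_iff)
  interpret isolated_order "{..<n}" c K
  proof
    show "c' (u, v, w) = c (u, v, w)"
      if "c' \<in> circular_orders (free_group {..<n})"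
        "\<And>u v w. \<lbrakk>u \<in> K; v \<in> K; w \<in> K\<rbrakk> \<Longrightarrow> c' (u, v, w) = c (u, v, w)" for c' u v w
      using det that by blast
  qed (use c K in \<open>auto simp: circular_orders_iff\<close>)
  obtain t where "t \<in> words {..<n}" "t \<noteq> []" "\<forall>g\<in>words {..<n}. \<not> btw [] g t"
    using ex_successor assms by blast
  then interpret isolated_successor "{..<n}" c K t
    by unfold_locales auto
  show "even n" using even_card_generators by simp
next
  assume "even n"
  then obtain K where K: "finite K" "K \<subseteq> words {..<n}"
    and det: "\<forall>c\<in>circular_orders (free_group {..<n}).
      (\<forall>u\<in>K. \<forall>v\<in>K. \<forall>w\<in>K. c (u, v, w) = tree_order (u, v, w)) \<longrightarrow>
      (\<forall>u\<in>words {..<n}. \<forall>v\<in>words {..<n}. \<forall>w\<in>words {..<n}. c (u, v, w) = tree_order (u, v, w))"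
    using tree_order_determined[OF \<open>even n\<close>] by (elim exE conjE)
  let ?W3 = "words {..<n} \<times> words {..<n} \<times> words {..<n}"
  let ?c = "restrict tree_order ?W3"
  have "c' = ?c" if c': "c' \<in> circular_orders (free_group {..<n})"
    and agree: "\<forall>u\<in>K. \<forall>v\<in>K. \<forall>w\<in>K. c' (u, v, w) = ?c (u, v, w)" for c'
  proof (rule extensionalityI)
    show "c' \<in> extensional ?W3" using c' by (simp add: circular_orders_iff)
    have "\<forall>u\<in>K. \<forall>v\<in>K. \<forall>w\<in>K. c' (u, v, w) = tree_order (u, v, w)"
      using agree K(2) by (auto simp: subset_iff)
    then have "\<forall>u\<in>words {..<n}. \<forall>v\<in>words {..<n}. \<forall>w\<in>words {..<n}. c' (u, v, w) = tree_order (u, v, w)"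
      using det c' by blast
    then show "c' g = ?c g" if "g \<in> ?W3" for g
      using that by (cases g) auto
  qed simp
  then show "\<exists>c. isolated_point (CO (free_group {..<n})) c"
    unfolding isolated_point_free_group_iff
    by (intro bexI[OF _ tree_order_circular] exI[of _ K] conjI ballI impI K)
qed

end
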